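(* Let $A$ be a simple, exact, finite, separable, unital $C^*$-algebra with strict comparison and at most countably many extreme traces. Let $\alpha\colon G\to\mathrm{Aut}(A)$ be an action of a finite group $G$ with finite Rokhlin dimension with commuting towers. If all traces on $A$ are quasidiagonal, then every trace on $A\rtimes_\alpha G$ is quasidiagonal.
   Context: "Trace" means tracial state; an extreme trace is an extreme point of the set $T(A)$ of tracial states. $\mathrm{tr}_k$ denotes the normalized trace on $M_k=M_k(\mathbb{C})$. Quasidiagonal trace: a trace $\tau$ on a $C^*$-algebra $A$ is quasidiagonal if there is a net of completely positive contractive maps $\phi_i\colon A\to M_{k(i)}$ such that $|\mathrm{tr}_{k(i)}(\phi_i(a))-\tau(a)|\to 0$ and $\|\phi_i(ab)-\phi_i(a)\phi_i(b)\|\to 0$ for all $a,b\in A$. A unital $C^*$-algebra is finite if its unit is not Murray-von Neumann equivalent to a proper subprojection. Strict comparison (for simple, exact, unital $A$): for all positive $a,b\in\bigcup_n M_n(A)$ with $b\neq 0$, if $d_\tau(a)<d_\tau(b)$ for all $\tau\in T(A)$ then $a\precsim b$, where $d_\tau(a)=\lim_{n\to\infty}\tau(a^{1/n})$ (with $\tau$ extended to matrices by the unnormalized trace), and $a\precsim b$ denotes Cuntz subequivalence, i.e. $\|a-v_n b v_n^*\|\to 0$ for some sequence $(v_n)$. Rokhlin dimension with commuting towers: an action $\alpha\colon G\to\mathrm{Aut}(A)$ of a finite group on a separable unital $C^*$-algebra has finite Rokhlin dimension with commuting towers if there is an integer $d\ge 0$ such that for every finite set $F\subseteq A$ and every $\varepsilon>0$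 there are positive contractions $f_g^{(l)}\in A$, $g\in G$, $l=0,\dots,d$, satisfying, for all $g,h\in G$, $k,l\in\{0,\dots,d\}$ and $a\in F$: (1) $\|\alpha_h(f_g^{(l)})-f_{hg}^{(l)}\|\le\varepsilon$; (2) $\|f_g^{(l)}a-af_g^{(l)}\|\le\varepsilon$; (3) $\|f_g^{(l)}f_h^{(l)}\|\le\varepsilon$ whenever $g\ne h$; (4) $\big\|\sum_{l=0}^d\sum_{g\in G}f_g^{(l)}-1\big\|\le\varepsilon$; (5) $\|f_g^{(l)}f_h^{(k)}-f_h^{(k)}f_g^{(l)}\|\le\varepsilon$. *)

theory Defs
  imports
    "HOL-Analysis.Analysis"
    "HOL-Algebra.Module"
    "HOL-Algebra.Ideal"
    "HOL-Algebra.Group_Action"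
begin

section \<open>Unital C*-algebras\<close>

text \<open>
  C*-algebras are records with an explicit carrier, extending the modules of HOL-Algebra, because
  matrix algebras and crossed products depend on term parameters and so cannot be type class
  instances.
\<close>

record 'a cstar_struct = "(complex, 'a) module" +
  adj :: "'a \<Rightarrow> 'a"
  cnorm :: "'a \<Rightarrow> real"

definition complex_cstar :: "complex cstar_struct" where
  "complex_cstar = \<lparr>carrier = UNIV, mult = (*), one = 1, zero = 0, add = (+),
     smult = (*), adj = cnj, cnorm = cmod\<rparr>"

locale cstar_algebra = ring A + Module.module complex_cstar A for A :: "'a cstar_struct" (structure) +
  assumes smult_mult_left:
      "\<lbrakk>x \<in> carrier A; y \<in> carrier A\<rbrakk> \<Longrightarrow> (c \<odot> x) \<otimes> y = c \<odot> (x \<otimes> y)"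
    and smult_mult_right:
      "\<lbrakk>x \<in> carrier A; y \<in> carrier A\<rbrakk> \<Longrightarrow> x \<otimes> (c \<odot> y) = c \<odot> (x \<otimes> y)"
    and adj_closed: "x \<in> carrier A \<Longrightarrow> adj A x \<in> carrier A"
    and adj_adj: "x \<in> carrier A \<Longrightarrow> adj A (adj A x) = x"
    and adj_add: "\<lbrakk>x \<in> carrier A; y \<in> carrier A\<rbrakk> \<Longrightarrow> adj A (x \<oplus> y) = adj A x \<oplus> adj A y"
    and adj_smult: "x \<in> carrier A \<Longrightarrow> adj A (c \<odot> x) = cnj c \<odot> adj A x"
    and adj_mult: "\<lbrakk>x \<in> carrier A; y \<in> carrier A\<rbrakk> \<Longrightarrow> adj A (x \<otimes> y) = adj A y \<otimes> adj A x"
    and cnorm_nonneg: "x \<in> carrier A \<Longrightarrow> 0 \<le> cnorm A x"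
    and cnorm_eq_0: "x \<in> carrier A \<Longrightarrow> cnorm A x = 0 \<longleftrightarrow> x = \<zero>"
    and cnorm_smult: "x \<in> carrier A \<Longrightarrow> cnorm A (c \<odot> x) = cmod c * cnorm A x"
    and cnorm_triangle:
      "\<lbrakk>x \<in> carrier A; y \<in> carrier A\<rbrakk> \<Longrightarrow> cnorm A (x \<oplus> y) \<le> cnorm A x + cnorm A y"
    and cnorm_mult:
      "\<lbrakk>x \<in> carrier A; y \<in> carrier A\<rbrakk> \<Longrightarrow> cnorm A (x \<otimes> y) \<le> cnorm A x * cnorm A y"
    and cstar_identity: "x \<in> carrier A \<Longrightarrow> cnorm A (adj A x \<otimes> x) = (cnorm A x)\<^sup>2"
    and complete:
      "\<lbrakk>range X \<subseteq> carrier A; \<forall>e>0. \<exists>N. \<forall>m\<ge>N. \<forall>n\<ge>N. cnorm A (X m \<ominus> X n) < e\<rbrakk>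
        \<Longrightarrow> \<exists>x\<in>carrier A. (\<lambda>n. cnorm A (X n \<ominus> x)) \<longlonglongrightarrow> 0"

lemma cstar_algebra_complex: "cstar_algebra complex_cstar"
proof -
  have cr: "cring complex_cstar"
  proof (rule cringI)
    show "abelian_group complex_cstar"
      by (rule abelian_groupI)
        (auto simp: complex_cstar_def add.assoc add.commute intro: exI[of _ "- x" for x])
    show "Group.comm_monoid complex_cstar"
      by (rule comm_monoidI) (auto simp: complex_cstar_def)
  qed (auto simp: complex_cstar_def algebra_simps)
  have mo: "Module.module complex_cstar complex_cstar"
    using cr by (intro Module.module.intro cring.axioms Module.module_axioms.intro)
      (auto simp: complex_cstar_def algebra_simps cring_def ring_def)
  interpret R: cring complex_cstar by (rule cr)
  have neg: "\<ominus>\<^bsub>complex_cstar\<^esub> y = - y" for y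
    by (rule R.minus_equality) (auto simp: complex_cstar_def)
  have diff: "x \<ominus>\<^bsub>complex_cstar\<^esub> y = x - y" for x y
    unfolding a_minus_def neg by (simp add: complex_cstar_def)
  have compl: "\<exists>x\<in>carrier complex_cstar.
      (\<lambda>n. cnorm complex_cstar (X n \<ominus>\<^bsub>complex_cstar\<^esub> x)) \<longlonglongrightarrow> 0"
    if "\<forall>e>0. \<exists>N. \<forall>m\<ge>N. \<forall>n\<ge>N. cnorm complex_cstar (X m \<ominus>\<^bsub>complex_cstar\<^esub> X n) < e"
    for X
  proof -
    have "Cauchy X"
      using that unfolding diff Cauchy_def by (simp add: complex_cstar_def dist_norm)
    then obtain L where "X \<longlonglongrightarrow> L" using Cauchy_convergent_iff convergent_def by blast
    then have "(\<lambda>n. cmod (X n - L)) \<longlonglongrightarrow> 0"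
      by (simp add: LIM_zero_iff tendsto_norm_zero_iff)
    then show ?thesis unfolding diff by (auto simp: complex_cstar_def)
  qed
  show ?thesis
    by (intro cstar_algebra.intro cstar_algebra_axioms.intro R.ring_axioms mo compl)
      (auto simp: complex_cstar_def norm_mult norm_triangle_ineq power2_eq_square)
qed

definition cstar_positive :: "'a cstar_struct \<Rightarrow> 'a \<Rightarrow> bool" where
  "cstar_positive A a \<longleftrightarrow> (\<exists>x\<in>carrier A. a = adj A x \<otimes>\<^bsub>A\<^esub> x)"

definition cstar_separable :: "'a cstar_struct \<Rightarrow> bool" where
  "cstar_separable A \<longleftrightarrow> (\<exists>D. countable D \<and> D \<subseteq> carrier A \<and>
     (\<forall>a\<in>carrier A. \<forall>e>0. \<exists>d\<in>D. cnorm A (a \<ominus>\<^bsub>A\<^esub> d) < e))"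

definition cstar_closed :: "'a cstar_struct \<Rightarrow> 'a set \<Rightarrow> bool" where
  "cstar_closed A I \<longleftrightarrow> (\<forall>X x. range X \<subseteq> I \<and> x \<in> carrier A \<and>
     (\<lambda>n::nat. cnorm A (X n \<ominus>\<^bsub>A\<^esub> x)) \<longlonglongrightarrow> 0 \<longrightarrow> x \<in> I)"

definition cstar_simple :: "'a cstar_struct \<Rightarrow> bool" where
  "cstar_simple A \<longleftrightarrow> carrier A \<noteq> {\<zero>\<^bsub>A\<^esub>} \<and>
     (\<forall>I. ideal I A \<and> cstar_closed A I \<longrightarrow> I = {\<zero>\<^bsub>A\<^esub>} \<or> I = carrier A)"

definition is_projection :: "'a cstar_struct \<Rightarrow> 'a \<Rightarrow> bool" where
  "is_projection A p \<longleftrightarrow> p \<in> carrier A \<and> adj A p = p \<and> p \<otimes>\<^bsub>A\<^esub> p = p"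

definition mvn_equivalent :: "'a cstar_struct \<Rightarrow> 'a \<Rightarrow> 'a \<Rightarrow> bool" where
  "mvn_equivalent A p q \<longleftrightarrow>
     (\<exists>v\<in>carrier A. adj A v \<otimes>\<^bsub>A\<^esub> v = p \<and> v \<otimes>\<^bsub>A\<^esub> adj A v = q)"

text \<open>Every projection is a subprojection of the unit.\<close>

definition cstar_finite :: "'a cstar_struct \<Rightarrow> bool" where
  "cstar_finite A \<longleftrightarrow>
     \<not> (\<exists>q. is_projection A q \<and> q \<noteq> \<one>\<^bsub>A\<^esub> \<and> mvn_equivalent A \<one>\<^bsub>A\<^esub> q)"

section \<open>Matrix algebras and completely positive maps\<close>

text \<open>
  For a finite set \<open>I\<close>, the functions from \<open>I\<close> to \<open>A\<close> form the Hilbert \<open>A\<close>-module with inner product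
  \<open>\<langle>\<xi>, \<eta>\<rangle> = \<Sum>i\<in>I. \<xi>\<^sub>i* \<eta>\<^sub>i\<close>. The norms of matrix algebras and of crossed products are operator norms
  on such modules.
\<close>

definition hilbert_module_norm :: "'a cstar_struct \<Rightarrow> 'i set \<Rightarrow> ('i \<Rightarrow> 'a) \<Rightarrow> real" where
  "hilbert_module_norm A I \<xi> = sqrt (cnorm A (\<Oplus>\<^bsub>A\<^esub>i\<in>I. adj A (\<xi> i) \<otimes>\<^bsub>A\<^esub> \<xi> i))"

definition hilbert_module_op_norm ::
    "'a cstar_struct \<Rightarrow> 'i set \<Rightarrow> (('i \<Rightarrow> 'a) \<Rightarrow> ('i \<Rightarrow> 'a)) \<Rightarrow> real" where
  "hilbert_module_op_norm A I T =
     (SUP \<xi>\<in>{\<xi>. \<xi> \<in> I \<rightarrow> carrier A \<and> hilbert_module_norm A I \<xi> \<le> 1}.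
        hilbert_module_norm A I (T \<xi>))"

text \<open>
  Entries outside the \<open>n \<times> n\<close> block are zero. Hence the carriers increase with \<open>n\<close>, the inclusions
  being the usual embeddings \<open>x \<mapsto> diag(x, 0)\<close>.
\<close>

definition matrix_algebra :: "nat \<Rightarrow> 'a cstar_struct \<Rightarrow> (nat \<Rightarrow> nat \<Rightarrow> 'a) cstar_struct" where
  "matrix_algebra n A = \<lparr>
     carrier = {X. \<forall>i j. (i < n \<and> j < n \<longrightarrow> X i j \<in> carrier A) \<and>
                         (\<not> (i < n \<and> j < n) \<longrightarrow> X i j = \<zero>\<^bsub>A\<^esub>)},
     mult = (\<lambda>X Y i j. if i < n \<and> j < n then \<Oplus>\<^bsub>A\<^esub>k\<in>{..<n}. X i k \<otimes>\<^bsub>A\<^esub> Y k j else \<zero>\<^bsub>A\<^esub>),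
     one = (\<lambda>i j. if i < n \<and> i = j then \<one>\<^bsub>A\<^esub> else \<zero>\<^bsub>A\<^esub>),
     zero = (\<lambda>i j. \<zero>\<^bsub>A\<^esub>),
     add = (\<lambda>X Y i j. X i j \<oplus>\<^bsub>A\<^esub> Y i j),
     smult = (\<lambda>c X i j. c \<odot>\<^bsub>A\<^esub> X i j),
     adj = (\<lambda>X i j. adj A (X j i)),
     cnorm = (\<lambda>X. hilbert_module_op_norm A {..<n}
                (\<lambda>\<xi> i. \<Oplus>\<^bsub>A\<^esub>j\<in>{..<n}. X i j \<otimes>\<^bsub>A\<^esub> \<xi> j))\<rparr>"

definition cstar_linear :: "'a cstar_struct \<Rightarrow> 'b cstar_struct \<Rightarrow> ('a \<Rightarrow> 'b) \<Rightarrow> bool" where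
  "cstar_linear A B \<phi> \<longleftrightarrow> \<phi> \<in> carrier A \<rightarrow> carrier B \<and>
     (\<forall>x\<in>carrier A. \<forall>y\<in>carrier A. \<phi> (x \<oplus>\<^bsub>A\<^esub> y) = \<phi> x \<oplus>\<^bsub>B\<^esub> \<phi> y) \<and>
     (\<forall>c. \<forall>x\<in>carrier A. \<phi> (c \<odot>\<^bsub>A\<^esub> x) = c \<odot>\<^bsub>B\<^esub> \<phi> x)"

definition star_hom :: "'a cstar_struct \<Rightarrow> 'b cstar_struct \<Rightarrow> ('a \<Rightarrow> 'b) \<Rightarrow> bool" where
  "star_hom A B \<phi> \<longleftrightarrow> cstar_linear A B \<phi> \<and>
     (\<forall>x\<in>carrier A. \<forall>y\<in>carrier A. \<phi> (x \<otimes>\<^bsub>A\<^esub> y) = \<phi> x \<otimes>\<^bsub>B\<^esub> \<phi> y) \<and>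
     (\<forall>x\<in>carrier A. \<phi> (adj A x) = adj B (\<phi> x))"

definition cp_contractive :: "'a cstar_struct \<Rightarrow> 'b cstar_struct \<Rightarrow> ('a \<Rightarrow> 'b) \<Rightarrow> bool" where
  "cp_contractive A B \<phi> \<longleftrightarrow> cstar_linear A B \<phi> \<and>
     (\<forall>n X. cstar_positive (matrix_algebra n A) X \<longrightarrow>
        cstar_positive (matrix_algebra n B) (\<lambda>i j. \<phi> (X i j))) \<and>
     (\<forall>x\<in>carrier A. cnorm B (\<phi> x) \<le> cnorm A x)"

section \<open>Exactness\<close>

text \<open>Every Hilbert space is isomorphic to some \<open>\<ell>\<^sup>2(S)\<close>.\<close>

definition l2_space :: "'i set \<Rightarrow> ('i \<Rightarrow> complex) set" where
  "l2_space S = {\<xi>. (\<forall>i. i \<notin> S \<longrightarrow> \<xi> i = 0) \<and> (\<lambda>i. (cmod (\<xi> i))\<^sup>2) summable_on S}"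

definition l2_inner :: "'i set \<Rightarrow> ('i \<Rightarrow> complex) \<Rightarrow> ('i \<Rightarrow> complex) \<Rightarrow> complex" where
  "l2_inner S \<xi> \<eta> = (\<Sum>\<^sub>\<infinity>i\<in>S. cnj (\<xi> i) * \<eta> i)"

definition l2_norm :: "'i set \<Rightarrow> ('i \<Rightarrow> complex) \<Rightarrow> real" where
  "l2_norm S \<xi> = sqrt (\<Sum>\<^sub>\<infinity>i\<in>S. (cmod (\<xi> i))\<^sup>2)"

definition bounded_operators :: "'i set \<Rightarrow> (('i \<Rightarrow> complex) \<Rightarrow> ('i \<Rightarrow> complex)) set" where
  "bounded_operators S = {T. T \<in> l2_space S \<rightarrow>\<^sub>E l2_space S \<and>
     (\<forall>\<xi>\<in>l2_space S. \<forall>\<eta>\<in>l2_space S. T (\<lambda>i. \<xi> i + \<eta> i) = (\<lambda>i. T \<xi> i + T \<eta> i)) \<and>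
     (\<forall>c. \<forall>\<xi>\<in>l2_space S. T (\<lambda>i. c * \<xi> i) = (\<lambda>i. c * T \<xi> i)) \<and>
     (\<exists>M. \<forall>\<xi>\<in>l2_space S. l2_norm S (T \<xi>) \<le> M * l2_norm S \<xi>)}"

definition operator_algebra ::
    "'i set \<Rightarrow> (('i \<Rightarrow> complex) \<Rightarrow> ('i \<Rightarrow> complex)) cstar_struct" where
  "operator_algebra S = \<lparr>
     carrier = bounded_operators S,
     mult = compose (l2_space S),
     one = (\<lambda>\<xi>\<in>l2_space S. \<xi>),
     zero = (\<lambda>\<xi>\<in>l2_space S. (\<lambda>i. 0)),
     add = (\<lambda>T U. \<lambda>\<xi>\<in>l2_space S. (\<lambda>i. T \<xi> i + U \<xi> i)),
     smult = (\<lambda>c T. \<lambda>\<xi>\<in>l2_space S. (\<lambda>i. c * T \<xi> i)),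
     adj = (\<lambda>T. THE U. U \<in> bounded_operators S \<and>
        (\<forall>\<xi>\<in>l2_space S. \<forall>\<eta>\<in>l2_space S. l2_inner S (T \<xi>) \<eta> = l2_inner S \<xi> (U \<eta>))),
     cnorm = (\<lambda>T. SUP \<xi>\<in>{\<xi>\<in>l2_space S. l2_norm S \<xi> \<le> 1}. l2_norm S (T \<xi>))\<rparr>"

definition nuclear_map :: "'a cstar_struct \<Rightarrow> 'b cstar_struct \<Rightarrow> ('a \<Rightarrow> 'b) \<Rightarrow> bool" where
  "nuclear_map A B \<theta> \<longleftrightarrow> (\<forall>F \<epsilon>. finite F \<and> F \<subseteq> carrier A \<and> 0 < \<epsilon> \<longrightarrow>
     (\<exists>n \<phi> \<psi>. 0 < n \<and>
        cp_contractive A (matrix_algebra n complex_cstar) \<phi> \<and>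
        cp_contractive (matrix_algebra n complex_cstar) B \<psi> \<and>
        (\<forall>a\<in>F. cnorm B (\<psi> (\<phi> a) \<ominus>\<^bsub>B\<^esub> \<theta> a) < \<epsilon>)))"

text \<open>
  Exactness in the sense of Brown and Ozawa: some faithful representation is nuclear. Taking
  \<open>S \<subseteq> 'a\<close> is no restriction: a unital C*-algebra has a faithful representation on a Hilbert space
  of dimension at most its cardinality, and by Arveson extension nuclearity does not depend on
  the choice of the faithful representation.
\<close>

definition cstar_exact :: "'a cstar_struct \<Rightarrow> bool" where
  "cstar_exact A \<longleftrightarrow> (\<exists>(S :: 'a set) \<pi>. star_hom A (operator_algebra S) \<pi> \<and>
     inj_on \<pi> (carrier A) \<and> nuclear_map A (operator_algebra S) \<pi>)"

section \<open>Traces\<close>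

text \<open>
  Functionals are extensional, so that distinct elements of \<open>tracial_states A\<close> are distinct on
  \<open>carrier A\<close> and the extreme traces can be counted.
\<close>

definition tracial_states :: "'a cstar_struct \<Rightarrow> ('a \<Rightarrow> complex) set" where
  "tracial_states A = {\<tau>. \<tau> \<in> extensional (carrier A) \<and> cstar_linear A complex_cstar \<tau> \<and>
     (\<forall>a. cstar_positive A a \<longrightarrow> \<tau> a \<in> \<real>\<^sub>\<ge>\<^sub>0) \<and>
     \<tau> \<one>\<^bsub>A\<^esub> = 1 \<and>
     (\<forall>a\<in>carrier A. \<forall>b\<in>carrier A. \<tau> (a \<otimes>\<^bsub>A\<^esub> b) = \<tau> (b \<otimes>\<^bsub>A\<^esub> a))}"

definition extreme_traces :: "'a cstar_struct \<Rightarrow> ('a \<Rightarrow> complex) set" where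
  "extreme_traces A = {\<tau> \<in> tracial_states A.
     \<forall>\<rho>\<in>tracial_states A. \<forall>\<sigma>\<in>tracial_states A. \<forall>t::real. 0 < t \<and> t < 1 \<and>
       (\<forall>a\<in>carrier A. \<tau> a = of_real t * \<rho> a + of_real (1 - t) * \<sigma> a) \<longrightarrow> \<rho> = \<tau> \<and> \<sigma> = \<tau>}"

definition normalized_trace :: "nat \<Rightarrow> (nat \<Rightarrow> nat \<Rightarrow> complex) \<Rightarrow> complex" where
  "normalized_trace k X = (\<Sum>i<k. X i i) / of_nat k"

text \<open>
  The net of maps \<open>\<phi>\<^sub>i : A \<rightarrow> M\<^sub>k\<^sub>(\<^sub>i\<^sub>)\<close> is represented by the filter on pairs \<open>(k, \<phi>)\<close> that is
  generated by its tails. Thus no index type has to be chosen; conversely, every such proper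
  filter arises from a net.
\<close>

definition quasidiagonal_trace :: "'a cstar_struct \<Rightarrow> ('a \<Rightarrow> complex) \<Rightarrow> bool" where
  "quasidiagonal_trace A \<tau> \<longleftrightarrow> (\<exists>\<N> :: (nat \<times> ('a \<Rightarrow> nat \<Rightarrow> nat \<Rightarrow> complex)) filter.
     \<N> \<noteq> bot \<and>
     (\<forall>\<^sub>F (k, \<phi>) in \<N>. 0 < k \<and> cp_contractive A (matrix_algebra k complex_cstar) \<phi>) \<and>
     (\<forall>a\<in>carrier A. ((\<lambda>(k, \<phi>). cmod (normalized_trace k (\<phi> a) - \<tau> a)) \<longlongrightarrow> 0) \<N>) \<and>
     (\<forall>a\<in>carrier A. \<forall>b\<in>carrier A.
        ((\<lambda>(k, \<phi>). cnorm (matrix_algebra k complex_cstar)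
            (\<phi> (a \<otimes>\<^bsub>A\<^esub> b) \<ominus>\<^bsub>matrix_algebra k complex_cstar\<^esub>
              (\<phi> a \<otimes>\<^bsub>matrix_algebra k complex_cstar\<^esub> \<phi> b))) \<longlongrightarrow> 0) \<N>))"

section \<open>Strict comparison\<close>

text \<open>\<open>a\<^sup>1\<^sup>/\<^sup>m\<close> is the unique positive \<open>m\<close>-th root of the positive element \<open>a\<close>.\<close>

definition positive_root :: "'a cstar_struct \<Rightarrow> nat \<Rightarrow> 'a \<Rightarrow> 'a" where
  "positive_root A m a = (THE x. cstar_positive A x \<and> x [^]\<^bsub>A\<^esub> m = a)"

definition matrix_trace :: "('a \<Rightarrow> complex) \<Rightarrow> nat \<Rightarrow> (nat \<Rightarrow> nat \<Rightarrow> 'a) \<Rightarrow> complex" where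
  "matrix_trace \<tau> n X = (\<Sum>i<n. \<tau> (X i i))"

definition dimension_function ::
    "'a cstar_struct \<Rightarrow> ('a \<Rightarrow> complex) \<Rightarrow> nat \<Rightarrow> (nat \<Rightarrow> nat \<Rightarrow> 'a) \<Rightarrow> real" where
  "dimension_function A \<tau> n a =
     lim (\<lambda>m. Re (matrix_trace \<tau> n (positive_root (matrix_algebra n A) (Suc m) a)))"

definition cuntz_subequivalent :: "'a cstar_struct \<Rightarrow> 'a \<Rightarrow> 'a \<Rightarrow> bool" where
  "cuntz_subequivalent A a b \<longleftrightarrow> (\<exists>v :: nat \<Rightarrow> 'a. range v \<subseteq> carrier A \<and>
     (\<lambda>m. cnorm A (a \<ominus>\<^bsub>A\<^esub> (v m \<otimes>\<^bsub>A\<^esub> b \<otimes>\<^bsub>A\<^esub> adj A (v m)))) \<longlonglongrightarrow> 0)"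

text \<open>
  Two elements of \<open>\<Union>\<^sub>n M\<^sub>n(A)\<close> lie in a common \<open>M\<^sub>n(A)\<close>, and elements \<open>v\<close> of a larger matrix algebra
  may be compressed to it.
\<close>

definition strict_comparison :: "'a cstar_struct \<Rightarrow> bool" where
  "strict_comparison A \<longleftrightarrow> (\<forall>n a b.
     cstar_positive (matrix_algebra n A) a \<and> cstar_positive (matrix_algebra n A) b \<and>
     b \<noteq> \<zero>\<^bsub>matrix_algebra n A\<^esub> \<and>
     (\<forall>\<tau>\<in>tracial_states A. dimension_function A \<tau> n a < dimension_function A \<tau> n b) \<longrightarrow>
     cuntz_subequivalent (matrix_algebra n A) a b)"

section \<open>Actions of finite groups\<close>

definition cstar_action ::
    "('g, 'm) monoid_scheme \<Rightarrow> 'a cstar_struct \<Rightarrow> ('g \<Rightarrow> 'a \<Rightarrow> 'a) \<Rightarrow> bool" where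
  "cstar_action G A \<alpha> \<longleftrightarrow> group_action G (carrier A) \<alpha> \<and> (\<forall>g\<in>carrier G. star_hom A A (\<alpha> g))"

text \<open>
  For finite \<open>G\<close> the algebraic crossed product is already complete and has a unique C*-norm. The norm
  used here is that of the regular representation on the Hilbert module of functions from \<open>G\<close> to
  \<open>A\<close>, given by \<open>(a \<xi>)(t) = \<alpha>\<^sub>t\<inverse>(a) \<xi>(t)\<close> and \<open>(u\<^sub>s \<xi>)(t) = \<xi>(s\<inverse> t)\<close>. The function \<open>f\<close> stands for
  \<open>\<Sum>s. f(s) u\<^sub>s\<close>.
\<close>

definition crossed_product ::
    "('g, 'm) monoid_scheme \<Rightarrow> 'a cstar_struct \<Rightarrow> ('g \<Rightarrow> 'a \<Rightarrow> 'a) \<Rightarrow> ('g \<Rightarrow> 'a) cstar_struct" where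
  "crossed_product G A \<alpha> = \<lparr>
     carrier = carrier G \<rightarrow>\<^sub>E carrier A,
     mult = (\<lambda>f h. \<lambda>t\<in>carrier G.
        \<Oplus>\<^bsub>A\<^esub>s\<in>carrier G. f s \<otimes>\<^bsub>A\<^esub> \<alpha> s (h (inv\<^bsub>G\<^esub> s \<otimes>\<^bsub>G\<^esub> t))),
     one = (\<lambda>t\<in>carrier G. if t = \<one>\<^bsub>G\<^esub> then \<one>\<^bsub>A\<^esub> else \<zero>\<^bsub>A\<^esub>),
     zero = (\<lambda>t\<in>carrier G. \<zero>\<^bsub>A\<^esub>),
     add = (\<lambda>f h. \<lambda>t\<in>carrier G. f t \<oplus>\<^bsub>A\<^esub> h t),
     smult = (\<lambda>c f. \<lambda>t\<in>carrier G. c \<odot>\<^bsub>A\<^esub> f t),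
     adj = (\<lambda>f. \<lambda>t\<in>carrier G. \<alpha> t (adj A (f (inv\<^bsub>G\<^esub> t)))),
     cnorm = (\<lambda>f. hilbert_module_op_norm A (carrier G)
        (\<lambda>\<xi> t. \<Oplus>\<^bsub>A\<^esub>s\<in>carrier G. \<alpha> (inv\<^bsub>G\<^esub> t) (f s) \<otimes>\<^bsub>A\<^esub> \<xi> (inv\<^bsub>G\<^esub> s \<otimes>\<^bsub>G\<^esub> t)))\<rparr>"

definition finite_rokhlin_dimension_commuting_towers ::
    "('g, 'm) monoid_scheme \<Rightarrow> 'a cstar_struct \<Rightarrow> ('g \<Rightarrow> 'a \<Rightarrow> 'a) \<Rightarrow> bool" where
  "finite_rokhlin_dimension_commuting_towers G A \<alpha> \<longleftrightarrow> (\<exists>d::nat. \<forall>F \<epsilon>.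
     finite F \<and> F \<subseteq> carrier A \<and> 0 < \<epsilon> \<longrightarrow>
     (\<exists>f :: nat \<Rightarrow> 'g \<Rightarrow> 'a.
        (\<forall>l\<le>d. \<forall>g\<in>carrier G. cstar_positive A (f l g) \<and> cnorm A (f l g) \<le> 1) \<and>
        (\<forall>l\<le>d. \<forall>g\<in>carrier G. \<forall>h\<in>carrier G.
           cnorm A (\<alpha> h (f l g) \<ominus>\<^bsub>A\<^esub> f l (h \<otimes>\<^bsub>G\<^esub> g)) \<le> \<epsilon>) \<and>
        (\<forall>l\<le>d. \<forall>g\<in>carrier G. \<forall>a\<in>F.
           cnorm A ((f l g \<otimes>\<^bsub>A\<^esub> a) \<ominus>\<^bsub>A\<^esub> (a \<otimes>\<^bsub>A\<^esub> f l g)) \<le> \<epsilon>) \<and>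
        (\<forall>l\<le>d. \<forall>g\<in>carrier G. \<forall>h\<in>carrier G. g \<noteq> h \<longrightarrow>
           cnorm A (f l g \<otimes>\<^bsub>A\<^esub> f l h) \<le> \<epsilon>) \<and>
        cnorm A ((\<Oplus>\<^bsub>A\<^esub>l\<in>{..d}. \<Oplus>\<^bsub>A\<^esub>g\<in>carrier G. f l g) \<ominus>\<^bsub>A\<^esub> \<one>\<^bsub>A\<^esub>) \<le> \<epsilon> \<and>
        (\<forall>k\<le>d. \<forall>l\<le>d. \<forall>g\<in>carrier G. \<forall>h\<in>carrier G.
           cnorm A ((f l g \<otimes>\<^bsub>A\<^esub> f k h) \<ominus>\<^bsub>A\<^esub> (f k h \<otimes>\<^bsub>A\<^esub> f l g)) \<le> \<epsilon>)))"

end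

theory Submission
  imports Defs
begin

text \<open>
  Since the group is finite, the crossed product \<open>B\<close> embeds into \<open>M\<^sub>N(A)\<close>, \<open>N = |G|\<close>, by the regular
  representation. If a trace \<open>\<tau>\<close> on \<open>B\<close> vanishes on \<open>a u\<^sub>g\<close> for \<open>g \<noteq> 1\<close>, it is the restriction to \<open>B\<close> of
  \<open>\<tau>\<^sub>0 \<otimes> tr\<close> with \<open>\<tau>\<^sub>0 = \<tau>|A\<close>, and amplifying the maps that witness quasidiagonality of \<open>\<tau>\<^sub>0\<close> gives maps
  for \<open>\<tau>\<close>. The Rokhlin towers \<open>p\<^sub>i\<close> give the vanishing: insert \<open>\<Sum>i. p\<^sub>i \<approx> 1\<close> repeatedly; by pigeonhole and
  commutation each resulting term is of the form \<open>\<tau>(p\<^sub>i\<^sup>2 x u\<^sub>g) \<approx> \<tau>(p\<^sub>i \<alpha>\<^sub>g(p\<^sub>i) x u\<^sub>g) \<approx> 0\<close>. The functional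
  analysis needed (positivity of \<open>x* x\<close>, operator norms of matrices over \<open>A\<close>) is obtained from square
  roots alone.
\<close>

section \<open>Square roots in C*-algebras\<close>

text \<open>One insertion of the towers gives terms with a single factor p_i, and moving it around
  u_g makes nothing small: orthogonality needs two factors from one tower. Writing p_i as the square
  of its root would supply them, but calls for approximate equivariance and orthogonality of roots;
  repeating an index keeps everything polynomial in the towers. Between the two equal factors there
  may stand members of other towers, which are not orthogonal to them, so the factors can be brought
  together only because the towers commute. The errors of the swaps do no harm: the number d + 1 of
  towers, hence the length of the words, is fixed before the tolerance.

  For the amplified maps the obstacle is contractivity. Block by block, an N by N matrix over M_k is
  bounded only up to a constant depending on N, and complete positivity has to remove that constant.
  On the side of the trace, \<tau>_0 is \<alpha>-invariant, so the N diagonal blocks of the regular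
  representation all have the same trace. The norm of \<open>B\<close> is accessed only through
  matrices over \<open>A\<close>.\<close>

lemma complex_cstar_simps [simp]:
  "carrier complex_cstar = UNIV" "mult complex_cstar = (*)" "one complex_cstar = 1"
  "zero complex_cstar = 0" "add complex_cstar = (+)" "smult complex_cstar = (*)"
  "adj complex_cstar = cnj" "cnorm complex_cstar = cmod"
  by (simp_all add: complex_cstar_def)

text \<open>
  Inside \<^locale>\<open>cstar_algebra\<close> the ring facts of the scalars shadow those of \<open>A\<close>; this locale exposes
  only the latter.
\<close>

locale unital_cstar = ring A for A :: "'a cstar_struct" (structure) +
  assumes cstar: "cstar_algebra A"
begin

lemma scalar_module: "Module.module complex_cstar A"
  using cstar by (simp add: cstar_algebra_def)

lemmas adj_closed [simp, intro] = cstar_algebra.adj_closed[OF cstar]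
  and adj_adj [simp] = cstar_algebra.adj_adj[OF cstar]
  and adj_add = cstar_algebra.adj_add[OF cstar]
  and adj_smult = cstar_algebra.adj_smult[OF cstar]
  and adj_mult = cstar_algebra.adj_mult[OF cstar]
  and smult_mult_left = cstar_algebra.smult_mult_left[OF cstar]
  and smult_mult_right = cstar_algebra.smult_mult_right[OF cstar]
  and cnorm_nonneg [simp] = cstar_algebra.cnorm_nonneg[OF cstar]
  and cnorm_eq_0 = cstar_algebra.cnorm_eq_0[OF cstar]
  and cnorm_smult = cstar_algebra.cnorm_smult[OF cstar]
  and cnorm_triangle = cstar_algebra.cnorm_triangle[OF cstar]
  and cnorm_mult = cstar_algebra.cnorm_mult[OF cstar]
  and cstar_identity = cstar_algebra.cstar_identity[OF cstar]
  and complete = cstar_algebra.complete[OF cstar]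

lemma scale_closed [simp, intro]: "x \<in> carrier A \<Longrightarrow> c \<odot> x \<in> carrier A"
  using Module.module.smult_closed[OF scalar_module, of c x] by simp

lemma scale_add_left: "x \<in> carrier A \<Longrightarrow> (c + d) \<odot> x = c \<odot> x \<oplus> d \<odot> x"
  using Module.module.smult_l_distr[OF scalar_module, of c d x] by simp

lemma scale_add_right: "x \<in> carrier A \<Longrightarrow> y \<in> carrier A \<Longrightarrow> c \<odot> (x \<oplus> y) = c \<odot> x \<oplus> c \<odot> y"
  using Module.module.smult_r_distr[OF scalar_module, of c x y] by simp

lemma scale_scale [simp]: "x \<in> carrier A \<Longrightarrow> c \<odot> (d \<odot> x) = (c * d) \<odot> x"
  using Module.module.smult_assoc1[OF scalar_module, of c d x] by simp

lemma scale_one [simp]: "x \<in> carrier A \<Longrightarrow> 1 \<odot> x = x"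
  using Module.module.smult_one[OF scalar_module, of x] by simp

lemma scale_zero_left [simp]: "x \<in> carrier A \<Longrightarrow> 0 \<odot> x = \<zero>"
  using Module.module.smult_l_null[OF scalar_module, of x] by simp

lemma scale_zero_right [simp]: "c \<odot> \<zero> = \<zero>"
  using Module.module.smult_r_null[OF scalar_module, of c] by simp

lemma minus_scale: "x \<in> carrier A \<Longrightarrow> \<ominus> x = (-1) \<odot> x"
proof -
  assume x: "x \<in> carrier A"
  have "(-1) \<odot> x \<oplus> x = \<zero>"
    using scale_add_left[of x "-1" 1] x by simp
  then show ?thesis using x by (intro minus_equality) auto
qed

lemma diff_scale: "x \<in> carrier A \<Longrightarrow> y \<in> carrier A \<Longrightarrow> x \<ominus> y = x \<oplus> (-1) \<odot> y"
  by (simp add: a_minus_def minus_scale)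

lemma scale_diff_right:
  "x \<in> carrier A \<Longrightarrow> y \<in> carrier A \<Longrightarrow> c \<odot> (x \<ominus> y) = c \<odot> x \<ominus> c \<odot> y"
  by (simp add: diff_scale scale_add_right)

lemma scale_add_same: "x \<in> carrier A \<Longrightarrow> x \<oplus> x = 2 \<odot> x"
  using scale_add_left[of x 1 1] by simp

lemma scale_cancel:
  assumes "c \<odot> x = \<zero>" "c \<noteq> 0" "x \<in> carrier A"
  shows "x = \<zero>"
proof -
  have "x = (inverse c) \<odot> (c \<odot> x)" using assms(2,3) by simp
  then show ?thesis using assms(1) by simp
qed

lemma diff_zero_iff: "x \<in> carrier A \<Longrightarrow> y \<in> carrier A \<Longrightarrow> x \<ominus> y = \<zero> \<longleftrightarrow> x = y"
proof
  assume xy: "x \<in> carrier A" "y \<in> carrier A" "x \<ominus> y = \<zero>"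
  have "x = (x \<ominus> y) \<oplus> y" using xy(1,2) by algebra
  then show "x = y" using xy by simp
qed (simp add: a_minus_def r_neg)

lemma adj_zero [simp]: "adj A \<zero> = \<zero>"
  using adj_smult[of \<zero> 0] by simp

lemma adj_one [simp]: "adj A \<one> = \<one>"
  by (metis adj_adj adj_closed adj_mult l_one one_closed r_one)

lemma adj_minus: "x \<in> carrier A \<Longrightarrow> adj A (\<ominus> x) = \<ominus> adj A x"
  by (simp add: minus_scale adj_smult)

lemma adj_diff:
  "x \<in> carrier A \<Longrightarrow> y \<in> carrier A \<Longrightarrow> adj A (x \<ominus> y) = adj A x \<ominus> adj A y"
  by (simp add: a_minus_def adj_add adj_minus)

lemma cnorm_zero [simp]: "cnorm A \<zero> = 0"
  by (simp add: cnorm_eq_0)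

text \<open>The C*-identity gives ||y||^2 <= ||y*|| ||y||, whence ||y|| <= ||y*||; the same
  inequality for y* is the converse.\<close>

lemma cnorm_adj [simp]:
  assumes "x \<in> carrier A"
  shows "cnorm A (adj A x) = cnorm A x"
proof -
  have le: "cnorm A y \<le> cnorm A (adj A y)" if y: "y \<in> carrier A" for y
  proof (cases "cnorm A y = 0")
    case False
    then have p: "cnorm A y > 0" using cnorm_nonneg[OF y] by simp
    have "cnorm A y * cnorm A y \<le> cnorm A (adj A y) * cnorm A y"
      using cstar_identity[OF y] cnorm_mult[of "adj A y" y] y by (simp add: power2_eq_square)
    then show ?thesis using p by simp
  qed (use y in simp)
  show ?thesis using le[OF assms] le[of "adj A x"] assms by simp
qed

text \<open>By the C*-identity the norm of 1 is an idempotent real number. It is 0 in the zero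
  algebra, which is why only an inequality is claimed.\<close>

lemma cnorm_one_le: "cnorm A \<one> \<le> 1"
proof -
  have "cnorm A \<one> * cnorm A \<one> = cnorm A \<one>"
    using cstar_identity[of \<one>] by (simp add: power2_eq_square)
  then have "cnorm A \<one> = 0 \<or> cnorm A \<one> = 1" by auto
  then show ?thesis by auto
qed

lemma cnorm_minus [simp]: "x \<in> carrier A \<Longrightarrow> cnorm A (\<ominus> x) = cnorm A x"
  by (simp add: minus_scale cnorm_smult)

lemma cnorm_diff_commute:
  "x \<in> carrier A \<Longrightarrow> y \<in> carrier A \<Longrightarrow> cnorm A (x \<ominus> y) = cnorm A (y \<ominus> x)"
proof -
  assume xy: "x \<in> carrier A" "y \<in> carrier A"
  have "x \<ominus> y = \<ominus> (y \<ominus> x)" using xy by algebra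
  then show ?thesis using xy by simp
qed

lemma cnorm_diff_triangle:
  assumes "x \<in> carrier A" "y \<in> carrier A" "z \<in> carrier A"
  shows "cnorm A (x \<ominus> z) \<le> cnorm A (x \<ominus> y) + cnorm A (y \<ominus> z)"
proof -
  have "x \<ominus> z = (x \<ominus> y) \<oplus> (y \<ominus> z)" using assms by algebra
  then show ?thesis using cnorm_triangle[of "x \<ominus> y" "y \<ominus> z"] assms by simp
qed

lemma cnorm_le_diff:
  assumes "x \<in> carrier A" "y \<in> carrier A"
  shows "cnorm A x \<le> cnorm A (x \<ominus> y) + cnorm A y"
proof -
  have "x = (x \<ominus> y) \<oplus> y" using assms by algebra
  then show ?thesis using cnorm_triangle[of "x \<ominus> y" y] assms by simp
qed

lemma cnorm_finsum_le:
  assumes "finite I" "f \<in> I \<rightarrow> carrier A"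
  shows "cnorm A (\<Oplus>i\<in>I. f i) \<le> (\<Sum>i\<in>I. cnorm A (f i))"
  using assms
proof (induction I rule: finite_induct)
  case (insert i I)
  then have fi: "f i \<in> carrier A" "f \<in> I \<rightarrow> carrier A" by auto
  have "cnorm A (f i \<oplus> finsum A f I) \<le> cnorm A (f i) + cnorm A (finsum A f I)"
    using fi by (intro cnorm_triangle) auto
  then show ?case using insert fi by simp
qed simp

section \<open>Norm limits of sequences\<close>

definition conv :: "(nat \<Rightarrow> 'a) \<Rightarrow> 'a \<Rightarrow> bool" where
  "conv X x \<longleftrightarrow> (\<forall>n. X n \<in> carrier A) \<and> x \<in> carrier A \<and>
     (\<lambda>n. cnorm A (X n \<ominus> x)) \<longlonglongrightarrow> 0"

lemma conv_const: "x \<in> carrier A \<Longrightarrow> conv (\<lambda>n. x) x"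
  by (simp add: conv_def diff_zero_iff r_neg a_minus_def)

lemma conv_Suc: "conv X x \<Longrightarrow> conv (\<lambda>n. X (Suc n)) x"
  unfolding conv_def using LIMSEQ_Suc by fastforce

lemma conv_cnorm_bound:
  assumes "conv X x" "\<And>n. cnorm A (X n) \<le> c"
  shows "cnorm A x \<le> c"
proof -
  have c: "\<And>n. X n \<in> carrier A" "x \<in> carrier A" using assms by (auto simp: conv_def)
  have le: "cnorm A x \<le> cnorm A (X n \<ominus> x) + c" for n
    using cnorm_le_diff[of x "X n"] cnorm_diff_commute[of x "X n"] assms(2)[of n] c by simp
  have "(\<lambda>n. cnorm A (X n \<ominus> x) + c) \<longlonglongrightarrow> 0 + c"
    using assms(1) by (intro tendsto_intros) (auto simp: conv_def)
  then show ?thesis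
    using le by (intro LIMSEQ_le_const[of _ c]) auto
qed

lemma conv_bounded:
  assumes "conv X x"
  shows "\<exists>K. \<forall>n. cnorm A (X n) \<le> K"
proof -
  have c: "\<And>n. X n \<in> carrier A" "x \<in> carrier A" using assms by (auto simp: conv_def)
  have "Bseq (\<lambda>n. cnorm A (X n \<ominus> x))"
    using assms by (intro convergent_imp_Bseq convergentI) (auto simp: conv_def)
  then obtain K where K: "\<And>n. norm (cnorm A (X n \<ominus> x)) \<le> K" unfolding Bseq_def by auto
  have "cnorm A (X n) \<le> K + cnorm A x" for n
    using cnorm_le_diff[of "X n" x] c K[of n] by simp
  then show ?thesis by blast
qed

lemma convI:
  assumes "\<And>n. X n \<in> carrier A" "x \<in> carrier A" "\<And>n. cnorm A (X n \<ominus> x) \<le> f n" "f \<longlonglongrightarrow> 0"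
  shows "conv X x"
  unfolding conv_def
  using assms(1,2) tendsto_sandwich[of "\<lambda>n. 0" "\<lambda>n. cnorm A (X n \<ominus> x)" sequentially f 0] assms(3,4)
  by (auto simp: eventually_sequentially)

lemma conv_add:
  assumes "conv X x" "conv Y y"
  shows "conv (\<lambda>n. X n \<oplus> Y n) (x \<oplus> y)"
proof -
  have c: "\<And>n. X n \<in> carrier A" "x \<in> carrier A" "\<And>n. Y n \<in> carrier A" "y \<in> carrier A"
    using assms by (auto simp: conv_def)
  show ?thesis
  proof (rule convI)
    fix n
    have "(X n \<oplus> Y n) \<ominus> (x \<oplus> y) = (X n \<ominus> x) \<oplus> (Y n \<ominus> y)"
      using c(1,3)[of n] c(2,4) by algebra
    then show "cnorm A ((X n \<oplus> Y n) \<ominus> (x \<oplus> y)) \<le> cnorm A (X n \<ominus> x) + cnorm A (Y n \<ominus> y)"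
      using cnorm_triangle c by simp
    show "(\<lambda>n. cnorm A (X n \<ominus> x) + cnorm A (Y n \<ominus> y)) \<longlonglongrightarrow> 0"
      using assms tendsto_add_zero unfolding conv_def by blast
  qed (use c in auto)
qed

lemma conv_scale:
  assumes "conv X x"
  shows "conv (\<lambda>n. c \<odot> X n) (c \<odot> x)"
proof (rule convI)
  have c: "\<And>n. X n \<in> carrier A" "x \<in> carrier A"
    using assms by (auto simp: conv_def)
  show "(\<lambda>n. cmod c * cnorm A (X n \<ominus> x)) \<longlonglongrightarrow> 0"
    using assms tendsto_mult_right_zero unfolding conv_def by blast
  show "cnorm A (c \<odot> X n \<ominus> c \<odot> x) \<le> cmod c * cnorm A (X n \<ominus> x)" for n
    using c by (simp add: scale_diff_right[symmetric] cnorm_smult)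
qed (use assms in \<open>auto simp: conv_def\<close>)

lemma conv_mult:
  assumes "conv X x" "conv Y y"
  shows "conv (\<lambda>n. X n \<otimes> Y n) (x \<otimes> y)"
proof -
  have c: "\<And>n. X n \<in> carrier A" "x \<in> carrier A" "\<And>n. Y n \<in> carrier A" "y \<in> carrier A"
    using assms by (auto simp: conv_def)
  obtain K where K: "\<And>n. cnorm A (X n) \<le> K" using conv_bounded[OF assms(1)] by blast
  show ?thesis
  proof (rule convI)
    fix n
    have "(X n \<otimes> Y n) \<ominus> (x \<otimes> y) = X n \<otimes> (Y n \<ominus> y) \<oplus> (X n \<ominus> x) \<otimes> y"
      using c(1,3)[of n] c(2,4) by algebra
    then have "cnorm A ((X n \<otimes> Y n) \<ominus> (x \<otimes> y))
        \<le> cnorm A (X n \<otimes> (Y n \<ominus> y)) + cnorm A ((X n \<ominus> x) \<otimes> y)"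
      using cnorm_triangle c by simp
    also have "\<dots> \<le> cnorm A (X n) * cnorm A (Y n \<ominus> y) + cnorm A (X n \<ominus> x) * cnorm A y"
      using cnorm_mult c by (intro add_mono) auto
    also have "\<dots> \<le> K * cnorm A (Y n \<ominus> y) + cnorm A (X n \<ominus> x) * cnorm A y"
      using K[of n] c by (intro add_mono mult_right_mono) auto
    finally show "cnorm A ((X n \<otimes> Y n) \<ominus> (x \<otimes> y)) \<le> \<dots>" .
    show "(\<lambda>n. K * cnorm A (Y n \<ominus> y) + cnorm A (X n \<ominus> x) * cnorm A y) \<longlonglongrightarrow> 0"
      using assms unfolding conv_def
      by (intro tendsto_add_zero tendsto_mult_right_zero tendsto_mult_left_zero) auto
  qed (use c in auto)
qed

lemma conv_adj:
  assumes "conv X x"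
  shows "conv (\<lambda>n. adj A (X n)) (adj A x)"
proof -
  have c: "\<And>n. X n \<in> carrier A" "x \<in> carrier A"
    using assms by (auto simp: conv_def)
  show ?thesis
    using assms c by (auto simp: conv_def adj_diff[symmetric])
qed

lemma conv_unique:
  assumes "conv X x" "conv X y"
  shows "x = y"
proof -
  have c: "\<And>n. X n \<in> carrier A" "x \<in> carrier A" "y \<in> carrier A"
    using assms by (auto simp: conv_def)
  have "(\<lambda>n. cnorm A (X n \<ominus> x) + cnorm A (X n \<ominus> y)) \<longlonglongrightarrow> 0"
    using assms tendsto_add_zero unfolding conv_def by blast
  moreover have "cnorm A (x \<ominus> y) \<le> cnorm A (X n \<ominus> x) + cnorm A (X n \<ominus> y)" for n
    using cnorm_diff_triangle[of x "X n" y] c cnorm_diff_commute[of x "X n"] by simp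
  ultimately have "cnorm A (x \<ominus> y) \<le> 0"
    by (intro LIMSEQ_le_const) auto
  then have "x \<ominus> y = \<zero>"
    using c cnorm_nonneg[of "x \<ominus> y"] cnorm_eq_0[of "x \<ominus> y"] by (simp del: cnorm_nonneg)
  then show ?thesis using c by (simp add: diff_zero_iff)
qed

definition selfadj :: "'a \<Rightarrow> bool" where
  "selfadj h \<longleftrightarrow> h \<in> carrier A \<and> adj A h = h"

definition commutes :: "'a \<Rightarrow> 'a \<Rightarrow> bool" where
  "commutes x y \<longleftrightarrow> x \<otimes> y = y \<otimes> x"

text \<open>
  The iteration \<open>y \<mapsto> (x + y\<^sup>2) / 2\<close> converges to \<open>1 - sqrt (1 - x)\<close>. Starting at \<open>0\<close>, its increments
  are dominated in norm by those of the scalar iteration for \<open>x = 1\<close>, which increases to \<open>1\<close>; so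
  the boundary case \<open>\<parallel>x\<parallel> = 1\<close> is included and no spectral theory is needed.
\<close>

primrec sqrt_iter :: "'a \<Rightarrow> nat \<Rightarrow> 'a" where
  "sqrt_iter x 0 = \<zero>"
| "sqrt_iter x (Suc n) = (1/2) \<odot> (x \<oplus> sqrt_iter x n \<otimes> sqrt_iter x n)"

end

primrec scalar_sqrt_iter :: "nat \<Rightarrow> real" where
  "scalar_sqrt_iter 0 = 0"
| "scalar_sqrt_iter (Suc n) = (1 + (scalar_sqrt_iter n)\<^sup>2) / 2"

lemma scalar_sqrt_iter_bounds: "0 \<le> scalar_sqrt_iter n \<and> scalar_sqrt_iter n \<le> 1"
proof (induction n)
  case (Suc n)
  then show ?case using power_le_one[of "scalar_sqrt_iter n" 2] by auto
qed simp

lemma scalar_sqrt_iter_mono: "scalar_sqrt_iter n \<le> scalar_sqrt_iter (Suc n)"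
  using sum_squares_bound[of "scalar_sqrt_iter n" 1] by (simp add: power2_eq_square)

lemma scalar_sqrt_iter_Cauchy: "Cauchy scalar_sqrt_iter"
proof -
  have "incseq scalar_sqrt_iter" using scalar_sqrt_iter_mono by (rule incseq_SucI)
  then have "convergent scalar_sqrt_iter"
    using scalar_sqrt_iter_bounds incseq_convergent[of scalar_sqrt_iter 1]
    by (metis convergentI)
  then show ?thesis by (rule convergent_Cauchy)
qed

context unital_cstar
begin

context
  fixes x
  assumes x: "x \<in> carrier A" "cnorm A x \<le> 1"
begin

lemma sqrt_iter_closed [simp]: "sqrt_iter x n \<in> carrier A"
  by (induction n) (use x in auto)

lemma sqrt_iter_bound: "cnorm A (sqrt_iter x n) \<le> scalar_sqrt_iter n"
proof (induction n)
  case (Suc n)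
  let ?y = "sqrt_iter x n"
  have "cnorm A (?y \<otimes> ?y) \<le> cnorm A ?y * cnorm A ?y" by (simp add: cnorm_mult)
  also have "\<dots> \<le> (scalar_sqrt_iter n)\<^sup>2"
    using Suc scalar_sqrt_iter_bounds[of n] unfolding power2_eq_square
    by (intro mult_mono) auto
  finally have "cnorm A (x \<oplus> ?y \<otimes> ?y) \<le> 1 + (scalar_sqrt_iter n)\<^sup>2"
    using cnorm_triangle[of x "?y \<otimes> ?y"] x by simp
  then show ?case using x by (simp add: cnorm_smult norm_divide)
qed simp

text \<open>The difference of two squares splits as z (z - y) + (z - y) y without commutativity.
  Bounded term by term with the scalar iterates s <= t, it becomes t (t - s) + (t - s) s = t^2 -
  s^2, twice the next scalar increment.\<close>

lemma sqrt_iter_step: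
  "cnorm A (sqrt_iter x (Suc n) \<ominus> sqrt_iter x n) \<le> scalar_sqrt_iter (Suc n) - scalar_sqrt_iter n"
proof (induction n)
  case 0
  then show ?case using x by (simp add: cnorm_smult norm_divide a_minus_def)
next
  case (Suc n)
  define y z where "y = sqrt_iter x n" and "z = sqrt_iter x (Suc n)"
  have c: "y \<in> carrier A" "z \<in> carrier A" unfolding y_def z_def by (auto simp only: sqrt_iter_closed)
  have "sqrt_iter x (Suc (Suc n)) \<ominus> sqrt_iter x (Suc n)
      = (1/2) \<odot> (x \<oplus> z \<otimes> z) \<ominus> (1/2) \<odot> (x \<oplus> y \<otimes> y)"
    by (simp add: y_def z_def)
  also have "\<dots> = (1/2) \<odot> ((x \<oplus> z \<otimes> z) \<ominus> (x \<oplus> y \<otimes> y))"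
    using c x by (simp add: scale_diff_right)
  also have "(x \<oplus> z \<otimes> z) \<ominus> (x \<oplus> y \<otimes> y) = z \<otimes> (z \<ominus> y) \<oplus> (z \<ominus> y) \<otimes> y"
    using c x(1) by algebra
  finally have eq: "sqrt_iter x (Suc (Suc n)) \<ominus> sqrt_iter x (Suc n)
      = (1/2) \<odot> (z \<otimes> (z \<ominus> y) \<oplus> (z \<ominus> y) \<otimes> y)" .
  define s t where "s = scalar_sqrt_iter n" and "t = scalar_sqrt_iter (Suc n)"
  have st: "cnorm A y \<le> s" "cnorm A z \<le> t" "cnorm A (z \<ominus> y) \<le> t - s" "0 \<le> s" "0 \<le> t" "s \<le> t"
    using scalar_sqrt_iter_mono[of n] sqrt_iter_bound[of n] sqrt_iter_bound[of "Suc n"] Suc scalar_sqrt_iter_bounds[of n]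
      scalar_sqrt_iter_bounds[of "Suc n"]
    unfolding y_def z_def s_def t_def by auto
  have "cnorm A (z \<otimes> (z \<ominus> y) \<oplus> (z \<ominus> y) \<otimes> y)
      \<le> cnorm A (z \<otimes> (z \<ominus> y)) + cnorm A ((z \<ominus> y) \<otimes> y)"
    using c by (intro cnorm_triangle) auto
  also have "\<dots> \<le> cnorm A z * cnorm A (z \<ominus> y) + cnorm A (z \<ominus> y) * cnorm A y"
    using c by (intro add_mono cnorm_mult) auto
  also have "\<dots> \<le> t * (t - s) + (t - s) * s"
    using st c by (intro add_mono mult_mono) auto
  also have "\<dots> = t\<^sup>2 - s\<^sup>2" by (simp add: power2_eq_square algebra_simps)
  finally have "cnorm A (sqrt_iter x (Suc (Suc n)) \<ominus> sqrt_iter x (Suc n)) \<le> (t\<^sup>2 - s\<^sup>2) / 2"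
    unfolding eq using c by (simp add: cnorm_smult norm_divide)
  also have "\<dots> = scalar_sqrt_iter (Suc (Suc n)) - scalar_sqrt_iter (Suc n)"
    by (simp add: s_def t_def diff_divide_distrib add_divide_distrib)
  finally show ?case .
qed

lemma sqrt_iter_dist:
  assumes "m \<le> n"
  shows "cnorm A (sqrt_iter x n \<ominus> sqrt_iter x m) \<le> scalar_sqrt_iter n - scalar_sqrt_iter m"
  using assms
proof (induction n rule: dec_induct)
  case base
  then show ?case by (simp add: a_minus_def r_neg)
next
  case (step n)
  have "cnorm A (sqrt_iter x (Suc n) \<ominus> sqrt_iter x m)
      \<le> cnorm A (sqrt_iter x (Suc n) \<ominus> sqrt_iter x n) + cnorm A (sqrt_iter x n \<ominus> sqrt_iter x m)"
    by (intro cnorm_diff_triangle sqrt_iter_closed)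
  then show ?case using step.IH sqrt_iter_step[of n] by linarith
qed

lemma sqrt_iter_conv: "\<exists>y. conv (sqrt_iter x) y"
proof -
  have "\<exists>y\<in>carrier A. (\<lambda>n. cnorm A (sqrt_iter x n \<ominus> y)) \<longlonglongrightarrow> 0"
  proof (rule complete)
    show "range (sqrt_iter x) \<subseteq> carrier A" by auto
    show "\<forall>e>0. \<exists>N. \<forall>m\<ge>N. \<forall>n\<ge>N. cnorm A (sqrt_iter x m \<ominus> sqrt_iter x n) < e"
    proof (intro allI impI)
      fix e :: real assume "0 < e"
      then obtain N where N: "\<And>m n. m \<ge> N \<Longrightarrow> n \<ge> N \<Longrightarrow>
          \<bar>scalar_sqrt_iter m - scalar_sqrt_iter n\<bar> < e"
        using scalar_sqrt_iter_Cauchy unfolding Cauchy_def dist_real_def by blast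
      have "cnorm A (sqrt_iter x m \<ominus> sqrt_iter x n) < e" if mn: "m \<ge> N" "n \<ge> N" for m n
      proof (cases "n \<le> m")
        case True
        then show ?thesis using sqrt_iter_dist[OF True] N[OF mn] by linarith
      next
        case False
        then have "n \<ge> m" by simp
        then show ?thesis
          using sqrt_iter_dist[of m n] N[OF mn] cnorm_diff_commute[of "sqrt_iter x m" "sqrt_iter x n"]
          by simp
      qed
      then show "\<exists>N. \<forall>m\<ge>N. \<forall>n\<ge>N. cnorm A (sqrt_iter x m \<ominus> sqrt_iter x n) < e" by blast
    qed
  qed
  then show ?thesis unfolding conv_def by auto
qed

lemma sqrt_iter_adj: "adj A x = x \<Longrightarrow> adj A (sqrt_iter x n) = sqrt_iter x n"
  by (induction n) (use x in \<open>auto simp: adj_add adj_smult adj_mult\<close>)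

lemma sqrt_iter_commutes:
  assumes "z \<in> carrier A" "commutes z x"
  shows "commutes z (sqrt_iter x n)"
proof (induction n)
  case (Suc n)
  let ?y = "sqrt_iter x n"
  have "z \<otimes> (?y \<otimes> ?y) = (?y \<otimes> ?y) \<otimes> z"
    using Suc assms(1) m_assoc sqrt_iter_closed unfolding commutes_def by metis
  then show ?case
    using assms x
    by (simp add: commutes_def smult_mult_left smult_mult_right l_distr r_distr)
qed (use assms in \<open>simp add: commutes_def\<close>)

end

text \<open>The iteration runs on x = 1 - h. Its limit y satisfies 2 y = x + y^2, so (1 - y)^2 = 1 -
  x = h. The iterates are built from x alone, so the limit commutes with everything that commutes
  with h; this clause takes the place of a functional calculus later. The bound on 1 - s says that s
  satisfies the hypothesis on h again.\<close>

lemma selfadj_sqrt: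
  assumes h: "selfadj h" "cnorm A (\<one> \<ominus> h) \<le> 1"
  obtains s where "selfadj s" "s \<otimes> s = h" "cnorm A (\<one> \<ominus> s) \<le> 1"
    "\<And>z. z \<in> carrier A \<Longrightarrow> commutes z h \<Longrightarrow> commutes z s"
proof -
  have hc: "h \<in> carrier A" "adj A h = h" using h by (auto simp: selfadj_def)
  define x where "x = \<one> \<ominus> h"
  have x: "x \<in> carrier A" "cnorm A x \<le> 1" "adj A x = x"
    using hc h by (auto simp: x_def adj_diff)
  obtain y where y: "conv (sqrt_iter x) y" using sqrt_iter_conv[OF x(1,2)] by blast
  have yc: "y \<in> carrier A" using y by (simp add: conv_def)
  have "conv (\<lambda>n. sqrt_iter x (Suc n)) ((1/2) \<odot> (x \<oplus> y \<otimes> y))"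
    unfolding sqrt_iter.simps
    by (intro conv_scale conv_add conv_mult conv_const y x)
  then have yeq: "y = (1/2) \<odot> (x \<oplus> y \<otimes> y)"
    by (rule conv_unique[OF conv_Suc[OF y]])
  have "conv (sqrt_iter x) (adj A y)"
    using conv_adj[OF y] by (simp add: sqrt_iter_adj[OF x])
  then have "adj A y = y"
    by (rule conv_unique[OF _ y])
  moreover have "cnorm A y \<le> 1"
    using conv_cnorm_bound[OF y] sqrt_iter_bound[OF x(1,2)] scalar_sqrt_iter_bounds
    by (meson order.trans)
  moreover have comm: "commutes z y" if z: "z \<in> carrier A" "commutes z h" for z
  proof -
    have "commutes z x" using z hc by (simp add: x_def commutes_def a_minus_def l_distr r_distr l_minus r_minus)
    then have "z \<otimes> sqrt_iter x n = sqrt_iter x n \<otimes> z" for n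
      using sqrt_iter_commutes[OF x(1,2) z(1)] unfolding commutes_def by simp
    then have "conv (\<lambda>n. z \<otimes> sqrt_iter x n) (y \<otimes> z)"
      using conv_mult[OF y conv_const[OF z(1)]] by simp
    then show ?thesis
      unfolding commutes_def by (rule conv_unique[OF conv_mult[OF conv_const[OF z(1)] y]])
  qed
  define s where "s = \<one> \<ominus> y"
  have sc: "s \<in> carrier A" using yc by (simp add: s_def)
  have "2 \<odot> y = x \<oplus> y \<otimes> y"
    using arg_cong[OF yeq, of "\<lambda>u. 2 \<odot> u"] x yc by simp
  then have "y \<oplus> y = x \<oplus> y \<otimes> y" using yc by (simp add: scale_add_same)
  then have "\<one> \<ominus> (y \<oplus> y) \<oplus> y \<otimes> y = \<one> \<ominus> (x \<oplus> y \<otimes> y) \<oplus> y \<otimes> y" by simp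
  moreover have "s \<otimes> s = \<one> \<ominus> (y \<oplus> y) \<oplus> y \<otimes> y"
    unfolding s_def using yc by (simp add: ring_simprules)
  moreover have "\<one> \<ominus> (x \<oplus> y \<otimes> y) \<oplus> y \<otimes> y = h"
    unfolding x_def using yc hc(1) by algebra
  ultimately have "s \<otimes> s = h" by simp
  moreover have "\<one> \<ominus> s = y" unfolding s_def using yc by algebra
  moreover have "commutes z s" if z: "z \<in> carrier A" "commutes z h" for z
    using comm[OF z] z yc by (simp add: s_def commutes_def a_minus_def l_distr r_distr l_minus r_minus)
  ultimately show ?thesis
    using that[of s] sc \<open>adj A y = y\<close> \<open>cnorm A y \<le> 1\<close> yc
    by (simp add: selfadj_def s_def adj_diff)
qed

end

section \<open>Positive elements\<close>

context unital_cstar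
begin

text \<open>Squares of selfadjoint elements rather than elements x* x: for squares, sums and norm
  bounds can be treated with the roots constructed above. \<open>cstar_positive_iff_pos\<close>
  identifies the two notions once x* x is known to have a selfadjoint root.\<close>

definition pos :: "'a \<Rightarrow> bool" where
  "pos h \<longleftrightarrow> (\<exists>s. selfadj s \<and> s \<otimes> s = h)"

lemma selfadj_closed: "selfadj h \<Longrightarrow> h \<in> carrier A"
  by (simp add: selfadj_def)

lemma pos_selfadj: "pos h \<Longrightarrow> selfadj h"
  by (auto simp: pos_def selfadj_def adj_mult)

lemma pos_closed: "pos h \<Longrightarrow> h \<in> carrier A"
  using pos_selfadj selfadj_closed by blast

lemma selfadj_scale: "selfadj h \<Longrightarrow> selfadj (complex_of_real t \<odot> h)"
  by (auto simp: selfadj_def adj_smult)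

lemma selfadj_add: "selfadj h \<Longrightarrow> selfadj k \<Longrightarrow> selfadj (h \<oplus> k)"
  by (auto simp: selfadj_def adj_add)

lemma selfadj_minus: "selfadj h \<Longrightarrow> selfadj (\<ominus> h)"
  by (auto simp: selfadj_def adj_minus)

lemma selfadj_diff: "selfadj h \<Longrightarrow> selfadj k \<Longrightarrow> selfadj (h \<ominus> k)"
  by (auto simp: selfadj_def adj_diff)

lemma selfadj_one: "selfadj \<one>"
  by (auto simp: selfadj_def)

lemma selfadj_mult: "selfadj h \<Longrightarrow> selfadj k \<Longrightarrow> commutes h k \<Longrightarrow> selfadj (h \<otimes> k)"
  by (auto simp: selfadj_def adj_mult commutes_def)

lemma selfadj_adj_mult: "x \<in> carrier A \<Longrightarrow> selfadj (adj A x \<otimes> x)"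
  by (auto simp: selfadj_def adj_mult)

lemma cnorm_selfadj_square: "selfadj h \<Longrightarrow> cnorm A (h \<otimes> h) = (cnorm A h)\<^sup>2"
  using cstar_identity[of h] by (simp add: selfadj_def)

lemma selfadj_square_zero: "selfadj h \<Longrightarrow> h \<otimes> h = \<zero> \<Longrightarrow> h = \<zero>"
  using cnorm_selfadj_square[of h] cnorm_eq_0[of h] by (simp add: selfadj_def)

lemma commutes_scale:
  "x \<in> carrier A \<Longrightarrow> y \<in> carrier A \<Longrightarrow> commutes x y \<Longrightarrow> commutes x (c \<odot> y)"
  by (simp add: commutes_def smult_mult_left smult_mult_right)

lemma commutes_mult:
  assumes "x \<in> carrier A" "y \<in> carrier A" "z \<in> carrier A" "commutes x y" "commutes x z"
  shows "commutes x (y \<otimes> z)"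
  using assms m_assoc unfolding commutes_def by metis

lemma commutes_diff:
  assumes "x \<in> carrier A" "y \<in> carrier A" "z \<in> carrier A" "commutes x y" "commutes x z"
  shows "commutes x (y \<ominus> z)"
  using assms by (simp add: commutes_def a_minus_def l_distr r_distr l_minus r_minus)

lemma commutes_sym: "commutes x y \<Longrightarrow> commutes y x"
  by (simp add: commutes_def)

lemma pos_zero: "pos \<zero>"
  unfolding pos_def selfadj_def by (intro exI[of _ \<zero>]) auto

text \<open>\<open>u = h + i k\<close> is normal with \<open>u* u = h\<^sup>2 + k\<^sup>2\<close> and real part \<open>h\<close>.\<close>

lemma cnorm_le_commuting_squares:
  assumes h: "selfadj h" and k: "selfadj k" and hk: "commutes h k"
  shows "(cnorm A h)\<^sup>2 \<le> cnorm A (h \<otimes> h \<oplus> k \<otimes> k)"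
proof -
  have c: "h \<in> carrier A" "k \<in> carrier A" "adj A h = h" "adj A k = k" "k \<otimes> h = h \<otimes> k"
    using h k hk by (auto simp: selfadj_def commutes_def)
  define v where "v = \<i> \<odot> (h \<otimes> k)"
  have vc: "v \<in> carrier A" unfolding v_def using c by simp
  define u where "u = h \<oplus> \<i> \<odot> k"
  have uc: "u \<in> carrier A" using c by (simp add: u_def)
  have ua: "adj A u = h \<oplus> (-\<i>) \<odot> k"
    using c by (simp add: u_def adj_add adj_smult)
  have "adj A u \<otimes> u = h \<otimes> h \<oplus> v \<oplus> ((-1) \<odot> v \<oplus> k \<otimes> k)"
    using c unfolding ua unfolding u_def v_def
    by (simp add: l_distr r_distr smult_mult_left smult_mult_right scale_add_right a_ac)
  also have "\<dots> = h \<otimes> h \<oplus> v \<oplus> (\<ominus> v \<oplus> k \<otimes> k)"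
    using vc by (simp add: minus_scale)
  also have "\<dots> = h \<otimes> h \<oplus> k \<otimes> k"
    using c(1,2) vc by algebra
  finally have uu: "(cnorm A u)\<^sup>2 = cnorm A (h \<otimes> h \<oplus> k \<otimes> k)"
    using cstar_identity[OF uc] by simp
  define w where "w = \<i> \<odot> k"
  have wc: "w \<in> carrier A" using c by (simp add: w_def)
  have "adj A u \<oplus> u = (h \<oplus> \<ominus> w) \<oplus> (h \<oplus> w)"
    unfolding ua unfolding u_def w_def using c by (simp add: minus_scale)
  also have "\<dots> = h \<oplus> h" using c(1) wc by algebra
  finally have "2 \<odot> h = adj A u \<oplus> u" using c by (simp add: scale_add_same)
  then have "2 * cnorm A h \<le> 2 * cnorm A u"
    using cnorm_triangle[of "adj A u" u] uc cnorm_smult[of h 2] c by simp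
  then have "(cnorm A h)\<^sup>2 \<le> (cnorm A u)\<^sup>2" using c by (simp add: power_mono)
  then show ?thesis using uu by simp
qed

text \<open>The root of 1 - h^2 exists because ||h^2|| <= 1. It commutes with h, so k^2 + h^2 = 1
  and \<open>cnorm_le_commuting_squares\<close> bounds its norm.\<close>

lemma selfadj_complement_sqrt:
  assumes h: "selfadj h" "cnorm A h \<le> 1"
  obtains k where "selfadj k" "k \<otimes> k = \<one> \<ominus> h \<otimes> h" "cnorm A k \<le> 1"
proof -
  have hc: "h \<in> carrier A" using h by (simp add: selfadj_def)
  have sa: "selfadj (\<one> \<ominus> h \<otimes> h)"
    using h by (intro selfadj_diff selfadj_one selfadj_mult) (auto simp: commutes_def)
  have "\<one> \<ominus> (\<one> \<ominus> h \<otimes> h) = h \<otimes> h" using hc by algebra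
  then have "cnorm A (\<one> \<ominus> (\<one> \<ominus> h \<otimes> h)) \<le> 1"
    using cnorm_selfadj_square[OF h(1)] h hc by (simp add: power_le_one)
  from selfadj_sqrt[OF sa this] obtain k where k: "selfadj k" "k \<otimes> k = \<one> \<ominus> h \<otimes> h"
    "\<And>z. z \<in> carrier A \<Longrightarrow> commutes z (\<one> \<ominus> h \<otimes> h) \<Longrightarrow> commutes z k" by metis
  have hh: "commutes h (\<one> \<ominus> h \<otimes> h)"
    using hc by (intro commutes_diff commutes_mult) (auto simp: commutes_def)
  have kh: "commutes k h" using k(3)[OF hc hh] by (rule commutes_sym)
  have "k \<otimes> k \<oplus> h \<otimes> h = \<one>" using hc unfolding k(2) by algebra
  then have "(cnorm A k)\<^sup>2 \<le> 1"
    using cnorm_le_commuting_squares[OF k(1) h(1) kh] cnorm_one_le by simp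
  then have "cnorm A k \<le> 1"
    using k(1) selfadj_closed cnorm_nonneg by (simp add: power_le_one_iff abs_square_le_1)
  then show ?thesis using that k by blast
qed

text \<open>Write h = s^2. The contraction s / sqrt t has a complementary root k, and then t - h = t
  k^2 with ||k|| <= 1.\<close>

lemma pos_dist_le:
  assumes h: "pos h" "cnorm A h \<le> t" "0 < t"
  shows "cnorm A (complex_of_real t \<odot> \<one> \<ominus> h) \<le> t"
proof -
  obtain s where s: "selfadj s" "s \<otimes> s = h" using h by (auto simp: pos_def)
  have sc: "s \<in> carrier A" "h \<in> carrier A" using s by (auto simp: selfadj_def)
  define c where "c = complex_of_real (1 / sqrt t)"
  have cc: "complex_of_real t * (c * c) = 1"
    unfolding c_def of_real_mult[symmetric] using h(3) by simp
  have "cnorm A (c \<odot> s) \<le> 1"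
  proof -
    have "(cnorm A s)\<^sup>2 \<le> t" using cnorm_selfadj_square[OF s(1)] s h by simp
    then have "cnorm A s \<le> sqrt t" by (simp add: real_le_rsqrt)
    then show ?thesis using h(3) sc by (simp add: c_def cnorm_smult field_simps norm_divide)
  qed
  moreover have "selfadj (c \<odot> s)" unfolding c_def by (rule selfadj_scale[OF s(1)])
  ultimately obtain k where k: "selfadj k" "k \<otimes> k = \<one> \<ominus> (c \<odot> s) \<otimes> (c \<odot> s)" "cnorm A k \<le> 1"
    using selfadj_complement_sqrt[of "c \<odot> s"] by blast
  have "complex_of_real t \<odot> (k \<otimes> k)
      = complex_of_real t \<odot> \<one> \<ominus> (complex_of_real t * (c * c)) \<odot> (s \<otimes> s)"
    unfolding k(2) using sc
    by (simp add: scale_diff_right smult_mult_left smult_mult_right)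
  then have "complex_of_real t \<odot> \<one> \<ominus> h = complex_of_real t \<odot> (k \<otimes> k)"
    unfolding cc s(2) using sc by simp
  moreover have "cnorm A (k \<otimes> k) \<le> 1"
    using cnorm_selfadj_square[OF k(1)] k(1,3) by (simp add: power_le_one selfadj_def)
  ultimately show ?thesis
    using h(3) k(1) by (simp add: cnorm_smult selfadj_closed)
qed

text \<open>\<open>selfadj_sqrt\<close> rescaled by t. The bound on the root has the same shape as
  the one on h, which makes the root positive in its turn.\<close>

lemma sqrt_of_dist_le:
  assumes h: "selfadj h" "cnorm A (complex_of_real t \<odot> \<one> \<ominus> h) \<le> t" "0 < t"
  obtains s where "selfadj s" "s \<otimes> s = h" "cnorm A (complex_of_real (sqrt t) \<odot> \<one> \<ominus> s) \<le> sqrt t"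
    "\<And>z. z \<in> carrier A \<Longrightarrow> commutes z h \<Longrightarrow> commutes z s"
proof -
  have hc: "h \<in> carrier A" using h by (simp add: selfadj_def)
  define h' where "h' = complex_of_real (1/t) \<odot> h"
  have "complex_of_real (1/t) \<odot> (complex_of_real t \<odot> \<one> \<ominus> h) = \<one> \<ominus> h'"
    using hc h(3) by (simp add: h'_def scale_diff_right)
  then have "cnorm A (\<one> \<ominus> h') = (1/t) * cnorm A (complex_of_real t \<odot> \<one> \<ominus> h)"
    using hc h(3) cnorm_smult[of "complex_of_real t \<odot> \<one> \<ominus> h" "complex_of_real (1/t)"]
    by (simp add: norm_divide)
  then have n: "cnorm A (\<one> \<ominus> h') \<le> 1" using h by simp
  have "selfadj h'" unfolding h'_def by (rule selfadj_scale[OF h(1)])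
  from selfadj_sqrt[OF this n] obtain s where s: "selfadj s" "s \<otimes> s = h'" "cnorm A (\<one> \<ominus> s) \<le> 1"
    "\<And>z. z \<in> carrier A \<Longrightarrow> commutes z h' \<Longrightarrow> commutes z s" by metis
  have sc: "s \<in> carrier A" using s by (simp add: selfadj_def)
  let ?c = "complex_of_real (sqrt t)"
  have cc: "?c * (?c * complex_of_real (1/t)) = 1"
    unfolding of_real_mult[symmetric] using h(3) by simp
  show ?thesis
  proof (rule that[of "?c \<odot> s"])
    show "selfadj (?c \<odot> s)" by (rule selfadj_scale[OF s(1)])
    have "(?c \<odot> s) \<otimes> (?c \<odot> s) = (?c * (?c * complex_of_real (1/t))) \<odot> h"
      using sc hc s(2) by (simp add: smult_mult_left smult_mult_right h'_def)
    then show "(?c \<odot> s) \<otimes> (?c \<odot> s) = h" unfolding cc using hc by simp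
    have "cnorm A (?c \<odot> (\<one> \<ominus> s)) \<le> sqrt t"
      using sc s(3) h(3) by (simp add: cnorm_smult mult_left_le)
    then show "cnorm A (?c \<odot> \<one> \<ominus> ?c \<odot> s) \<le> sqrt t"
      using sc by (simp add: scale_diff_right)
    show "commutes z (?c \<odot> s)" if "z \<in> carrier A" "commutes z h" for z
      using that s(4)[of z] sc hc unfolding h'_def by (simp add: commutes_scale)
  qed
qed

text \<open>In spectral terms the right side says that the spectrum of h lies in [0, 2t] for some t
  > 0. This form of positivity involves only norms and is the one that is visibly stable under
  sums.\<close>

lemma pos_iff_dist:
  "pos h \<longleftrightarrow> selfadj h \<and> (\<exists>t>0. cnorm A (complex_of_real t \<odot> \<one> \<ominus> h) \<le> t)"
proof
  assume h: "pos h"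
  \<comment> \<open>The summand 1 keeps the radius positive when h = 0.\<close>
  have "cnorm A h + 1 > 0" using cnorm_nonneg[OF pos_closed[OF h]] by linarith
  then show "selfadj h \<and> (\<exists>t>0. cnorm A (complex_of_real t \<odot> \<one> \<ominus> h) \<le> t)"
    using pos_dist_le[OF h, of "cnorm A h + 1"] pos_selfadj[OF h]
    by (intro conjI exI[of _ "cnorm A h + 1"]) auto
next
  assume "selfadj h \<and> (\<exists>t>0. cnorm A (complex_of_real t \<odot> \<one> \<ominus> h) \<le> t)"
  then show "pos h" using sqrt_of_dist_le[of h] unfolding pos_def by metis
qed

lemma pos_sqrt:
  assumes "pos h"
  obtains s where "pos s" "s \<otimes> s = h" "\<And>z. z \<in> carrier A \<Longrightarrow> commutes z h \<Longrightarrow> commutes z s"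
proof -
  obtain t where t: "selfadj h" "t > 0" "cnorm A (complex_of_real t \<odot> \<one> \<ominus> h) \<le> t"
    using assms by (auto simp: pos_iff_dist)
  from sqrt_of_dist_le[OF t(1,3,2)] obtain s where s: "selfadj s" "s \<otimes> s = h"
    "cnorm A (complex_of_real (sqrt t) \<odot> \<one> \<ominus> s) \<le> sqrt t"
    "\<And>z. z \<in> carrier A \<Longrightarrow> commutes z h \<Longrightarrow> commutes z s" by metis
  have "pos s" unfolding pos_iff_dist using s t by (auto intro!: exI[of _ "sqrt t"])
  then show ?thesis using that s by blast
qed

text \<open>Balls around scalars add up: centres t, s and radii t, s give centre and radius t +
  s.\<close>

lemma pos_add:
  assumes "pos h" "pos k"
  shows "pos (h \<oplus> k)"
proof -
  obtain s t where st: "selfadj h" "t > 0" "cnorm A (complex_of_real t \<odot> \<one> \<ominus> h) \<le> t"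
    "selfadj k" "s > 0" "cnorm A (complex_of_real s \<odot> \<one> \<ominus> k) \<le> s"
    using assms by (auto simp: pos_iff_dist)
  define p q where "p = complex_of_real t \<odot> \<one>" and "q = complex_of_real s \<odot> \<one>"
  have c: "h \<in> carrier A" "k \<in> carrier A" "p \<in> carrier A" "q \<in> carrier A"
    using st by (auto simp: selfadj_def p_def q_def)
  have "complex_of_real (t + s) \<odot> \<one> = p \<oplus> q"
    by (simp add: p_def q_def scale_add_left)
  moreover have "(p \<oplus> q) \<ominus> (h \<oplus> k) = (p \<ominus> h) \<oplus> (q \<ominus> k)" using c by algebra
  ultimately have "cnorm A (complex_of_real (t + s) \<odot> \<one> \<ominus> (h \<oplus> k)) \<le> t + s"
    using cnorm_triangle[of "p \<ominus> h" "q \<ominus> k"] c st unfolding p_def q_def by simp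
  then show ?thesis
    unfolding pos_iff_dist using st selfadj_add by (intro conjI exI[of _ "t + s"]) auto
qed

lemma pos_scale:
  assumes "pos h" "0 \<le> t"
  shows "pos (complex_of_real t \<odot> h)"
proof -
  obtain s where s: "selfadj s" "s \<otimes> s = h" using assms by (auto simp: pos_def)
  have sc: "s \<in> carrier A" using s by (simp add: selfadj_def)
  have "complex_of_real (sqrt t) * complex_of_real (sqrt t) = complex_of_real t"
    unfolding of_real_mult[symmetric] using assms by simp
  then have "(complex_of_real (sqrt t) \<odot> s) \<otimes> (complex_of_real (sqrt t) \<odot> s) = complex_of_real t \<odot> h"
    using sc by (simp add: smult_mult_left smult_mult_right flip: s(2))
  then show ?thesis using selfadj_scale[OF s(1)] unfolding pos_def by blast
qed

lemma pos_square: "selfadj h \<Longrightarrow> pos (h \<otimes> h)"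
  by (auto simp: pos_def)

text \<open>For t > 0 the distance criterion applies to t - a with centre t itself, since t - (t -
  a) = a. The case t = 0 is separate because the criterion asks for a positive radius.\<close>

lemma pos_cnorm_diff:
  assumes a: "selfadj a" "cnorm A a \<le> t"
  shows "pos (complex_of_real t \<odot> \<one> \<ominus> a)"
proof (cases "t = 0")
  case True
  then have "a = \<zero>" using a cnorm_nonneg[of a] cnorm_eq_0[of a] by (auto simp: selfadj_def simp del: cnorm_nonneg)
  then show ?thesis using True pos_zero by (simp add: a_minus_def)
next
  case False
  then have t: "t > 0" using a cnorm_nonneg[of a] by (simp add: selfadj_def del: cnorm_nonneg)
  define p where "p = complex_of_real t \<odot> \<one>"
  have c: "a \<in> carrier A" "p \<in> carrier A" using a by (auto simp: p_def selfadj_def)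
  have "p \<ominus> (p \<ominus> a) = a" using c by algebra
  then show ?thesis
    unfolding pos_iff_dist using a t selfadj_diff[OF selfadj_scale[OF selfadj_one] a(1)]
    by (intro conjI exI[of _ t]) (auto simp: p_def)
qed

text \<open>Roots commute with whatever commutes with the original elements, so the roots s of a and
  r of b commute with each other and a b = (s r)^2.\<close>

lemma pos_mult:
  assumes "pos a" "pos b" "commutes a b"
  shows "pos (a \<otimes> b)"
proof -
  obtain s where s: "pos s" "s \<otimes> s = a" "\<And>z. z \<in> carrier A \<Longrightarrow> commutes z a \<Longrightarrow> commutes z s"
    using pos_sqrt[OF assms(1)] by metis
  obtain r where r: "pos r" "r \<otimes> r = b" "\<And>z. z \<in> carrier A \<Longrightarrow> commutes z b \<Longrightarrow> commutes z r"
    using pos_sqrt[OF assms(2)] by metis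
  note c = pos_closed[OF s(1)] pos_closed[OF r(1)]
  have "commutes s b"
    using s(3)[OF pos_closed[OF assms(2)] commutes_sym[OF assms(3)]] by (rule commutes_sym)
  then have sr: "commutes s r" using r(3) c by blast
  have "a \<otimes> b = (s \<otimes> r) \<otimes> (s \<otimes> r)"
    unfolding s(2)[symmetric] r(2)[symmetric] using sr c m_assoc m_closed unfolding commutes_def by metis
  moreover have "selfadj (s \<otimes> r)" using s r sr selfadj_mult pos_selfadj by blast
  ultimately show ?thesis by (simp add: pos_square)
qed

text \<open>The product of the commuting positive elements h and -h is positive, say q^2. Then h^2 +
  q^2 = 0 with commuting h and q, and \<open>cnorm_le_commuting_squares\<close> forces h =
  0.\<close>

lemma pos_antisym:
  assumes "pos h" "pos (\<ominus> h)"
  shows "h = \<zero>"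
proof -
  have hc: "h \<in> carrier A" using assms pos_closed by blast
  have "pos (h \<otimes> \<ominus> h)"
    using assms hc by (intro pos_mult) (auto simp: commutes_def l_minus r_minus)
  then obtain q where q: "pos q" "q \<otimes> q = h \<otimes> \<ominus> h"
    "\<And>z. z \<in> carrier A \<Longrightarrow> commutes z (h \<otimes> \<ominus> h) \<Longrightarrow> commutes z q"
    using pos_sqrt by metis
  have "commutes h (h \<otimes> \<ominus> h)"
    using hc by (intro commutes_mult) (auto simp: commutes_def l_minus r_minus)
  then have "commutes h q" using q(3) hc by blast
  then have "(cnorm A h)\<^sup>2 \<le> cnorm A (h \<otimes> h \<oplus> q \<otimes> q)"
    using cnorm_le_commuting_squares assms q pos_selfadj by blast
  also have "h \<otimes> h \<oplus> q \<otimes> q = \<zero>" unfolding q(2) using hc by algebra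
  finally have "cnorm A h = 0" by simp
  then show ?thesis using cnorm_eq_0 hc by blast
qed

end

text \<open>If r > 1, then r^m outgrows every C (m + 1), also along m = 2^n. These exponents are the
  ones reached by iterating an identity or inequality for squares; the lemma discards constants and
  polynomial factors picked up on the way.\<close>

lemma le_one_of_power_pow2_le:
  fixes r :: real
  assumes "\<And>n. r ^ (2 ^ n) \<le> C * (2 ^ n + 1)" "0 \<le> r"
  shows "r \<le> 1"
proof (rule ccontr)
  assume "\<not> r \<le> 1"
  then have r: "r > 1" by simp
  have "(\<lambda>m::nat. (real m + 1) / r ^ m) \<longlonglongrightarrow> 0"
    using r by real_asymp
  then have "(\<lambda>m::nat. C * ((real m + 1) / r ^ m)) \<longlonglongrightarrow> 0"
    by (rule tendsto_mult_right_zero)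
  then have "(\<lambda>n::nat. C * ((real (2 ^ n) + 1) / r ^ (2 ^ n))) \<longlonglongrightarrow> 0"
    by (rule filterlim_compose) (rule filterlim_subseq, simp add: strict_mono_def)
  then have "\<forall>\<^sub>F n in sequentially. C * ((real (2 ^ n) + 1) / r ^ (2 ^ n)) < 1"
    by (rule order_tendstoD) simp
  then obtain n :: nat where "C * ((real (2 ^ n) + 1) / r ^ (2 ^ n)) < 1"
    by (auto simp: eventually_sequentially)
  then have "C * (2 ^ n + 1) < r ^ (2 ^ n)" using r by (simp add: field_simps)
  then show False using assms(1)[of n] by linarith
qed

section \<open>Positivity of x* x\<close>

context unital_cstar
begin

lemma selfadj_pow: "selfadj h \<Longrightarrow> selfadj (h [^] (n::nat))"
proof (induction n)
  case (Suc n)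
  have "commutes (h [^] n) h"
    using Suc selfadj_closed[OF Suc.prems] by (simp add: commutes_def nat_pow_Suc2[symmetric])
  then show ?case using Suc selfadj_mult by simp
qed (simp add: selfadj_one)

lemma cnorm_selfadj_pow2:
  assumes "selfadj h"
  shows "cnorm A (h [^] ((2::nat) ^ n)) = cnorm A h ^ (2 ^ n)"
proof (induction n)
  case 0
  then show ?case using assms by (simp add: selfadj_def)
next
  case (Suc n)
  have "h [^] ((2::nat) ^ Suc n) = h [^] ((2::nat) ^ n) \<otimes> h [^] ((2::nat) ^ n)"
    using assms by (simp add: selfadj_def nat_pow_mult mult_2)
  then have "cnorm A (h [^] ((2::nat) ^ Suc n)) = (cnorm A h ^ (2 ^ n))\<^sup>2"
    using cnorm_selfadj_square[OF selfadj_pow[OF assms, of "2 ^ n"]] Suc by simp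
  then show ?case by (simp add: power_even_eq)
qed

lemma cnorm_pow_le: "x \<in> carrier A \<Longrightarrow> cnorm A (x [^] (n::nat)) \<le> cnorm A x ^ n"
proof (induction n)
  case (Suc n)
  have "cnorm A (x [^] n \<otimes> x) \<le> cnorm A (x [^] n) * cnorm A x"
    using Suc by (intro cnorm_mult) auto
  also have "\<dots> \<le> cnorm A x ^ n * cnorm A x"
    using Suc by (intro mult_right_mono) auto
  finally show ?case by (simp add: mult.commute)
qed (simp add: cnorm_one_le)

text \<open>
  An elementary substitute for the equality of the nonzero spectra of \<open>y* y\<close> and \<open>y y*\<close>: the powers
  of \<open>c + y y*\<close> and \<open>c + y* y\<close> are intertwined by \<open>y\<close>, so the norms of the former grow like
  \<open>(m + 1) c\<^sup>m\<close>.
\<close>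

lemma pos_minus_swap:
  assumes y: "y \<in> carrier A" and neg: "pos (\<ominus> (adj A y \<otimes> y))"
  shows "pos (\<ominus> (y \<otimes> adj A y))"
proof (cases "cnorm A y = 0")
  case True
  then have "y = \<zero>" using cnorm_eq_0 y by blast
  then show ?thesis using pos_zero by simp
next
  case False
  define c where "c = (cnorm A y)\<^sup>2"
  have c: "c > 0" using False by (simp add: c_def)
  define C where "C = complex_of_real c \<odot> \<one>"
  have Cc: "C \<in> carrier A" by (simp add: C_def)
  have ya: "adj A y \<in> carrier A" using y by simp
  define K M where "K = C \<oplus> adj A y \<otimes> y" and "M = C \<oplus> y \<otimes> adj A y"
  have KM: "K \<in> carrier A" "M \<in> carrier A" using y Cc by (auto simp: K_def M_def)
  have "cnorm A (\<ominus> (adj A y \<otimes> y)) \<le> c"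
    using y cstar_identity[OF y] by (simp add: c_def)
  \<comment> \<open>The positive element -y* y has norm at most c, so its distance to the scalar c
    is at most c as well; that distance is the norm of K.\<close>
  then have "cnorm A (C \<ominus> \<ominus> (adj A y \<otimes> y)) \<le> c"
    unfolding C_def by (rule pos_dist_le[OF neg _ c])
  moreover have "C \<ominus> \<ominus> (adj A y \<otimes> y) = K" unfolding K_def using Cc y ya by algebra
  ultimately have K: "cnorm A K \<le> c" by simp
  have Cy: "C \<otimes> y = y \<otimes> C" using y by (simp add: C_def smult_mult_left smult_mult_right)
  have My: "M \<otimes> y = y \<otimes> K"
    unfolding M_def K_def using y ya Cc Cy by (simp add: l_distr r_distr m_assoc)
  have pow: "M [^] m \<otimes> y = y \<otimes> K [^] m" for m :: nat
  proof (induction m)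
    case (Suc m)
    have "M [^] Suc m \<otimes> y = M [^] m \<otimes> (M \<otimes> y)" using KM y by (simp add: m_assoc)
    also have "\<dots> = (M [^] m \<otimes> y) \<otimes> K" using KM y by (simp add: My m_assoc)
    also have "\<dots> = y \<otimes> K [^] Suc m" unfolding Suc using KM y by (simp add: m_assoc)
    finally show ?case .
  qed (use y in simp)
  have bound: "cnorm A (M [^] m) \<le> (real m + 1) * c ^ m" for m :: nat
  proof (induction m)
    case (Suc m)
    \<comment> \<open>Only the last factor M is expanded. Its part y y* turns M^m y y* into y K^m
      y*, of norm at most c^(m+1), so every step adds one more copy of c^(m+1) to the bound.\<close>
    have "M [^] Suc m = complex_of_real c \<odot> M [^] m \<oplus> y \<otimes> K [^] m \<otimes> adj A y"
      using KM y ya pow[of m] unfolding nat_pow_Suc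
      by (subst (2) M_def) (simp add: C_def r_distr smult_mult_right m_assoc[symmetric])
    then have "cnorm A (M [^] Suc m)
        \<le> cnorm A (complex_of_real c \<odot> M [^] m) + cnorm A (y \<otimes> K [^] m \<otimes> adj A y)"
      using KM y ya by (simp add: cnorm_triangle)
    also have "cnorm A (complex_of_real c \<odot> M [^] m) \<le> c * ((real m + 1) * c ^ m)"
      using KM c Suc by (simp add: cnorm_smult)
    also have "cnorm A (y \<otimes> K [^] m \<otimes> adj A y) \<le> cnorm A (y \<otimes> K [^] m) * cnorm A (adj A y)"
      using KM y ya by (intro cnorm_mult) auto
    also have "cnorm A (y \<otimes> K [^] m) \<le> cnorm A y * cnorm A (K [^] m)"
      using KM y by (intro cnorm_mult) auto
    also have "cnorm A (K [^] m) \<le> c ^ m"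
      using cnorm_pow_le[OF KM(1), of m] K KM cnorm_nonneg[OF KM(1)]
      by (meson order.trans power_mono)
    finally have "cnorm A (M [^] Suc m)
        \<le> c * ((real m + 1) * c ^ m) + cnorm A y * c ^ m * cnorm A (adj A y)"
      using y by (simp add: mult_left_mono mult_right_mono)
    also have "\<dots> = (real (Suc m) + 1) * c ^ Suc m"
      using y by (simp add: c_def power2_eq_square algebra_simps)
    finally show ?case .
  qed (simp add: cnorm_one_le)
  have Msa: "selfadj M"
    unfolding M_def C_def using selfadj_adj_mult[OF ya] y
    by (intro selfadj_add selfadj_scale selfadj_one) simp
  \<comment> \<open>M is selfadjoint, so the norm of its power 2^n is exactly ||M||^(2^n) and the
    linear factor in the bound can be discarded.\<close>
  have "(cnorm A M / c) ^ (2 ^ n) \<le> 1 * (2 ^ n + 1)" for n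
  proof -
    have "cnorm A M ^ (2 ^ n) \<le> (2 ^ n + 1) * c ^ (2 ^ n)"
      using bound[of "2 ^ n"] cnorm_selfadj_pow2[OF Msa, of n] by simp
    then show ?thesis using c by (simp add: power_divide field_simps)
  qed
  then have "cnorm A M / c \<le> 1"
    using c KM by (intro le_one_of_power_pow2_le[of _ 1]) auto
  then have "cnorm A M \<le> c" using c by simp
  moreover have "C \<ominus> \<ominus> (y \<otimes> adj A y) = M" unfolding M_def using Cc y ya by algebra
  moreover have "selfadj (\<ominus> (y \<otimes> adj A y))"
    using selfadj_minus[OF selfadj_adj_mult[OF ya]] y by simp
  ultimately show ?thesis
    unfolding pos_iff_dist C_def using c by auto
qed

text \<open>For y = h + i k with selfadjoint h, k one has a = 2 h and b = -2 k. Hence y* y + y y* is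
  half a sum of two squares of selfadjoint elements, and so positive.\<close>

lemma adj_mult_add_mult_adj:
  assumes y: "y \<in> carrier A"
  defines "a \<equiv> y \<oplus> adj A y" and "b \<equiv> \<i> \<odot> (y \<ominus> adj A y)"
  shows "a \<otimes> a \<oplus> b \<otimes> b = 2 \<odot> (adj A y \<otimes> y \<oplus> y \<otimes> adj A y)"
proof -
  define z where "z = adj A y"
  have z: "z \<in> carrier A" using y by (simp add: z_def)
  have "b \<otimes> b = \<ominus> ((y \<ominus> z) \<otimes> (y \<ominus> z))"
    unfolding b_def z_def[symmetric] using y z
    by (simp add: smult_mult_left smult_mult_right minus_scale)
  then have "a \<otimes> a \<oplus> b \<otimes> b = (y \<oplus> z) \<otimes> (y \<oplus> z) \<oplus> \<ominus> ((y \<ominus> z) \<otimes> (y \<ominus> z))"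
    by (simp add: a_def z_def)
  also have "\<dots> = (z \<otimes> y \<oplus> y \<otimes> z) \<oplus> (z \<otimes> y \<oplus> y \<otimes> z)" using y z by algebra
  finally show ?thesis using y z by (simp add: scale_add_same z_def)
qed

text \<open>
  The Fukamiya--Kaplansky theorem. With \<open>q = |h|\<close> and \<open>w = q - h\<close> (twice the negative part of \<open>h\<close>),
  the element \<open>y = x w\<close> satisfies \<open>- y* y = q w\<^sup>2 \<ge> 0\<close>, which forces \<open>y = 0\<close>.
\<close>

lemma pos_adj_mult:
  assumes x: "x \<in> carrier A"
  shows "pos (adj A x \<otimes> x)"
proof -
  define h where "h = adj A x \<otimes> x"
  have h: "selfadj h" "h \<in> carrier A" using selfadj_adj_mult[OF x] by (auto simp: h_def selfadj_def)
  obtain q where q: "pos q" "q \<otimes> q = h \<otimes> h"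
    "\<And>z. z \<in> carrier A \<Longrightarrow> commutes z (h \<otimes> h) \<Longrightarrow> commutes z q"
    using pos_sqrt[OF pos_square[OF h(1)]] by metis
  have qc: "q \<in> carrier A" using q pos_closed by blast
  have hq: "commutes h q" using q(3)[OF h(2)] h(2) by (simp add: commutes_def m_assoc)
  define w where "w = q \<ominus> h"
  have w: "selfadj w" "w \<in> carrier A"
    unfolding w_def using selfadj_diff[OF pos_selfadj[OF q(1)] h(1)] qc h by auto
  have hw: "commutes h w" unfolding w_def using h qc hq by (intro commutes_diff) (auto simp: commutes_def)
  have wq: "commutes w q"
    unfolding w_def using h qc hq
    by (intro commutes_sym[OF commutes_diff]) (auto simp: commutes_def)
  \<comment> \<open>This is (q + h) (q - h) = 0, which holds because q and h commute and have the
    same square.\<close>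
  have qw: "q \<otimes> w = \<ominus> (h \<otimes> w)"
  proof -
    have "q \<otimes> w = q \<otimes> q \<ominus> q \<otimes> h" unfolding w_def using qc h(2) by algebra
    also have "\<dots> = h \<otimes> h \<ominus> h \<otimes> q" using q(2) hq by (simp add: commutes_def)
    also have "\<dots> = \<ominus> (h \<otimes> w)" unfolding w_def using qc h(2) by algebra
    finally show ?thesis .
  qed
  obtain s where s: "pos s" "s \<otimes> s = q" "\<And>z. z \<in> carrier A \<Longrightarrow> commutes z q \<Longrightarrow> commutes z s"
    using pos_sqrt[OF q(1)] by metis
  have sc: "s \<in> carrier A" using s pos_closed by blast
  have ws: "commutes w s" using s(3) wq w by blast
  define y where "y = x \<otimes> w"
  have y: "y \<in> carrier A" using x w by (simp add: y_def)
  have yy: "adj A y \<otimes> y = h \<otimes> w \<otimes> w"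
  proof -
    have "adj A y \<otimes> y = w \<otimes> h \<otimes> w"
      using x w by (simp add: y_def adj_mult h_def m_assoc selfadj_def)
    then show ?thesis using hw by (simp add: commutes_def)
  qed
  have "\<ominus> (adj A y \<otimes> y) = q \<otimes> w \<otimes> w"
    unfolding yy qw using h w by (simp add: l_minus)
  also have "\<dots> = (s \<otimes> w) \<otimes> (s \<otimes> w)"
    using s(2) sc w ws m_assoc m_closed unfolding commutes_def by metis
  finally have neg: "pos (\<ominus> (adj A y \<otimes> y))"
    using pos_square[OF selfadj_mult[OF pos_selfadj[OF s(1)] w(1) commutes_sym[OF ws]]] by simp
  \<comment> \<open>Z is positive as half a sum of squares, and -Z is the sum of -y* y and -y y*,
    both positive; so Z = 0.\<close>
  define Z where "Z = adj A y \<otimes> y \<oplus> y \<otimes> adj A y"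
  have Zc: "Z \<in> carrier A" using y by (simp add: Z_def)
  have "pos (2 \<odot> Z)"
  proof -
    have "selfadj (y \<oplus> adj A y)" "selfadj (\<i> \<odot> (y \<ominus> adj A y))"
      using y by (auto simp: selfadj_def adj_add adj_smult adj_diff a_comm diff_scale scale_add_right)
    then show ?thesis
      unfolding Z_def adj_mult_add_mult_adj[OF y, symmetric] by (intro pos_add pos_square)
  qed
  moreover have "pos (\<ominus> (2 \<odot> Z))"
  proof -
    have "\<ominus> Z = \<ominus> (adj A y \<otimes> y) \<oplus> \<ominus> (y \<otimes> adj A y)"
      unfolding Z_def using y by (simp add: minus_add)
    then have "pos (\<ominus> Z)" using pos_add[OF neg pos_minus_swap[OF y neg]] by simp
    then have "pos (complex_of_real 2 \<odot> \<ominus> Z)" by (rule pos_scale) simp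
    then show ?thesis using Zc by (simp add: minus_scale)
  qed
  ultimately have "2 \<odot> Z = \<zero>" by (rule pos_antisym)
  then have "Z = \<zero>" using scale_cancel[of 2 Z] Zc by simp
  then have "adj A y \<otimes> y = \<ominus> (y \<otimes> adj A y)"
    using y unfolding Z_def by (simp add: minus_equality[symmetric])
  \<comment> \<open>Since Z = 0, the element y* y equals -y y* and is positive, while its negative
    is positive by construction.\<close>
  then have "pos (adj A y \<otimes> y)" using pos_minus_swap[OF y neg] by simp
  then have "adj A y \<otimes> y = \<zero>" using neg by (rule pos_antisym)
  then have hww: "h \<otimes> w \<otimes> w = \<zero>" using yy by simp
  \<comment> \<open>Here w^3 = (q - h) w^2, and both h w^2 and q w^2 = -h w^2 vanish. From w^4 = 0
    the C*-identity descends to w^2 = 0 and then to w = 0.\<close>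
  have "w \<otimes> w \<otimes> w = q \<otimes> w \<otimes> w \<ominus> h \<otimes> w \<otimes> w"
    by (subst (1) w_def) (use qc h(2) w(2) in algebra)
  also have "\<dots> = \<zero>" unfolding qw using hww h w by (simp add: l_minus a_minus_def)
  finally have "(w \<otimes> w) \<otimes> (w \<otimes> w) = \<zero>" using w by (simp add: m_assoc[symmetric])
  moreover have "selfadj (w \<otimes> w)" using pos_square[OF w(1)] pos_selfadj by blast
  ultimately have "w \<otimes> w = \<zero>" using selfadj_square_zero by blast
  then have "w = \<zero>" using selfadj_square_zero w by blast
  then have "q = h" using qc h diff_zero_iff unfolding w_def by blast
  then show ?thesis using q(1) by (simp add: h_def)
qed

lemma cstar_positive_iff_pos: "cstar_positive A a \<longleftrightarrow> pos a"
  unfolding cstar_positive_def using pos_adj_mult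
  by (auto simp: pos_def selfadj_def) metis

lemma pos_conj:
  assumes "pos p" "c \<in> carrier A"
  shows "pos (adj A c \<otimes> p \<otimes> c)"
proof -
  obtain s where s: "selfadj s" "s \<otimes> s = p" using assms by (auto simp: pos_def)
  have "adj A c \<otimes> p \<otimes> c = adj A (s \<otimes> c) \<otimes> (s \<otimes> c)"
    using s assms by (auto simp: selfadj_def adj_mult m_assoc)
  then show ?thesis using pos_adj_mult[of "s \<otimes> c"] s assms by (simp add: selfadj_def)
qed

text \<open>From a <= b <= ||b|| one gets a = r^2 and ||b|| - a = l^2, where r and l commute because
  the upper bound is now a scalar. Then ||a|| = ||r||^2 is at most the norm of r^2 + l^2, which is
  that scalar.\<close>

lemma pos_cnorm_mono:
  assumes a: "pos a" and ba: "pos (b \<ominus> a)" and b: "b \<in> carrier A"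
  shows "cnorm A a \<le> cnorm A b"
proof -
  define B where "B = complex_of_real (cnorm A b) \<odot> \<one>"
  have c: "B \<in> carrier A" "a \<in> carrier A" using pos_closed[OF a] by (auto simp: B_def)
  have "b = a \<oplus> (b \<ominus> a)" using b c by algebra
  then have "pos b" using pos_add[OF a ba] by simp
  then have "pos (B \<ominus> b)" unfolding B_def by (intro pos_cnorm_diff pos_selfadj) auto
  moreover have "B \<ominus> a = (B \<ominus> b) \<oplus> (b \<ominus> a)" using b c by algebra
  ultimately have Ba: "pos (B \<ominus> a)" using pos_add ba by simp
  obtain r where r: "pos r" "r \<otimes> r = a" "\<And>z. z \<in> carrier A \<Longrightarrow> commutes z a \<Longrightarrow> commutes z r"
    using pos_sqrt[OF a] by metis
  obtain l where l: "pos l" "l \<otimes> l = B \<ominus> a"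
    "\<And>z. z \<in> carrier A \<Longrightarrow> commutes z (B \<ominus> a) \<Longrightarrow> commutes z l"
    using pos_sqrt[OF Ba] by metis
  have rc: "r \<in> carrier A" using r pos_closed by blast
  have "commutes r B" using rc by (simp add: B_def commutes_def smult_mult_left smult_mult_right)
  moreover have "commutes r a" using rc by (simp add: commutes_def m_assoc flip: r(2))
  ultimately have "commutes r l" using l(3) commutes_diff rc c by blast
  then have "(cnorm A r)\<^sup>2 \<le> cnorm A (r \<otimes> r \<oplus> l \<otimes> l)"
    using cnorm_le_commuting_squares r l pos_selfadj by blast
  also have "r \<otimes> r \<oplus> l \<otimes> l = B" unfolding r(2) l(2) using c by algebra
  also have "cnorm A B \<le> cnorm A b * 1"
    unfolding B_def using b by (simp add: cnorm_smult mult_left_le cnorm_one_le)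
  finally show ?thesis using cnorm_selfadj_square[OF pos_selfadj[OF r(1)]] r(2) by simp
qed

lemma pos_finsum:
  assumes "finite I" "\<And>i. i \<in> I \<Longrightarrow> pos (f i)"
  shows "pos (\<Oplus>i\<in>I. f i)"
  using assms
proof (induction I rule: finite_induct)
  case (insert i I)
  then have "f i \<in> carrier A" "f \<in> I \<rightarrow> carrier A" using pos_closed by auto
  then show ?case using insert pos_add by simp
qed (simp add: pos_zero)

end

section \<open>Hilbert modules and operator norms\<close>

context unital_cstar
begin

lemma finsum_adj:
  assumes "finite I" "f \<in> I \<rightarrow> carrier A"
  shows "adj A (\<Oplus>i\<in>I. f i) = (\<Oplus>i\<in>I. adj A (f i))"
  using assms
proof (induction I rule: finite_induct)
  case (insert i I)
  then have "f i \<in> carrier A" "f \<in> I \<rightarrow> carrier A" "(\<lambda>i. adj A (f i)) \<in> I \<rightarrow> carrier A" by auto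
  then show ?case using insert by (simp add: adj_add)
qed simp

lemma finsum_scale:
  assumes "finite I" "f \<in> I \<rightarrow> carrier A"
  shows "c \<odot> (\<Oplus>i\<in>I. f i) = (\<Oplus>i\<in>I. c \<odot> f i)"
  using assms
proof (induction I rule: finite_induct)
  case (insert i I)
  then have "f i \<in> carrier A" "f \<in> I \<rightarrow> carrier A" "(\<lambda>i. c \<odot> f i) \<in> I \<rightarrow> carrier A" by auto
  then show ?case using insert by (simp add: scale_add_right)
qed simp

lemma finsum_closed_family: "(\<And>i. i \<in> I \<Longrightarrow> f i \<in> carrier A) \<Longrightarrow> (\<Oplus>i\<in>I. f i) \<in> carrier A"
  by (intro finsum_closed) auto

lemma finsum_eqI:
  "(\<And>i. i \<in> I \<Longrightarrow> f i = g i) \<Longrightarrow> (\<And>i. i \<in> I \<Longrightarrow> g i \<in> carrier A)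
    \<Longrightarrow> (\<Oplus>i\<in>I. f i) = (\<Oplus>i\<in>I. g i)"
  by (intro finsum_cong') auto

lemma finsum_mult_left:
  "finite I \<Longrightarrow> a \<in> carrier A \<Longrightarrow> (\<And>i. i \<in> I \<Longrightarrow> f i \<in> carrier A)
    \<Longrightarrow> a \<otimes> (\<Oplus>i\<in>I. f i) = (\<Oplus>i\<in>I. a \<otimes> f i)"
  by (intro finsum_rdistr) auto

lemma finsum_mult_right:
  "finite I \<Longrightarrow> a \<in> carrier A \<Longrightarrow> (\<And>i. i \<in> I \<Longrightarrow> f i \<in> carrier A)
    \<Longrightarrow> (\<Oplus>i\<in>I. f i) \<otimes> a = (\<Oplus>i\<in>I. f i \<otimes> a)"
  by (intro finsum_ldistr) auto

lemma finsum_swap: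
  assumes "finite I" "finite J" "\<And>i j. i \<in> I \<Longrightarrow> j \<in> J \<Longrightarrow> f i j \<in> carrier A"
  shows "(\<Oplus>i\<in>I. \<Oplus>j\<in>J. f i j) = (\<Oplus>j\<in>J. \<Oplus>i\<in>I. f i j)"
  using assms
proof (induction I rule: finite_induct)
  case (insert i I)
  have c: "f i \<in> J \<rightarrow> carrier A" "(\<lambda>j. \<Oplus>i\<in>I. f i j) \<in> J \<rightarrow> carrier A"
    "(\<lambda>i. \<Oplus>j\<in>J. f i j) \<in> I \<rightarrow> carrier A" "(\<Oplus>j\<in>J. f i j) \<in> carrier A"
    using insert by auto
  have "(\<Oplus>i\<in>insert i I. \<Oplus>j\<in>J. f i j) = (\<Oplus>j\<in>J. f i j) \<oplus> (\<Oplus>j\<in>J. \<Oplus>i\<in>I. f i j)"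
    using insert c by simp
  also have "\<dots> = (\<Oplus>j\<in>J. f i j \<oplus> (\<Oplus>i\<in>I. f i j))"
    using c by (simp add: finsum_addf)
  also have "\<dots> = (\<Oplus>j\<in>J. \<Oplus>i\<in>insert i I. f i j)"
    using insert by (intro finsum_cong') auto
  finally show ?case .
qed simp

lemma add_diff_cancel: "x \<in> carrier A \<Longrightarrow> y \<in> carrier A \<Longrightarrow> (x \<oplus> y) \<ominus> x = y"
  by algebra

definition ip :: "'i set \<Rightarrow> ('i \<Rightarrow> 'a) \<Rightarrow> ('i \<Rightarrow> 'a) \<Rightarrow> 'a" where
  "ip I \<xi> \<eta> = (\<Oplus>i\<in>I. adj A (\<xi> i) \<otimes> \<eta> i)"

abbreviation hnorm :: "'i set \<Rightarrow> ('i \<Rightarrow> 'a) \<Rightarrow> real" where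
  "hnorm \<equiv> hilbert_module_norm A"

definition mat_app :: "'i set \<Rightarrow> ('i \<Rightarrow> 'i \<Rightarrow> 'a) \<Rightarrow> ('i \<Rightarrow> 'a) \<Rightarrow> 'i \<Rightarrow> 'a" where
  "mat_app I X \<xi> i = (\<Oplus>j\<in>I. X i j \<otimes> \<xi> j)"

abbreviation opnorm :: "'i set \<Rightarrow> ('i \<Rightarrow> 'i \<Rightarrow> 'a) \<Rightarrow> real" where
  "opnorm I X \<equiv> hilbert_module_op_norm A I (mat_app I X)"

context
  fixes I :: "'i set"
  assumes I: "finite I"
begin

lemma ip_closed [simp, intro]:
  "\<xi> \<in> I \<rightarrow> carrier A \<Longrightarrow> \<eta> \<in> I \<rightarrow> carrier A \<Longrightarrow> ip I \<xi> \<eta> \<in> carrier A"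
  unfolding ip_def by (intro finsum_closed) auto

lemma hnorm_square:
  "\<xi> \<in> I \<rightarrow> carrier A \<Longrightarrow> (hnorm I \<xi>)\<^sup>2 = cnorm A (ip I \<xi> \<xi>)"
  using ip_closed[of \<xi> \<xi>] by (simp add: hilbert_module_norm_def ip_def)

lemma hnorm_nonneg [simp]: "\<xi> \<in> I \<rightarrow> carrier A \<Longrightarrow> 0 \<le> hnorm I \<xi>"
  using ip_closed[of \<xi> \<xi>] by (simp add: hilbert_module_norm_def ip_def)

lemma ip_adj:
  "\<xi> \<in> I \<rightarrow> carrier A \<Longrightarrow> \<eta> \<in> I \<rightarrow> carrier A \<Longrightarrow> adj A (ip I \<xi> \<eta>) = ip I \<eta> \<xi>"
  unfolding ip_def using I
  by (subst finsum_adj) (auto simp: adj_mult Pi_def intro!: finsum_cong')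

lemma ip_pos: "\<xi> \<in> I \<rightarrow> carrier A \<Longrightarrow> pos (ip I \<xi> \<xi>)"
  unfolding ip_def using I by (intro pos_finsum pos_adj_mult) auto

lemma ip_diff_right:
  assumes "\<xi> \<in> I \<rightarrow> carrier A" "\<eta> \<in> I \<rightarrow> carrier A" "\<zeta> \<in> I \<rightarrow> carrier A"
  shows "ip I \<xi> (\<lambda>i. \<eta> i \<ominus> \<zeta> i) = ip I \<xi> \<eta> \<ominus> ip I \<xi> \<zeta>"
proof -
  have "ip I \<xi> (\<lambda>i. \<eta> i \<ominus> \<zeta> i)
      = (\<Oplus>i\<in>I. adj A (\<xi> i) \<otimes> \<eta> i \<oplus> (-1) \<odot> (adj A (\<xi> i) \<otimes> \<zeta> i))"
    unfolding ip_def using assms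
    by (intro finsum_cong') (auto simp: diff_scale r_distr smult_mult_right Pi_def)
  also have "\<dots> = ip I \<xi> \<eta> \<oplus> (\<Oplus>i\<in>I. (-1) \<odot> (adj A (\<xi> i) \<otimes> \<zeta> i))"
    unfolding ip_def using assms by (intro finsum_addf) (auto simp: Pi_def)
  also have "(\<Oplus>i\<in>I. (-1) \<odot> (adj A (\<xi> i) \<otimes> \<zeta> i)) = (-1) \<odot> ip I \<xi> \<zeta>"
    unfolding ip_def using assms I by (intro finsum_scale[symmetric]) (auto simp: Pi_def)
  finally show ?thesis using assms by (simp add: diff_scale)
qed

lemma ip_diff_left:
  assumes "\<xi> \<in> I \<rightarrow> carrier A" "\<eta> \<in> I \<rightarrow> carrier A" "\<zeta> \<in> I \<rightarrow> carrier A"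
  shows "ip I (\<lambda>i. \<eta> i \<ominus> \<zeta> i) \<xi> = ip I \<eta> \<xi> \<ominus> ip I \<zeta> \<xi>"
proof -
  have d: "(\<lambda>i. \<eta> i \<ominus> \<zeta> i) \<in> I \<rightarrow> carrier A" using assms by auto
  have "ip I (\<lambda>i. \<eta> i \<ominus> \<zeta> i) \<xi> = adj A (ip I \<xi> \<eta> \<ominus> ip I \<xi> \<zeta>)"
    by (simp only: ip_adj[OF assms(1) d, symmetric] ip_diff_right[OF assms])
  then show ?thesis using assms by (simp add: adj_diff ip_adj)
qed

lemma ip_mult_right:
  assumes "\<xi> \<in> I \<rightarrow> carrier A" "\<eta> \<in> I \<rightarrow> carrier A" "a \<in> carrier A"
  shows "ip I \<xi> (\<lambda>i. \<eta> i \<otimes> a) = ip I \<xi> \<eta> \<otimes> a"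
  unfolding ip_def using assms I
  by (subst finsum_ldistr) (auto simp: m_assoc Pi_def intro!: finsum_cong')

lemma ip_mult_left:
  assumes "\<xi> \<in> I \<rightarrow> carrier A" "\<eta> \<in> I \<rightarrow> carrier A" "a \<in> carrier A"
  shows "ip I (\<lambda>i. \<eta> i \<otimes> a) \<xi> = adj A a \<otimes> ip I \<eta> \<xi>"
proof -
  have d: "(\<lambda>i. \<eta> i \<otimes> a) \<in> I \<rightarrow> carrier A" using assms by auto
  have "ip I (\<lambda>i. \<eta> i \<otimes> a) \<xi> = adj A (ip I \<xi> \<eta> \<otimes> a)"
    by (simp only: ip_adj[OF assms(1) d, symmetric] ip_mult_right[OF assms])
  then show ?thesis using assms by (simp add: adj_mult ip_adj)
qed

text \<open>The other summands of the inner product of \<xi> with itself add up to a positive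
  element, and the norm is monotone on positive elements.\<close>

lemma cnorm_entry_le_hnorm:
  assumes \<xi>: "\<xi> \<in> I \<rightarrow> carrier A" and i: "i \<in> I"
  shows "cnorm A (\<xi> i) \<le> hnorm I \<xi>"
proof -
  have c: "\<xi> i \<in> carrier A" "\<xi> \<in> I - {i} \<rightarrow> carrier A" using assms by auto
  let ?r = "\<Oplus>j\<in>I - {i}. adj A (\<xi> j) \<otimes> \<xi> j"
  have "pos ?r" using I \<xi> by (intro pos_finsum pos_adj_mult) auto
  moreover have "ip I \<xi> \<xi> = adj A (\<xi> i) \<otimes> \<xi> i \<oplus> ?r"
  proof -
    have "ip I \<xi> \<xi> = (\<Oplus>j\<in>insert i (I - {i}). adj A (\<xi> j) \<otimes> \<xi> j)"
      using i by (simp add: ip_def insert_absorb)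
    also have "\<dots> = adj A (\<xi> i) \<otimes> \<xi> i \<oplus> ?r"
      using I c by (subst finsum_insert) (auto simp: Pi_def)
    finally show ?thesis .
  qed
  moreover have rc: "?r \<in> carrier A" using \<open>pos ?r\<close> by (rule pos_closed)
  moreover have "(adj A (\<xi> i) \<otimes> \<xi> i \<oplus> ?r) \<ominus> (adj A (\<xi> i) \<otimes> \<xi> i) = ?r"
    by (intro add_diff_cancel m_closed adj_closed c rc)
  ultimately have "cnorm A (adj A (\<xi> i) \<otimes> \<xi> i) \<le> cnorm A (ip I \<xi> \<xi>)"
    using pos_cnorm_mono pos_adj_mult c by simp
  then have "(cnorm A (\<xi> i))\<^sup>2 \<le> (hnorm I \<xi>)\<^sup>2"
    using cstar_identity c hnorm_square[OF \<xi>] by simp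
  then show ?thesis using hnorm_nonneg[OF \<xi>] power2_le_imp_le by blast
qed

lemma hnorm_le_sum:
  assumes \<xi>: "\<xi> \<in> I \<rightarrow> carrier A"
  shows "hnorm I \<xi> \<le> (\<Sum>i\<in>I. cnorm A (\<xi> i))"
proof -
  have "(hnorm I \<xi>)\<^sup>2 \<le> (\<Sum>i\<in>I. cnorm A (adj A (\<xi> i) \<otimes> \<xi> i))"
    unfolding hnorm_square[OF \<xi>] ip_def using I \<xi> by (intro cnorm_finsum_le) auto
  also have "\<dots> = (L2_set (\<lambda>i. cnorm A (\<xi> i)) I)\<^sup>2"
    unfolding L2_set_def using \<xi>
    by (subst real_sqrt_pow2) (auto intro!: sum_nonneg sum.cong simp: cstar_identity Pi_def)
  finally have "hnorm I \<xi> \<le> L2_set (\<lambda>i. cnorm A (\<xi> i)) I"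
    using L2_set_nonneg power2_le_imp_le by blast
  also have "\<dots> \<le> (\<Sum>i\<in>I. cnorm A (\<xi> i))"
    using \<xi> by (intro L2_set_le_sum cnorm_nonneg) auto
  finally show ?thesis .
qed

text \<open>The classical proof with \<theta> = \<eta> a / \<beta>, a = <\<eta>, \<xi>>, in the role
  of the projection of \<xi> to \<eta>; the norm \<beta> of <\<eta>, \<eta>> stands in for that
  element itself, which need not be invertible. Positivity of <\<xi> - \<theta>, \<xi> - \<theta>>
  yields a* a / \<beta> <= <\<xi>, \<xi>>, and norms are compared by
  \<open>pos_cnorm_mono\<close>.\<close>

lemma hnorm_Cauchy_Schwarz:
  assumes \<xi>: "\<xi> \<in> I \<rightarrow> carrier A" and \<eta>: "\<eta> \<in> I \<rightarrow> carrier A"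
  shows "cnorm A (ip I \<eta> \<xi>) \<le> hnorm I \<eta> * hnorm I \<xi>"
proof (cases "cnorm A (ip I \<eta> \<eta>) = 0")
  case True
  then have "hnorm I \<eta> = 0" using hnorm_square[OF \<eta>] by simp
  then have "\<eta> i = \<zero>" if "i \<in> I" for i
    using cnorm_entry_le_hnorm[OF \<eta> that] \<eta> that cnorm_nonneg[of "\<eta> i"] cnorm_eq_0[of "\<eta> i"]
    by (simp add: Pi_def del: cnorm_nonneg)
  then have "ip I \<eta> \<xi> = (\<Oplus>i\<in>I. \<zero>)"
    unfolding ip_def using \<xi> by (intro finsum_cong') (auto simp: Pi_def)
  then show ?thesis using \<xi> \<eta> by (simp add: finsum_zero)
next
  case False
  define \<beta> where "\<beta> = cnorm A (ip I \<eta> \<eta>)"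
  have \<beta>: "\<beta> > 0" using False cnorm_nonneg[of "ip I \<eta> \<eta>"] ip_closed[OF \<eta> \<eta>] by (simp add: \<beta>_def del: cnorm_nonneg)
  define a X n where "a = ip I \<eta> \<xi>" and "X = ip I \<xi> \<xi>" and "n = ip I \<eta> \<eta>"
  have c: "a \<in> carrier A" "X \<in> carrier A" "n \<in> carrier A"
    using \<xi> \<eta> by (auto simp: a_def X_def n_def)
  define g where "g = complex_of_real (1/\<beta>)"
  define \<theta> where "\<theta> = (\<lambda>i. \<eta> i \<otimes> (g \<odot> a))"
  have \<theta>: "\<theta> \<in> I \<rightarrow> carrier A" using \<eta> c by (auto simp: \<theta>_def)
  define P Q where "P = adj A a \<otimes> a" and "Q = adj A a \<otimes> n \<otimes> a"
  have PQ: "P \<in> carrier A" "Q \<in> carrier A" using c by (auto simp: P_def Q_def)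
  have adja: "adj A a = ip I \<xi> \<eta>" unfolding a_def using \<xi> \<eta> by (rule ip_adj[rotated])
  have ga: "g \<odot> a \<in> carrier A" using c by simp
  have cnjg: "cnj g = g" by (simp add: g_def)
  have i1: "ip I \<xi> \<theta> = g \<odot> P"
  proof -
    have "ip I \<xi> \<theta> = adj A a \<otimes> (g \<odot> a)"
      using ip_mult_right[OF \<xi> \<eta> ga] by (simp only: \<theta>_def[symmetric] adja)
    then show ?thesis using c by (simp add: P_def smult_mult_right)
  qed
  have i2: "ip I \<theta> \<xi> = g \<odot> P"
  proof -
    have "ip I \<theta> \<xi> = adj A (g \<odot> P)" by (simp only: ip_adj[OF \<xi> \<theta>, symmetric] i1)
    then show ?thesis using c cnjg by (simp add: adj_smult P_def adj_mult)
  qed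
  have i3: "ip I \<theta> \<theta> = (g * g) \<odot> Q"
  proof -
    have "ip I \<theta> \<eta> = adj A (g \<odot> a) \<otimes> n"
      using ip_mult_left[OF \<eta> \<eta> ga] by (simp only: \<theta>_def[symmetric] n_def)
    moreover have "ip I \<theta> \<theta> = ip I \<theta> \<eta> \<otimes> (g \<odot> a)"
      using ip_mult_right[OF \<theta> \<eta> ga] by (simp only: \<theta>_def[symmetric])
    ultimately show ?thesis
      using c cnjg by (simp add: adj_smult Q_def smult_mult_left smult_mult_right)
  qed
  define \<zeta> where "\<zeta> = (\<lambda>i. \<xi> i \<ominus> \<theta> i)"
  have \<zeta>: "\<zeta> \<in> I \<rightarrow> carrier A" using \<xi> \<theta> by (auto simp: \<zeta>_def)
  have "ip I \<zeta> \<zeta> = (X \<ominus> g \<odot> P) \<ominus> (g \<odot> P \<ominus> (g * g) \<odot> Q)"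
  proof -
    have "ip I \<zeta> \<zeta> = ip I \<zeta> \<xi> \<ominus> ip I \<zeta> \<theta>"
      using ip_diff_right[OF \<zeta> \<xi> \<theta>] by (simp only: \<zeta>_def[symmetric])
    also have "ip I \<zeta> \<xi> = X \<ominus> g \<odot> P"
      using ip_diff_left[OF \<xi> \<xi> \<theta>] by (simp only: \<zeta>_def[symmetric] X_def i2)
    also have "ip I \<zeta> \<theta> = g \<odot> P \<ominus> (g * g) \<odot> Q"
      using ip_diff_left[OF \<theta> \<xi> \<theta>] by (simp only: \<zeta>_def[symmetric] i1 i3)
    finally show ?thesis .
  qed
  moreover have "pos (ip I \<zeta> \<zeta>)" by (rule ip_pos[OF \<zeta>])
  \<comment> \<open>Conjugating n <= \<beta> by a gives a* n a <= \<beta> a* a; scaling twice by g =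
    1 / \<beta> gives the claim. It absorbs the quadratic term and one of the two linear
    ones.\<close>
  moreover have "pos (g \<odot> P \<ominus> (g * g) \<odot> Q)"
  proof -
    have gg: "g * (g * complex_of_real \<beta>) = g"
      unfolding g_def of_real_mult[symmetric] using \<beta> by simp
    have "pos (complex_of_real \<beta> \<odot> \<one> \<ominus> n)"
      using pos_cnorm_diff[OF pos_selfadj[OF ip_pos[OF \<eta>]], of \<beta>] by (simp add: n_def \<beta>_def)
    then have "pos (adj A a \<otimes> (complex_of_real \<beta> \<odot> \<one> \<ominus> n) \<otimes> a)" using c by (intro pos_conj)
    also have "adj A a \<otimes> (complex_of_real \<beta> \<odot> \<one> \<ominus> n) \<otimes> a = complex_of_real \<beta> \<odot> P \<ominus> Q"
      unfolding P_def Q_def using c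
      by (simp add: diff_scale l_distr r_distr smult_mult_left smult_mult_right)
    finally have "pos (complex_of_real (1/\<beta>) \<odot> (complex_of_real (1/\<beta>) \<odot> (complex_of_real \<beta> \<odot> P \<ominus> Q)))"
      using \<beta> by (intro pos_scale) auto
    then have "pos (g \<odot> (g \<odot> (complex_of_real \<beta> \<odot> P \<ominus> Q)))" by (simp only: g_def)
    moreover have "g \<odot> (g \<odot> (complex_of_real \<beta> \<odot> P \<ominus> Q))
       = (g * (g * complex_of_real \<beta>)) \<odot> P \<ominus> (g * g) \<odot> Q"
      using PQ by (simp only: scale_diff_right scale_scale scale_closed mult.assoc minus_closed)
    ultimately show ?thesis unfolding gg by simp
  qed
  ultimately have "pos (((X \<ominus> g \<odot> P) \<ominus> (g \<odot> P \<ominus> (g * g) \<odot> Q)) \<oplus> (g \<odot> P \<ominus> (g * g) \<odot> Q))"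
    using pos_add by simp
  moreover have "((X \<ominus> g \<odot> P) \<ominus> (g \<odot> P \<ominus> (g * g) \<odot> Q)) \<oplus> (g \<odot> P \<ominus> (g * g) \<odot> Q) = X \<ominus> g \<odot> P"
  proof -
    define u v where "u = g \<odot> P" and "v = (g * g) \<odot> Q"
    have "u \<in> carrier A" "v \<in> carrier A" using PQ by (auto simp: u_def v_def)
    then show ?thesis unfolding u_def[symmetric] v_def[symmetric] using c by algebra
  qed
  ultimately have "pos (X \<ominus> g \<odot> P)" by simp
  moreover have "pos (g \<odot> P)"
    unfolding g_def P_def using \<beta> c by (intro pos_scale pos_adj_mult) auto
  ultimately have "cnorm A (g \<odot> P) \<le> cnorm A X" using pos_cnorm_mono c by blast
  then have "(cnorm A a)\<^sup>2 / \<beta> \<le> cnorm A X"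
    unfolding cnorm_smult[OF PQ(1)] using \<beta>
    by (simp add: g_def norm_divide P_def cstar_identity[OF c(1)])
  then have "(cnorm A a)\<^sup>2 \<le> \<beta> * cnorm A X"
    using \<beta> by (simp add: pos_divide_le_eq mult.commute)
  then have "(cnorm A a)\<^sup>2 \<le> (hnorm I \<eta> * hnorm I \<xi>)\<^sup>2"
    by (simp only: power_mult_distrib hnorm_square[OF \<xi>] hnorm_square[OF \<eta>] \<beta>_def X_def)
  then show ?thesis
    unfolding a_def
    by (rule power2_le_imp_le) (intro mult_nonneg_nonneg hnorm_nonneg \<xi> \<eta>)
qed

lemma hnorm_scale:
  assumes \<xi>: "\<xi> \<in> I \<rightarrow> carrier A"
  shows "hnorm I (\<lambda>i. c \<odot> \<xi> i) = cmod c * hnorm I \<xi>"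
proof -
  have "ip I (\<lambda>i. c \<odot> \<xi> i) (\<lambda>i. c \<odot> \<xi> i) = (cnj c * c) \<odot> ip I \<xi> \<xi>"
    unfolding ip_def using \<xi> I
    by (subst finsum_scale)
      (auto intro!: finsum_cong' simp: adj_smult smult_mult_left smult_mult_right Pi_def mult.commute)
  moreover have c: "(\<lambda>i. c \<odot> \<xi> i) \<in> I \<rightarrow> carrier A" using \<xi> by auto
  ultimately have "(hnorm I (\<lambda>i. c \<odot> \<xi> i))\<^sup>2 = (cmod c * hnorm I \<xi>)\<^sup>2"
    using \<xi> by (simp add: hnorm_square[OF c] cnorm_smult power_mult_distrib hnorm_square[OF \<xi>]
      norm_mult power2_eq_square[of "cmod c"])
  then show ?thesis
    using hnorm_nonneg[OF \<xi>] hnorm_nonneg[OF c] by (simp add: power2_eq_iff_nonneg)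
qed

section \<open>Operator norms of matrices over \<open>A\<close>\<close>

lemma mat_app_closed [simp, intro]:
  assumes "\<And>i j. i \<in> I \<Longrightarrow> j \<in> I \<Longrightarrow> X i j \<in> carrier A" "\<xi> \<in> I \<rightarrow> carrier A"
  shows "mat_app I X \<xi> \<in> I \<rightarrow> carrier A"
  unfolding mat_app_def using assms by (auto intro!: finsum_closed)

context
  fixes X :: "'i \<Rightarrow> 'i \<Rightarrow> 'a"
  assumes X: "\<And>i j. i \<in> I \<Longrightarrow> j \<in> I \<Longrightarrow> X i j \<in> carrier A"
begin

text \<open>The constant is crude. It serves to bound the set whose supremum is
  \<open>opnorm\<close>, without which the supremum would carry no information.\<close>

lemma mat_app_bounded:
  assumes \<xi>: "\<xi> \<in> I \<rightarrow> carrier A"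
  shows "hnorm I (mat_app I X \<xi>) \<le> (\<Sum>i\<in>I. \<Sum>j\<in>I. cnorm A (X i j)) * hnorm I \<xi>"
proof -
  have "hnorm I (mat_app I X \<xi>) \<le> (\<Sum>i\<in>I. cnorm A (mat_app I X \<xi> i))"
    using X \<xi> by (intro hnorm_le_sum mat_app_closed)
  also have "\<dots> \<le> (\<Sum>i\<in>I. \<Sum>j\<in>I. cnorm A (X i j) * hnorm I \<xi>)"
  proof (intro sum_mono)
    fix i assume i: "i \<in> I"
    have "cnorm A (mat_app I X \<xi> i) \<le> (\<Sum>j\<in>I. cnorm A (X i j \<otimes> \<xi> j))"
      unfolding mat_app_def using I X \<xi> i by (intro cnorm_finsum_le) auto
    also have "\<dots> \<le> (\<Sum>j\<in>I. cnorm A (X i j) * hnorm I \<xi>)"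
    proof (intro sum_mono)
      fix j assume j: "j \<in> I"
      have "cnorm A (X i j \<otimes> \<xi> j) \<le> cnorm A (X i j) * cnorm A (\<xi> j)"
        using X i j \<xi> by (intro cnorm_mult) auto
      also have "\<dots> \<le> cnorm A (X i j) * hnorm I \<xi>"
        using X i j \<xi> by (intro mult_left_mono cnorm_entry_le_hnorm) auto
      finally show "cnorm A (X i j \<otimes> \<xi> j) \<le> cnorm A (X i j) * hnorm I \<xi>" .
    qed
    finally show "cnorm A (mat_app I X \<xi> i) \<le> (\<Sum>j\<in>I. cnorm A (X i j) * hnorm I \<xi>)" .
  qed
  finally show ?thesis by (simp add: sum_distrib_right)
qed

lemma hnorm_zero: "hnorm I (\<lambda>i. \<zero>) = 0"
  by (simp add: hilbert_module_norm_def finsum_zero)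

lemma opnorm_bdd:
  "bdd_above ((\<lambda>\<xi>. hnorm I (mat_app I X \<xi>)) ` {\<xi>. \<xi> \<in> I \<rightarrow> carrier A \<and> hnorm I \<xi> \<le> 1})"
proof (rule bdd_aboveI2)
  fix \<xi> assume "\<xi> \<in> {\<xi>. \<xi> \<in> I \<rightarrow> carrier A \<and> hnorm I \<xi> \<le> 1}"
  then have \<xi>: "\<xi> \<in> I \<rightarrow> carrier A" "hnorm I \<xi> \<le> 1" by auto
  have "hnorm I (mat_app I X \<xi>) \<le> (\<Sum>i\<in>I. \<Sum>j\<in>I. cnorm A (X i j)) * hnorm I \<xi>"
    by (rule mat_app_bounded[OF \<xi>(1)])
  also have "\<dots> \<le> (\<Sum>i\<in>I. \<Sum>j\<in>I. cnorm A (X i j))"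
    using \<xi> X by (intro mult_left_le) (auto intro!: sum_nonneg)
  finally show "hnorm I (mat_app I X \<xi>) \<le> (\<Sum>i\<in>I. \<Sum>j\<in>I. cnorm A (X i j))" .
qed

lemma opnorm_nonneg: "0 \<le> opnorm I X"
proof -
  have "hnorm I (mat_app I X (\<lambda>i. \<zero>)) \<le> opnorm I X"
    unfolding hilbert_module_op_norm_def
    by (rule cSUP_upper[OF _ opnorm_bdd]) (simp add: hnorm_zero)
  moreover have "0 \<le> hnorm I (mat_app I X (\<lambda>i. \<zero>))"
    using X by (intro hnorm_nonneg mat_app_closed) auto
  ultimately show ?thesis by linarith
qed

lemma hnorm_mat_app_le:
  assumes \<xi>: "\<xi> \<in> I \<rightarrow> carrier A"
  shows "hnorm I (mat_app I X \<xi>) \<le> opnorm I X * hnorm I \<xi>"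
proof (cases "hnorm I \<xi> = 0")
  case True
  \<comment> \<open>A vector of norm 0 cannot be normalised; the crude bound shows that its image
    has norm 0 too.\<close>
  then show ?thesis using mat_app_bounded[OF \<xi>] by simp
next
  case False
  then have p: "hnorm I \<xi> > 0" using hnorm_nonneg[OF \<xi>] by linarith
  define c where "c = complex_of_real (1 / hnorm I \<xi>)"
  define \<eta> where "\<eta> = (\<lambda>i. c \<odot> \<xi> i)"
  have \<eta>: "\<eta> \<in> I \<rightarrow> carrier A" "hnorm I \<eta> \<le> 1"
    unfolding \<eta>_def hnorm_scale[OF \<xi>] using \<xi> p by (auto simp: c_def norm_divide)
  have "hnorm I (mat_app I X \<eta>) \<le> opnorm I X"
    unfolding hilbert_module_op_norm_def
    by (rule cSUP_upper[OF _ opnorm_bdd]) (use \<eta> in simp)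
  moreover have "hnorm I (mat_app I X \<eta>) = hnorm I (\<lambda>i. c \<odot> mat_app I X \<xi> i)"
  proof -
    have "mat_app I X \<eta> i = c \<odot> mat_app I X \<xi> i" if "i \<in> I" for i
      unfolding mat_app_def \<eta>_def using I X \<xi> that
      by (subst finsum_scale) (auto intro!: finsum_cong' simp: smult_mult_right Pi_def)
    then have "ip I (mat_app I X \<eta>) (mat_app I X \<eta>)
        = ip I (\<lambda>i. c \<odot> mat_app I X \<xi> i) (\<lambda>i. c \<odot> mat_app I X \<xi> i)"
      unfolding ip_def using mat_app_closed[OF X \<xi>]
      by (intro finsum_cong') (auto simp: Pi_def)
    then show ?thesis by (simp add: hilbert_module_norm_def ip_def)
  qed
  moreover have "\<dots> = (1 / hnorm I \<xi>) * hnorm I (mat_app I X \<xi>)"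
    using X \<xi> p by (subst hnorm_scale) (auto simp: c_def norm_divide)
  ultimately show ?thesis using p by (simp add: field_simps)
qed

lemma opnorm_le:
  assumes "\<And>\<xi>. \<xi> \<in> I \<rightarrow> carrier A \<Longrightarrow> hnorm I (mat_app I X \<xi>) \<le> c * hnorm I \<xi>" "0 \<le> c"
  shows "opnorm I X \<le> c"
  unfolding hilbert_module_op_norm_def
proof (rule cSUP_least)
  show "{\<xi>. \<xi> \<in> I \<rightarrow> carrier A \<and> hnorm I \<xi> \<le> 1} \<noteq> {}"
    using hnorm_zero by (auto intro!: exI[of _ "\<lambda>i. \<zero>"])
  fix \<xi> assume "\<xi> \<in> {\<xi>. \<xi> \<in> I \<rightarrow> carrier A \<and> hnorm I \<xi> \<le> 1}"
  then show "hnorm I (mat_app I X \<xi>) \<le> c"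
    using assms(1)[of \<xi>] mult_left_le[of "hnorm I \<xi>" c] assms(2) by auto
qed

text \<open>The entry is read off from the image of the j-th unit vector, whose norm is at most
  1.\<close>

lemma cnorm_entry_le_opnorm:
  assumes "i \<in> I" "j \<in> I"
  shows "cnorm A (X i j) \<le> opnorm I X"
proof -
  define \<delta> where "\<delta> = (\<lambda>k. if k = j then \<one> else \<zero>)"
  have \<delta>: "\<delta> \<in> I \<rightarrow> carrier A" by (auto simp: \<delta>_def)
  have closed: "mat_app I X \<delta> \<in> I \<rightarrow> carrier A"
    by (intro mat_app_closed X \<delta>)
  have "mat_app I X \<delta> i = (\<Oplus>k\<in>I. if j = k then X i k else \<zero>)"
    unfolding mat_app_def \<delta>_def using X assms by (intro finsum_cong') auto
  also have "\<dots> = X i j" using I X assms by (intro finsum_singleton) auto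
  finally have "cnorm A (X i j) \<le> hnorm I (mat_app I X \<delta>)"
    using cnorm_entry_le_hnorm[OF closed assms(1)] by simp
  also have "\<dots> \<le> opnorm I X * hnorm I \<delta>" by (rule hnorm_mat_app_le[OF \<delta>])
  also have "hnorm I \<delta> \<le> (\<Sum>k\<in>I. cnorm A (\<delta> k))" by (rule hnorm_le_sum[OF \<delta>])
  also have "\<dots> = (\<Sum>k\<in>I. if k = j then cnorm A \<one> else 0)"
    by (intro sum.cong) (auto simp: \<delta>_def)
  also have "\<dots> \<le> 1" using I assms cnorm_one_le by simp
  finally show ?thesis using opnorm_nonneg by (simp add: mult_left_mono)
qed

lemma ip_mat_app:
  assumes \<xi>: "\<xi> \<in> I \<rightarrow> carrier A" and \<eta>: "\<eta> \<in> I \<rightarrow> carrier A"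
  shows "ip I (mat_app I (\<lambda>i j. adj A (X j i)) \<xi>) \<eta> = ip I \<xi> (mat_app I X \<eta>)"
proof -
  have c: "\<xi> i \<in> carrier A" "\<eta> i \<in> carrier A" if "i \<in> I" for i using \<xi> \<eta> that by auto
  have "ip I (mat_app I (\<lambda>i j. adj A (X j i)) \<xi>) \<eta>
      = (\<Oplus>i\<in>I. \<Oplus>j\<in>I. adj A (\<xi> j) \<otimes> X j i \<otimes> \<eta> i)"
    unfolding ip_def mat_app_def
  proof (intro finsum_eqI finsum_closed_family)
    fix i assume i: "i \<in> I"
    have "adj A (\<Oplus>j\<in>I. adj A (X j i) \<otimes> \<xi> j) = (\<Oplus>j\<in>I. adj A (adj A (X j i) \<otimes> \<xi> j))"
      using I X c i by (intro finsum_adj) auto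
    also have "\<dots> = (\<Oplus>j\<in>I. adj A (\<xi> j) \<otimes> X j i)"
      using X c i by (intro finsum_eqI) (auto simp: adj_mult)
    finally show "adj A (\<Oplus>j\<in>I. adj A (X j i) \<otimes> \<xi> j) \<otimes> \<eta> i = (\<Oplus>j\<in>I. adj A (\<xi> j) \<otimes> X j i \<otimes> \<eta> i)"
      using I X c i by (simp add: finsum_mult_right)
  qed (use X c in auto)
  also have "\<dots> = (\<Oplus>j\<in>I. \<Oplus>i\<in>I. adj A (\<xi> j) \<otimes> X j i \<otimes> \<eta> i)"
    using I X c by (intro finsum_swap) auto
  also have "\<dots> = ip I \<xi> (mat_app I X \<eta>)"
    unfolding ip_def mat_app_def
  proof (intro finsum_eqI m_closed finsum_closed_family adj_closed)
    fix j assume j: "j \<in> I"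
    show "(\<Oplus>i\<in>I. adj A (\<xi> j) \<otimes> X j i \<otimes> \<eta> i) = adj A (\<xi> j) \<otimes> (\<Oplus>i\<in>I. X j i \<otimes> \<eta> i)"
      using I X c j by (subst finsum_mult_left) (auto intro!: finsum_eqI simp: m_assoc)
  qed (use X c in auto)
  finally show ?thesis .
qed

end

text \<open>With \<zeta> the image of \<xi> under the adjoint matrix, ||\<zeta>||^2 is the norm of
  <\<xi>, X \<zeta>>, hence at most ||\<xi>|| ||X|| ||\<zeta>|| by Cauchy-Schwarz; one factor
  ||\<zeta>|| cancels.\<close>

lemma opnorm_adj_le:
  assumes X: "\<And>i j. i \<in> I \<Longrightarrow> j \<in> I \<Longrightarrow> X i j \<in> carrier A"
  shows "opnorm I (\<lambda>i j. adj A (X j i)) \<le> opnorm I X"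
proof (rule opnorm_le)
  fix \<xi> assume \<xi>: "\<xi> \<in> I \<rightarrow> carrier A"
  define \<zeta> where "\<zeta> = mat_app I (\<lambda>i j. adj A (X j i)) \<xi>"
  have \<zeta>: "\<zeta> \<in> I \<rightarrow> carrier A" unfolding \<zeta>_def using X \<xi> by (intro mat_app_closed) auto
  have "(hnorm I \<zeta>)\<^sup>2 = cnorm A (ip I \<xi> (mat_app I X \<zeta>))"
    unfolding hnorm_square[OF \<zeta>] using ip_mat_app[OF X \<xi> \<zeta>] by (simp add: \<zeta>_def)
  also have "\<dots> \<le> hnorm I \<xi> * hnorm I (mat_app I X \<zeta>)"
    using X \<xi> \<zeta> by (intro hnorm_Cauchy_Schwarz mat_app_closed)
  also have "\<dots> \<le> hnorm I \<xi> * (opnorm I X * hnorm I \<zeta>)"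
    using hnorm_mat_app_le[OF X \<zeta>] hnorm_nonneg[OF \<xi>] by (intro mult_left_mono)
  finally have "hnorm I \<zeta> * hnorm I \<zeta> \<le> (opnorm I X * hnorm I \<xi>) * hnorm I \<zeta>"
    by (simp add: power2_eq_square mult_ac)
  then show "hnorm I \<zeta> \<le> opnorm I X * hnorm I \<xi>"
    using hnorm_nonneg[OF \<zeta>] hnorm_nonneg[OF \<xi>] opnorm_nonneg[OF X]
    by (cases "hnorm I \<zeta> = 0") auto
qed (use X opnorm_nonneg in auto)

lemma mat_app_mult:
  assumes X: "\<And>i j. i \<in> I \<Longrightarrow> j \<in> I \<Longrightarrow> X i j \<in> carrier A"
    and Y: "\<And>i j. i \<in> I \<Longrightarrow> j \<in> I \<Longrightarrow> Y i j \<in> carrier A"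
    and \<xi>: "\<xi> \<in> I \<rightarrow> carrier A" and i: "i \<in> I"
  shows "mat_app I (\<lambda>i j. \<Oplus>k\<in>I. X i k \<otimes> Y k j) \<xi> i = mat_app I X (mat_app I Y \<xi>) i"
proof -
  have c: "\<xi> j \<in> carrier A" if "j \<in> I" for j using \<xi> that by auto
  have "mat_app I (\<lambda>i j. \<Oplus>k\<in>I. X i k \<otimes> Y k j) \<xi> i = (\<Oplus>j\<in>I. \<Oplus>k\<in>I. X i k \<otimes> Y k j \<otimes> \<xi> j)"
    unfolding mat_app_def using I X Y c i
    by (intro finsum_eqI finsum_mult_right finsum_closed_family) auto
  also have "\<dots> = (\<Oplus>k\<in>I. \<Oplus>j\<in>I. X i k \<otimes> Y k j \<otimes> \<xi> j)"
    using I X Y c i by (intro finsum_swap) auto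
  also have "\<dots> = mat_app I X (mat_app I Y \<xi>) i"
    unfolding mat_app_def
  proof (intro finsum_eqI m_closed finsum_closed_family)
    fix k assume k: "k \<in> I"
    show "(\<Oplus>j\<in>I. X i k \<otimes> Y k j \<otimes> \<xi> j) = X i k \<otimes> (\<Oplus>j\<in>I. Y k j \<otimes> \<xi> j)"
      using I X Y c i k by (subst finsum_mult_left) (auto intro!: finsum_eqI simp: m_assoc)
  qed (use X Y c i in auto)
  finally show ?thesis .
qed

lemma hnorm_cong:
  assumes "\<And>i. i \<in> I \<Longrightarrow> \<xi> i = \<eta> i" "\<eta> \<in> I \<rightarrow> carrier A"
  shows "hnorm I \<xi> = hnorm I \<eta>"
proof -
  have "ip I \<xi> \<xi> = ip I \<eta> \<eta>"
    unfolding ip_def using assms by (intro finsum_cong') (auto simp: Pi_def)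
  then show ?thesis by (simp add: hilbert_module_norm_def ip_def)
qed

lemma opnorm_mult_le:
  assumes X: "\<And>i j. i \<in> I \<Longrightarrow> j \<in> I \<Longrightarrow> X i j \<in> carrier A"
    and Y: "\<And>i j. i \<in> I \<Longrightarrow> j \<in> I \<Longrightarrow> Y i j \<in> carrier A"
  shows "opnorm I (\<lambda>i j. \<Oplus>k\<in>I. X i k \<otimes> Y k j) \<le> opnorm I X * opnorm I Y"
proof (rule opnorm_le)
  fix \<xi> assume \<xi>: "\<xi> \<in> I \<rightarrow> carrier A"
  have "hnorm I (mat_app I (\<lambda>i j. \<Oplus>k\<in>I. X i k \<otimes> Y k j) \<xi>) = hnorm I (mat_app I X (mat_app I Y \<xi>))"
    using X Y \<xi> by (intro hnorm_cong mat_app_mult mat_app_closed)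
  also have "\<dots> \<le> opnorm I X * hnorm I (mat_app I Y \<xi>)"
    using X Y \<xi> by (intro hnorm_mat_app_le mat_app_closed)
  also have "\<dots> \<le> opnorm I X * (opnorm I Y * hnorm I \<xi>)"
    using X Y \<xi> by (intro mult_left_mono hnorm_mat_app_le opnorm_nonneg)
  finally show "hnorm I (mat_app I (\<lambda>i j. \<Oplus>k\<in>I. X i k \<otimes> Y k j) \<xi>)
      \<le> opnorm I X * opnorm I Y * hnorm I \<xi>" by (simp add: mult_ac)
qed (use X Y opnorm_nonneg in \<open>auto intro!: finsum_closed mult_nonneg_nonneg\<close>)

end

end

lemma (in unital_cstar) opnorm_cong:
  assumes "finite I" and X: "\<And>i j. i \<in> I \<Longrightarrow> j \<in> I \<Longrightarrow> X i j = Y i j"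
    and Y: "\<And>i j. i \<in> I \<Longrightarrow> j \<in> I \<Longrightarrow> Y i j \<in> carrier A"
  shows "opnorm I X = opnorm I Y"
  unfolding hilbert_module_op_norm_def
proof (intro SUP_cong refl hnorm_cong assms(1))
  fix \<xi> i assume \<xi>: "\<xi> \<in> {\<xi>. \<xi> \<in> I \<rightarrow> carrier A \<and> hnorm I \<xi> \<le> 1}"
  show "i \<in> I \<Longrightarrow> mat_app I X \<xi> i = mat_app I Y \<xi> i"
    unfolding mat_app_def using X Y \<xi> by (intro finsum_eqI) auto
  show "mat_app I Y \<xi> \<in> I \<rightarrow> carrier A"
    using Y \<xi> by (intro mat_app_closed assms(1)) auto
qed

section \<open>Crossed products by finite groups\<close>

locale finite_cstar_dynamics = unital_cstar A + G: group G
  for A :: "'a cstar_struct" (structure) and G :: "('g, 'm) monoid_scheme" +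
  fixes \<alpha> :: "'g \<Rightarrow> 'a \<Rightarrow> 'a"
  assumes finite_group: "finite (carrier G)"
    and action: "cstar_action G A \<alpha>"
begin

lemma star_hom_action: "g \<in> carrier G \<Longrightarrow> star_hom A A (\<alpha> g)"
  using action by (simp add: cstar_action_def)

lemma act_closed [simp, intro]: "g \<in> carrier G \<Longrightarrow> x \<in> carrier A \<Longrightarrow> \<alpha> g x \<in> carrier A"
  using star_hom_action[of g] by (auto simp: star_hom_def cstar_linear_def Pi_def)

lemma act_add:
  "g \<in> carrier G \<Longrightarrow> x \<in> carrier A \<Longrightarrow> y \<in> carrier A \<Longrightarrow> \<alpha> g (x \<oplus> y) = \<alpha> g x \<oplus> \<alpha> g y"
  using star_hom_action by (auto simp: star_hom_def cstar_linear_def)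

lemma act_scale: "g \<in> carrier G \<Longrightarrow> x \<in> carrier A \<Longrightarrow> \<alpha> g (c \<odot> x) = c \<odot> \<alpha> g x"
  using star_hom_action by (auto simp: star_hom_def cstar_linear_def)

lemma act_mult:
  "g \<in> carrier G \<Longrightarrow> x \<in> carrier A \<Longrightarrow> y \<in> carrier A \<Longrightarrow> \<alpha> g (x \<otimes> y) = \<alpha> g x \<otimes> \<alpha> g y"
  using star_hom_action by (auto simp: star_hom_def)

lemma act_adj: "g \<in> carrier G \<Longrightarrow> x \<in> carrier A \<Longrightarrow> \<alpha> g (adj A x) = adj A (\<alpha> g x)"
  using star_hom_action by (auto simp: star_hom_def)

lemma act_one_group [simp]: "x \<in> carrier A \<Longrightarrow> \<alpha> \<one>\<^bsub>G\<^esub> x = x"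
  using group_action.id_eq_one[of G "carrier A" \<alpha>] action
  by (metis cstar_action_def restrict_apply')

lemma act_comp:
  "g \<in> carrier G \<Longrightarrow> h \<in> carrier G \<Longrightarrow> x \<in> carrier A \<Longrightarrow> \<alpha> g (\<alpha> h x) = \<alpha> (g \<otimes>\<^bsub>G\<^esub> h) x"
  using group_action.composition_rule[of G "carrier A" \<alpha> x g h] action
  by (simp add: cstar_action_def)

lemma act_zero [simp]: "g \<in> carrier G \<Longrightarrow> \<alpha> g \<zero> = \<zero>"
  using act_scale[of g \<zero> 0] by simp

text \<open>Preservation of the unit is not part of \<open>star_hom\<close>. It follows from
  surjectivity: apply \<alpha> g to 1 x = x, where x is a preimage of 1.\<close>

lemma act_one [simp]:
  assumes g: "g \<in> carrier G"
  shows "\<alpha> g \<one> = \<one>"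
proof -
  define x where "x = \<alpha> (inv\<^bsub>G\<^esub> g) \<one>"
  have x: "x \<in> carrier A" "\<alpha> g x = \<one>" using g by (auto simp: x_def act_comp)
  have "\<alpha> g (\<one> \<otimes> x) = \<alpha> g \<one> \<otimes> \<alpha> g x" using g x by (intro act_mult) auto
  then show ?thesis using g x by simp
qed

lemma act_finsum:
  assumes "g \<in> carrier G" "finite I" "\<And>i. i \<in> I \<Longrightarrow> f i \<in> carrier A"
  shows "\<alpha> g (\<Oplus>i\<in>I. f i) = (\<Oplus>i\<in>I. \<alpha> g (f i))"
  using assms(2,3)
proof (induction I rule: finite_induct)
  case (insert i I)
  then have "f i \<in> carrier A" "f \<in> I \<rightarrow> carrier A" "(\<lambda>i. \<alpha> g (f i)) \<in> I \<rightarrow> carrier A"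
    using assms(1) by auto
  then show ?case using insert assms(1) by (simp add: act_add)
qed (use assms in simp)

lemma act_pos: "g \<in> carrier G \<Longrightarrow> pos p \<Longrightarrow> pos (\<alpha> g p)"
  unfolding pos_def selfadj_def by (metis act_adj act_closed act_mult)

abbreviation B :: "('g \<Rightarrow> 'a) cstar_struct" where
  "B \<equiv> crossed_product G A \<alpha>"

lemma crossed_carrier: "carrier B = carrier G \<rightarrow>\<^sub>E carrier A"
  by (simp add: crossed_product_def)

lemma crossed_closed: "f \<in> carrier B \<Longrightarrow> t \<in> carrier G \<Longrightarrow> f t \<in> carrier A"
  by (auto simp: crossed_carrier)

lemma crossed_eqI:
  "f \<in> carrier B \<Longrightarrow> h \<in> carrier B \<Longrightarrow> (\<And>t. t \<in> carrier G \<Longrightarrow> f t = h t) \<Longrightarrow> f = h"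
  unfolding crossed_carrier by (rule PiE_ext)

lemma crossed_add: "t \<in> carrier G \<Longrightarrow> (f \<oplus>\<^bsub>B\<^esub> h) t = f t \<oplus> h t"
  and crossed_scale: "t \<in> carrier G \<Longrightarrow> (c \<odot>\<^bsub>B\<^esub> f) t = c \<odot> f t"
  and crossed_zero: "t \<in> carrier G \<Longrightarrow> \<zero>\<^bsub>B\<^esub> t = \<zero>"
  and crossed_adj: "t \<in> carrier G \<Longrightarrow> adj B f t = \<alpha> t (adj A (f (inv\<^bsub>G\<^esub> t)))"
  and crossed_mult: "t \<in> carrier G \<Longrightarrow>
    (f \<otimes>\<^bsub>B\<^esub> h) t = (\<Oplus>s\<in>carrier G. f s \<otimes> \<alpha> s (h (inv\<^bsub>G\<^esub> s \<otimes>\<^bsub>G\<^esub> t)))"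
  by (simp_all add: crossed_product_def)

lemma crossed_add_closed: "f \<in> carrier B \<Longrightarrow> h \<in> carrier B \<Longrightarrow> f \<oplus>\<^bsub>B\<^esub> h \<in> carrier B"
  by (auto simp: crossed_product_def)

lemma crossed_scale_closed: "f \<in> carrier B \<Longrightarrow> c \<odot>\<^bsub>B\<^esub> f \<in> carrier B"
  by (auto simp: crossed_product_def)

lemma crossed_zero_closed: "\<zero>\<^bsub>B\<^esub> \<in> carrier B"
  by (auto simp: crossed_product_def)

lemma crossed_adj_closed: "f \<in> carrier B \<Longrightarrow> adj B f \<in> carrier B"
  by (auto simp: crossed_product_def)

lemma crossed_mult_closed: "f \<in> carrier B \<Longrightarrow> h \<in> carrier B \<Longrightarrow> f \<otimes>\<^bsub>B\<^esub> h \<in> carrier B"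
  unfolding crossed_carrier PiE_iff extensional_def
  by (auto simp: crossed_product_def intro!: finsum_closed_family m_closed act_closed)

lemma crossed_abelian_monoid: "abelian_monoid B"
proof (rule abelian_monoidI)
  fix f h k assume "f \<in> carrier B" "h \<in> carrier B" "k \<in> carrier B"
  then show "(f \<oplus>\<^bsub>B\<^esub> h) \<oplus>\<^bsub>B\<^esub> k = f \<oplus>\<^bsub>B\<^esub> (h \<oplus>\<^bsub>B\<^esub> k)"
    by (intro crossed_eqI crossed_add_closed) (auto simp: crossed_add crossed_closed a_assoc)
next
  fix f h assume "f \<in> carrier B" "h \<in> carrier B"
  then show "f \<oplus>\<^bsub>B\<^esub> h = h \<oplus>\<^bsub>B\<^esub> f"
    by (intro crossed_eqI crossed_add_closed) (auto simp: crossed_add crossed_closed a_comm)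
next
  fix f assume "f \<in> carrier B"
  then show "\<zero>\<^bsub>B\<^esub> \<oplus>\<^bsub>B\<^esub> f = f"
    by (intro crossed_eqI crossed_add_closed crossed_zero_closed)
      (auto simp: crossed_add crossed_zero crossed_closed)
qed (auto intro: crossed_add_closed crossed_zero_closed)

lemma crossed_finsum_closed:
  assumes "\<And>i. i \<in> I \<Longrightarrow> F i \<in> carrier B"
  shows "(\<Oplus>\<^bsub>B\<^esub>i\<in>I. F i) \<in> carrier B"
  using assms by (intro abelian_monoid.finsum_closed[OF crossed_abelian_monoid]) auto

lemma crossed_finsum:
  assumes "finite I" "\<And>i. i \<in> I \<Longrightarrow> F i \<in> carrier B" "t \<in> carrier G"
  shows "(\<Oplus>\<^bsub>B\<^esub>i\<in>I. F i) t = (\<Oplus>i\<in>I. F i t)"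
  using assms(1,2)
proof (induction I rule: finite_induct)
  case empty
  then show ?case
    using assms(3) by (simp add: abelian_monoid.finsum_empty[OF crossed_abelian_monoid] crossed_zero)
next
  case (insert i I)
  then have "F i \<in> carrier B" "F \<in> I \<rightarrow> carrier B" by auto
  moreover have "(\<lambda>i. F i t) \<in> I \<rightarrow> carrier A" "F i t \<in> carrier A"
    using insert assms(3) crossed_closed by auto
  ultimately show ?case
    using insert assms(3)
    by (simp add: abelian_monoid.finsum_insert[OF crossed_abelian_monoid] crossed_add)
qed

lemma finsum_group_reindex:
  assumes "bij_betw h (carrier G) (carrier G)" "\<And>s. s \<in> carrier G \<Longrightarrow> f s \<in> carrier A"
  shows "(\<Oplus>s\<in>carrier G. f s) = (\<Oplus>q\<in>carrier G. f (h q))"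
proof -
  have "h ` carrier G = carrier G" "inj_on h (carrier G)" using assms(1) by (auto simp: bij_betw_def)
  then show ?thesis
    using finsum_reindex[of f h "carrier G"] assms(2) by auto
qed

text \<open>The substitution s = t q^-1, which turns convolution sums over s into matrix products
  over q.\<close>

lemma bij_mult_inv:
  assumes t: "t \<in> carrier G"
  shows "bij_betw (\<lambda>q. t \<otimes>\<^bsub>G\<^esub> inv\<^bsub>G\<^esub> q) (carrier G) (carrier G)"
  by (rule bij_betw_byWitness[where f' = "\<lambda>s. inv\<^bsub>G\<^esub> s \<otimes>\<^bsub>G\<^esub> t"])
    (use t in \<open>auto simp: G.inv_mult_group G.m_assoc\<close>,
     use t in \<open>auto simp: G.m_assoc[symmetric]\<close>)

text \<open>The matrix of \<open>f\<close> in the regular representation defining the norm of the crossed product.\<close>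

definition regular :: "('g \<Rightarrow> 'a) \<Rightarrow> 'g \<Rightarrow> 'g \<Rightarrow> 'a" where
  "regular f t r = \<alpha> (inv\<^bsub>G\<^esub> t) (f (t \<otimes>\<^bsub>G\<^esub> inv\<^bsub>G\<^esub> r))"

lemma regular_closed [simp, intro]:
  "f \<in> carrier B \<Longrightarrow> t \<in> carrier G \<Longrightarrow> r \<in> carrier G \<Longrightarrow> regular f t r \<in> carrier A"
  unfolding regular_def using crossed_closed by auto

lemma regular_add:
  "f \<in> carrier B \<Longrightarrow> h \<in> carrier B \<Longrightarrow> t \<in> carrier G \<Longrightarrow> r \<in> carrier G \<Longrightarrow>
    regular (f \<oplus>\<^bsub>B\<^esub> h) t r = regular f t r \<oplus> regular h t r"
  unfolding regular_def by (simp add: crossed_add crossed_closed act_add)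

lemma regular_scale:
  "f \<in> carrier B \<Longrightarrow> t \<in> carrier G \<Longrightarrow> r \<in> carrier G \<Longrightarrow>
    regular (c \<odot>\<^bsub>B\<^esub> f) t r = c \<odot> regular f t r"
  unfolding regular_def by (simp add: crossed_scale crossed_closed act_scale)

lemma regular_finsum:
  assumes "finite I" "\<And>i. i \<in> I \<Longrightarrow> F i \<in> carrier B" "t \<in> carrier G" "r \<in> carrier G"
  shows "regular (\<Oplus>\<^bsub>B\<^esub>i\<in>I. F i) t r = (\<Oplus>i\<in>I. regular (F i) t r)"
  unfolding regular_def using assms crossed_closed
  by (simp add: crossed_finsum act_finsum)

lemma regular_adj:
  assumes "f \<in> carrier B" "t \<in> carrier G" "r \<in> carrier G"
  shows "regular (adj B f) t r = adj A (regular f r t)"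
proof -
  have "inv\<^bsub>G\<^esub> (t \<otimes>\<^bsub>G\<^esub> inv\<^bsub>G\<^esub> r) = r \<otimes>\<^bsub>G\<^esub> inv\<^bsub>G\<^esub> t" "inv\<^bsub>G\<^esub> t \<otimes>\<^bsub>G\<^esub> (t \<otimes>\<^bsub>G\<^esub> inv\<^bsub>G\<^esub> r) = inv\<^bsub>G\<^esub> r"
    using assms by (auto simp: G.inv_mult_group G.m_assoc[symmetric])
  then show ?thesis
    unfolding regular_def using assms
    by (simp add: crossed_adj act_comp act_adj crossed_closed)
qed

text \<open>After s = t q^-1 the group elements cancel: f is evaluated at t q^-1, h at q r^-1, and
  the automorphism in front of h is the one of t^-1 t q^-1 = q^-1.\<close>

lemma regular_mult:
  assumes f: "f \<in> carrier B" and h: "h \<in> carrier B" and t: "t \<in> carrier G" and r: "r \<in> carrier G"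
  shows "regular (f \<otimes>\<^bsub>B\<^esub> h) t r = (\<Oplus>q\<in>carrier G. regular f t q \<otimes> regular h q r)"
proof -
  let ?tr = "t \<otimes>\<^bsub>G\<^esub> inv\<^bsub>G\<^esub> r"
  have "regular (f \<otimes>\<^bsub>B\<^esub> h) t r
      = \<alpha> (inv\<^bsub>G\<^esub> t) (\<Oplus>s\<in>carrier G. f s \<otimes> \<alpha> s (h (inv\<^bsub>G\<^esub> s \<otimes>\<^bsub>G\<^esub> ?tr)))"
    unfolding regular_def using t r by (simp add: crossed_mult)
  also have "\<dots> = (\<Oplus>s\<in>carrier G. \<alpha> (inv\<^bsub>G\<^esub> t) (f s \<otimes> \<alpha> s (h (inv\<^bsub>G\<^esub> s \<otimes>\<^bsub>G\<^esub> ?tr))))"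
    using t r f h finite_group crossed_closed by (intro act_finsum) auto
  also have "\<dots> = (\<Oplus>q\<in>carrier G. \<alpha> (inv\<^bsub>G\<^esub> t) (f (t \<otimes>\<^bsub>G\<^esub> inv\<^bsub>G\<^esub> q) \<otimes>
      \<alpha> (t \<otimes>\<^bsub>G\<^esub> inv\<^bsub>G\<^esub> q) (h (inv\<^bsub>G\<^esub> (t \<otimes>\<^bsub>G\<^esub> inv\<^bsub>G\<^esub> q) \<otimes>\<^bsub>G\<^esub> ?tr))))"
    using t r f h crossed_closed by (intro finsum_group_reindex bij_mult_inv) auto
  also have "\<dots> = (\<Oplus>q\<in>carrier G. regular f t q \<otimes> regular h q r)"
  proof (intro finsum_eqI)
    fix q assume q: "q \<in> carrier G"
    have 1: "inv\<^bsub>G\<^esub> (t \<otimes>\<^bsub>G\<^esub> inv\<^bsub>G\<^esub> q) \<otimes>\<^bsub>G\<^esub> ?tr = q \<otimes>\<^bsub>G\<^esub> inv\<^bsub>G\<^esub> r"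
    proof -
      have "inv\<^bsub>G\<^esub> (t \<otimes>\<^bsub>G\<^esub> inv\<^bsub>G\<^esub> q) \<otimes>\<^bsub>G\<^esub> ?tr = q \<otimes>\<^bsub>G\<^esub> (inv\<^bsub>G\<^esub> t \<otimes>\<^bsub>G\<^esub> (t \<otimes>\<^bsub>G\<^esub> inv\<^bsub>G\<^esub> r))"
        using t r q by (simp add: G.inv_mult_group G.m_assoc)
      then show ?thesis using t r q by (simp add: G.m_assoc[symmetric])
    qed
    have 2: "inv\<^bsub>G\<^esub> t \<otimes>\<^bsub>G\<^esub> (t \<otimes>\<^bsub>G\<^esub> inv\<^bsub>G\<^esub> q) = inv\<^bsub>G\<^esub> q"
      using t q by (simp add: G.m_assoc[symmetric])
    show "\<alpha> (inv\<^bsub>G\<^esub> t) (f (t \<otimes>\<^bsub>G\<^esub> inv\<^bsub>G\<^esub> q) \<otimes>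
        \<alpha> (t \<otimes>\<^bsub>G\<^esub> inv\<^bsub>G\<^esub> q) (h (inv\<^bsub>G\<^esub> (t \<otimes>\<^bsub>G\<^esub> inv\<^bsub>G\<^esub> q) \<otimes>\<^bsub>G\<^esub> ?tr)))
        = regular f t q \<otimes> regular h q r"
      unfolding 1 regular_def using t r q f h crossed_closed
      by (simp add: act_mult act_comp 2)
  qed (use f h t r in auto)
  finally show ?thesis .
qed

text \<open>The same substitution turns the operator that defines the norm into the action of the
  matrix \<open>regular f\<close>, so that the matrix estimates become available for
  \<open>B\<close>.\<close>

lemma cnorm_crossed:
  assumes f: "f \<in> carrier B"
  shows "cnorm B f = opnorm (carrier G) (regular f)"
proof -
  have eq: "(\<Oplus>s\<in>carrier G. \<alpha> (inv\<^bsub>G\<^esub> t) (f s) \<otimes> \<xi> (inv\<^bsub>G\<^esub> s \<otimes>\<^bsub>G\<^esub> t)) = mat_app (carrier G) (regular f) \<xi> t"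
    if \<xi>: "\<xi> \<in> carrier G \<rightarrow> carrier A" and t: "t \<in> carrier G" for \<xi> t
  proof -
    have "(\<Oplus>s\<in>carrier G. \<alpha> (inv\<^bsub>G\<^esub> t) (f s) \<otimes> \<xi> (inv\<^bsub>G\<^esub> s \<otimes>\<^bsub>G\<^esub> t))
       = (\<Oplus>q\<in>carrier G. \<alpha> (inv\<^bsub>G\<^esub> t) (f (t \<otimes>\<^bsub>G\<^esub> inv\<^bsub>G\<^esub> q)) \<otimes> \<xi> (inv\<^bsub>G\<^esub> (t \<otimes>\<^bsub>G\<^esub> inv\<^bsub>G\<^esub> q) \<otimes>\<^bsub>G\<^esub> t))"
    proof (intro finsum_group_reindex[OF bij_mult_inv[OF t]])
      fix s assume s: "s \<in> carrier G"
      have "\<xi> (inv\<^bsub>G\<^esub> s \<otimes>\<^bsub>G\<^esub> t) \<in> carrier A" using \<xi> t s by (intro funcset_mem[OF \<xi>]) auto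
      then show "\<alpha> (inv\<^bsub>G\<^esub> t) (f s) \<otimes> \<xi> (inv\<^bsub>G\<^esub> s \<otimes>\<^bsub>G\<^esub> t) \<in> carrier A"
        using crossed_closed[OF f s] t by simp
    qed
    also have "\<dots> = mat_app (carrier G) (regular f) \<xi> t"
      unfolding mat_app_def
    proof (intro finsum_eqI)
      fix q assume q: "q \<in> carrier G"
      have "inv\<^bsub>G\<^esub> (t \<otimes>\<^bsub>G\<^esub> inv\<^bsub>G\<^esub> q) \<otimes>\<^bsub>G\<^esub> t = q" using t q by (simp add: G.inv_mult_group G.m_assoc)
      then show "\<alpha> (inv\<^bsub>G\<^esub> t) (f (t \<otimes>\<^bsub>G\<^esub> inv\<^bsub>G\<^esub> q)) \<otimes> \<xi> (inv\<^bsub>G\<^esub> (t \<otimes>\<^bsub>G\<^esub> inv\<^bsub>G\<^esub> q) \<otimes>\<^bsub>G\<^esub> t)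
        = regular f t q \<otimes> \<xi> q" by (simp add: regular_def)
      show "regular f t q \<otimes> \<xi> q \<in> carrier A" using f t q \<xi> by auto
    qed
    finally show ?thesis .
  qed
  show ?thesis
    unfolding crossed_product_def hilbert_module_op_norm_def cstar_struct.simps module.simps
  proof (intro SUP_cong refl)
    fix \<xi> assume "\<xi> \<in> {\<xi>. \<xi> \<in> carrier G \<rightarrow> carrier A \<and> hnorm (carrier G) \<xi> \<le> 1}"
    then have \<xi>: "\<xi> \<in> carrier G \<rightarrow> carrier A" by simp
    show "hnorm (carrier G) (\<lambda>t. \<Oplus>s\<in>carrier G. \<alpha> (inv\<^bsub>G\<^esub> t) (f s) \<otimes> \<xi> (inv\<^bsub>G\<^esub> s \<otimes>\<^bsub>G\<^esub> t))
        = hnorm (carrier G) (mat_app (carrier G) (regular f) \<xi>)"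
      using eq[OF \<xi>] f \<xi> by (intro hnorm_cong finite_group mat_app_closed) auto
  qed
qed

text \<open>One half of the C*-identity for \<open>B\<close>, the half that is consumed when the
  Kadison-Schwarz inequality is iterated.\<close>

lemma crossed_adj_mult_cnorm_le:
  assumes f: "f \<in> carrier B"
  shows "cnorm B (adj B f \<otimes>\<^bsub>B\<^esub> f) \<le> (cnorm B f)\<^sup>2"
proof -
  have c: "adj B f \<in> carrier B" "adj B f \<otimes>\<^bsub>B\<^esub> f \<in> carrier B"
    using f crossed_adj_closed crossed_mult_closed by auto
  let ?R = "regular f"
  have R: "?R i j \<in> carrier A" if "i \<in> carrier G" "j \<in> carrier G" for i j using f that by simp
  have "cnorm B (adj B f \<otimes>\<^bsub>B\<^esub> f) = opnorm (carrier G) (\<lambda>i j. \<Oplus>k\<in>carrier G. adj A (?R k i) \<otimes> ?R k j)"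
    unfolding cnorm_crossed[OF c(2)] using f c
    by (intro opnorm_cong finite_group) (auto simp: regular_mult regular_adj intro!: finsum_closed_family finsum_eqI)
  also have "\<dots> \<le> opnorm (carrier G) (\<lambda>i j. adj A (?R j i)) * opnorm (carrier G) ?R"
    using R by (intro opnorm_mult_le finite_group) auto
  also have "\<dots> \<le> opnorm (carrier G) ?R * opnorm (carrier G) ?R"
    using R by (intro mult_right_mono opnorm_adj_le opnorm_nonneg finite_group) auto
  finally show ?thesis unfolding cnorm_crossed[OF f] by (simp add: power2_eq_square)
qed

end

section \<open>Traces on the crossed product\<close>

text \<open>The values c = 1 and c = \<i> force q to be the conjugate of p; the minimising value c =
  -p then turns the form into m - |p|^2.\<close>

lemma cmod_le_of_hermitian_form_nonneg:
  fixes p q m :: complex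
  assumes "\<And>c. cnj c * c + cnj c * p + c * q + m \<in> \<real>\<^sub>\<ge>\<^sub>0" and m: "m \<in> \<real>\<^sub>\<ge>\<^sub>0"
  shows "(cmod p)\<^sup>2 \<le> Re m"
proof -
  have "Im p + Im q = 0" "Re q = Re p"
    using assms(1)[of 1] assms(1)[of \<i>] m by (auto simp: complex_nonneg_Reals_iff)
  then have q: "q = cnj p" by (simp add: complex_eq_iff)
  have "0 \<le> Re (cnj (-p) * (-p) + cnj (-p) * p + (-p) * q + m)"
    using assms(1)[of "-p"] by (simp add: complex_nonneg_Reals_iff)
  then show ?thesis unfolding q cmod_power2 by (simp add: power2_eq_square)
qed

context finite_cstar_dynamics
begin

text \<open>The element y u_g, in the notation in which f stands for the sum of the f(s)
  u_s.\<close>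

definition single :: "'g \<Rightarrow> 'a \<Rightarrow> 'g \<Rightarrow> 'a" where
  "single g y = (\<lambda>t\<in>carrier G. if t = g then y else \<zero>)"

lemma single_closed [simp, intro]: "y \<in> carrier A \<Longrightarrow> single g y \<in> carrier B"
  by (auto simp: single_def crossed_carrier)

lemma single_add:
  "y \<in> carrier A \<Longrightarrow> z \<in> carrier A \<Longrightarrow> single g (y \<oplus> z) = single g y \<oplus>\<^bsub>B\<^esub> single g z"
  by (intro crossed_eqI crossed_add_closed) (auto simp: crossed_add single_def crossed_carrier)

lemma single_scale: "y \<in> carrier A \<Longrightarrow> single g (c \<odot> y) = c \<odot>\<^bsub>B\<^esub> single g y"
  by (intro crossed_eqI crossed_scale_closed) (auto simp: crossed_scale single_def crossed_carrier)

lemma single_mult: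
  assumes g: "g \<in> carrier G" and h: "h \<in> carrier G" and y: "y \<in> carrier A" and z: "z \<in> carrier A"
  shows "single g y \<otimes>\<^bsub>B\<^esub> single h z = single (g \<otimes>\<^bsub>G\<^esub> h) (y \<otimes> \<alpha> g z)"
proof (rule crossed_eqI)
  fix t assume t: "t \<in> carrier G"
  have "(single g y \<otimes>\<^bsub>B\<^esub> single h z) t
      = (\<Oplus>s\<in>carrier G. if g = s then y \<otimes> \<alpha> s (single h z (inv\<^bsub>G\<^esub> s \<otimes>\<^bsub>G\<^esub> t)) else \<zero>)"
    unfolding crossed_mult[OF t] using g h y z t
    by (intro finsum_eqI) (auto simp: single_def)
  also have "\<dots> = y \<otimes> \<alpha> g (single h z (inv\<^bsub>G\<^esub> g \<otimes>\<^bsub>G\<^esub> t))"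
    using g y z t finite_group by (intro finsum_singleton) (auto simp: single_def)
  also have "\<dots> = single (g \<otimes>\<^bsub>G\<^esub> h) (y \<otimes> \<alpha> g z) t"
  proof -
    have "inv\<^bsub>G\<^esub> g \<otimes>\<^bsub>G\<^esub> t = h \<longleftrightarrow> t = g \<otimes>\<^bsub>G\<^esub> h"
      using g h t by (metis G.inv_solve_left)
    then show ?thesis using g h t y by (auto simp: single_def)
  qed
  finally show "(single g y \<otimes>\<^bsub>B\<^esub> single h z) t = single (g \<otimes>\<^bsub>G\<^esub> h) (y \<otimes> \<alpha> g z) t" .
qed (use g h y z crossed_mult_closed in auto)

lemma single_adj:
  assumes g: "g \<in> carrier G" and y: "y \<in> carrier A"
  shows "adj B (single g y) = single (inv\<^bsub>G\<^esub> g) (\<alpha> (inv\<^bsub>G\<^esub> g) (adj A y))"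
proof (rule crossed_eqI)
  fix t assume t: "t \<in> carrier G"
  have "inv\<^bsub>G\<^esub> t = g \<longleftrightarrow> t = inv\<^bsub>G\<^esub> g" using g t by (metis G.inv_inv)
  then show "adj B (single g y) t = single (inv\<^bsub>G\<^esub> g) (\<alpha> (inv\<^bsub>G\<^esub> g) (adj A y)) t"
    using g t y by (auto simp: crossed_adj single_def)
qed (use g y crossed_adj_closed in auto)

lemma crossed_add_mult:
  assumes "f \<in> carrier B" "f' \<in> carrier B" "h \<in> carrier B"
  shows "(f \<oplus>\<^bsub>B\<^esub> f') \<otimes>\<^bsub>B\<^esub> h = (f \<otimes>\<^bsub>B\<^esub> h) \<oplus>\<^bsub>B\<^esub> (f' \<otimes>\<^bsub>B\<^esub> h)"
proof (intro crossed_eqI crossed_mult_closed crossed_add_closed assms)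
  fix t assume t: "t \<in> carrier G"
  have c: "h (inv\<^bsub>G\<^esub> s \<otimes>\<^bsub>G\<^esub> t) \<in> carrier A" "f s \<in> carrier A" "f' s \<in> carrier A"
    if "s \<in> carrier G" for s
    using assms crossed_closed t that by auto
  have "((f \<oplus>\<^bsub>B\<^esub> f') \<otimes>\<^bsub>B\<^esub> h) t = (\<Oplus>s\<in>carrier G.
      f s \<otimes> \<alpha> s (h (inv\<^bsub>G\<^esub> s \<otimes>\<^bsub>G\<^esub> t)) \<oplus> f' s \<otimes> \<alpha> s (h (inv\<^bsub>G\<^esub> s \<otimes>\<^bsub>G\<^esub> t)))"
    unfolding crossed_mult[OF t] using c
    by (intro finsum_eqI) (auto simp: crossed_add l_distr)
  also have "\<dots> = ((f \<otimes>\<^bsub>B\<^esub> h) \<oplus>\<^bsub>B\<^esub> (f' \<otimes>\<^bsub>B\<^esub> h)) t"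
    unfolding crossed_add[OF t] crossed_mult[OF t] using c by (intro finsum_addf) auto
  finally show "((f \<oplus>\<^bsub>B\<^esub> f') \<otimes>\<^bsub>B\<^esub> h) t = ((f \<otimes>\<^bsub>B\<^esub> h) \<oplus>\<^bsub>B\<^esub> (f' \<otimes>\<^bsub>B\<^esub> h)) t" .
qed

lemma crossed_mult_add:
  assumes "f \<in> carrier B" "h \<in> carrier B" "h' \<in> carrier B"
  shows "f \<otimes>\<^bsub>B\<^esub> (h \<oplus>\<^bsub>B\<^esub> h') = (f \<otimes>\<^bsub>B\<^esub> h) \<oplus>\<^bsub>B\<^esub> (f \<otimes>\<^bsub>B\<^esub> h')"
proof (intro crossed_eqI crossed_mult_closed crossed_add_closed assms)
  fix t assume t: "t \<in> carrier G"
  have c: "h (inv\<^bsub>G\<^esub> s \<otimes>\<^bsub>G\<^esub> t) \<in> carrier A" "h' (inv\<^bsub>G\<^esub> s \<otimes>\<^bsub>G\<^esub> t) \<in> carrier A" "f s \<in> carrier A"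
    if "s \<in> carrier G" for s
    using assms crossed_closed t that by auto
  have "(f \<otimes>\<^bsub>B\<^esub> (h \<oplus>\<^bsub>B\<^esub> h')) t = (\<Oplus>s\<in>carrier G.
      f s \<otimes> \<alpha> s (h (inv\<^bsub>G\<^esub> s \<otimes>\<^bsub>G\<^esub> t)) \<oplus> f s \<otimes> \<alpha> s (h' (inv\<^bsub>G\<^esub> s \<otimes>\<^bsub>G\<^esub> t)))"
    unfolding crossed_mult[OF t] using c t
    by (intro finsum_eqI) (auto simp: crossed_add r_distr act_add)
  also have "\<dots> = ((f \<otimes>\<^bsub>B\<^esub> h) \<oplus>\<^bsub>B\<^esub> (f \<otimes>\<^bsub>B\<^esub> h')) t"
    unfolding crossed_add[OF t] crossed_mult[OF t] using c by (intro finsum_addf) auto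
  finally show "(f \<otimes>\<^bsub>B\<^esub> (h \<oplus>\<^bsub>B\<^esub> h')) t = ((f \<otimes>\<^bsub>B\<^esub> h) \<oplus>\<^bsub>B\<^esub> (f \<otimes>\<^bsub>B\<^esub> h')) t" .
qed

lemma crossed_adj_add:
  assumes "f \<in> carrier B" "h \<in> carrier B"
  shows "adj B (f \<oplus>\<^bsub>B\<^esub> h) = adj B f \<oplus>\<^bsub>B\<^esub> adj B h"
  using assms
  by (intro crossed_eqI crossed_adj_closed crossed_add_closed)
    (auto simp: crossed_adj crossed_add adj_add act_add crossed_closed)

lemma crossed_eq_finsum_single:
  assumes f: "f \<in> carrier B"
  shows "f = (\<Oplus>\<^bsub>B\<^esub>g\<in>carrier G. single g (f g))"
proof (rule crossed_eqI[OF f])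
  show "(\<Oplus>\<^bsub>B\<^esub>g\<in>carrier G. single g (f g)) \<in> carrier B"
    using f crossed_closed by (intro crossed_finsum_closed) auto
  fix t assume t: "t \<in> carrier G"
  have "(\<Oplus>\<^bsub>B\<^esub>g\<in>carrier G. single g (f g)) t = (\<Oplus>g\<in>carrier G. single g (f g) t)"
    using f t crossed_closed finite_group by (intro crossed_finsum) auto
  also have "\<dots> = (\<Oplus>g\<in>carrier G. if t = g then f g else \<zero>)"
    using f t crossed_closed by (intro finsum_eqI) (auto simp: single_def)
  also have "\<dots> = f t" using f t crossed_closed finite_group by (intro finsum_singleton) auto
  finally show "f t = (\<Oplus>\<^bsub>B\<^esub>g\<in>carrier G. single g (f g)) t" ..
qed

section \<open>Coefficients of a trace along the group\<close>

context
  fixes \<tau>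
  assumes \<tau>: "\<tau> \<in> tracial_states B"
begin

lemma trace_add: "f \<in> carrier B \<Longrightarrow> h \<in> carrier B \<Longrightarrow> \<tau> (f \<oplus>\<^bsub>B\<^esub> h) = \<tau> f + \<tau> h"
  using \<tau> by (auto simp: tracial_states_def cstar_linear_def)

lemma trace_scale: "f \<in> carrier B \<Longrightarrow> \<tau> (c \<odot>\<^bsub>B\<^esub> f) = c * \<tau> f"
  using \<tau> by (auto simp: tracial_states_def cstar_linear_def)

lemma trace_commute: "f \<in> carrier B \<Longrightarrow> h \<in> carrier B \<Longrightarrow> \<tau> (f \<otimes>\<^bsub>B\<^esub> h) = \<tau> (h \<otimes>\<^bsub>B\<^esub> f)"
  using \<tau> by (auto simp: tracial_states_def)

lemma trace_adj_mult: "f \<in> carrier B \<Longrightarrow> \<tau> (adj B f \<otimes>\<^bsub>B\<^esub> f) \<in> \<real>\<^sub>\<ge>\<^sub>0"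
  using \<tau> by (auto simp: tracial_states_def cstar_positive_def)

lemma trace_finsum:
  assumes "finite I" "\<And>i. i \<in> I \<Longrightarrow> F i \<in> carrier B"
  shows "\<tau> (\<Oplus>\<^bsub>B\<^esub>i\<in>I. F i) = (\<Sum>i\<in>I. \<tau> (F i))"
  using assms
proof (induction I rule: finite_induct)
  case empty
  have "\<tau> (0 \<odot>\<^bsub>B\<^esub> single \<one>\<^bsub>G\<^esub> \<zero>) = 0" by (simp add: trace_scale)
  moreover have "0 \<odot>\<^bsub>B\<^esub> single \<one>\<^bsub>G\<^esub> \<zero> = \<zero>\<^bsub>B\<^esub>"
    by (intro crossed_eqI crossed_scale_closed crossed_zero_closed)
      (auto simp: crossed_scale crossed_zero single_def crossed_carrier)
  ultimately show ?case
    by (simp add: abelian_monoid.finsum_empty[OF crossed_abelian_monoid])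
next
  case (insert i I)
  then have "F i \<in> carrier B" "F \<in> I \<rightarrow> carrier B" by auto
  then show ?case
    using insert crossed_finsum_closed[of I F]
    by (simp add: abelian_monoid.finsum_insert[OF crossed_abelian_monoid] trace_add)
qed

definition coeff :: "'g \<Rightarrow> 'a \<Rightarrow> complex" where
  "coeff g y = \<tau> (single g y)"

lemma coeff_add: "y \<in> carrier A \<Longrightarrow> z \<in> carrier A \<Longrightarrow> coeff g (y \<oplus> z) = coeff g y + coeff g z"
  by (simp add: coeff_def single_add trace_add)

lemma coeff_scale: "y \<in> carrier A \<Longrightarrow> coeff g (c \<odot> y) = c * coeff g y"
  by (simp add: coeff_def single_scale trace_scale)

lemma coeff_zero: "coeff g \<zero> = 0"
  using coeff_scale[of \<zero> g 0] by simp

lemma coeff_diff: "y \<in> carrier A \<Longrightarrow> z \<in> carrier A \<Longrightarrow> coeff g (y \<ominus> z) = coeff g y - coeff g z"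
  by (simp add: diff_scale coeff_add coeff_scale)

lemma coeff_finsum:
  assumes "finite I" "\<And>i. i \<in> I \<Longrightarrow> f i \<in> carrier A"
  shows "coeff g (\<Oplus>i\<in>I. f i) = (\<Sum>i\<in>I. coeff g (f i))"
  using assms
proof (induction I rule: finite_induct)
  case (insert i I)
  then have "f i \<in> carrier A" "f \<in> I \<rightarrow> carrier A" by auto
  then show ?case using insert by (simp add: coeff_add)
qed (simp add: coeff_zero)

text \<open>The trace property for y u_g and z u_h, whose product is y \<alpha>_g(z) u_(gh).\<close>

lemma coeff_commute:
  assumes "g \<in> carrier G" "h \<in> carrier G" "y \<in> carrier A" "z \<in> carrier A"
  shows "coeff (g \<otimes>\<^bsub>G\<^esub> h) (y \<otimes> \<alpha> g z) = coeff (h \<otimes>\<^bsub>G\<^esub> g) (z \<otimes> \<alpha> h y)"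
  using trace_commute[of "single g y" "single h z"] assms by (simp add: coeff_def single_mult)

lemma coeff_one_nonneg:
  assumes "pos p"
  shows "coeff \<one>\<^bsub>G\<^esub> p \<in> \<real>\<^sub>\<ge>\<^sub>0"
proof -
  obtain s where s: "selfadj s" "s \<otimes> s = p" using assms by (auto simp: pos_def)
  have sc: "s \<in> carrier A" "adj A s = s" using s by (auto simp: selfadj_def)
  have "adj B (single \<one>\<^bsub>G\<^esub> s) \<otimes>\<^bsub>B\<^esub> single \<one>\<^bsub>G\<^esub> s = single \<one>\<^bsub>G\<^esub> p"
    using sc s(2) by (simp add: single_adj single_mult)
  then show ?thesis using trace_adj_mult[of "single \<one>\<^bsub>G\<^esub> s"] sc by (simp add: coeff_def)
qed

lemma coeff_one_one: "coeff \<one>\<^bsub>G\<^esub> \<one> = 1"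
proof -
  have "single \<one>\<^bsub>G\<^esub> \<one> = \<one>\<^bsub>B\<^esub>" by (simp add: single_def crossed_product_def)
  then show ?thesis using \<tau> by (simp add: coeff_def tracial_states_def)
qed

text \<open>Cauchy-Schwarz for \<tau> between 1 and v = y u_g. Expanding \<tau>((c 1 + v)* (c 1 +
  v)) >= 0 in the complex number c yields |\<tau>(v)|^2 <= \<tau>(v* v) = m, and y* y <= ||y||^2
  bounds m. This makes every coefficient continuous on \<open>A\<close>, so that approximate
  relations can be used under the trace.\<close>

lemma coeff_le:
  assumes g: "g \<in> carrier G" and y: "y \<in> carrier A"
  shows "cmod (coeff g y) \<le> cnorm A y"
proof -
  let ?i = "inv\<^bsub>G\<^esub> g"
  define m where "m = coeff \<one>\<^bsub>G\<^esub> (\<alpha> ?i (adj A y \<otimes> y))"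
  have yy: "\<alpha> ?i (adj A y) \<otimes> \<alpha> ?i y = \<alpha> ?i (adj A y \<otimes> y)" using g y by (simp add: act_mult)
  have form: "cnj c * c + cnj c * coeff g y + c * coeff ?i (\<alpha> ?i (adj A y)) + m \<in> \<real>\<^sub>\<ge>\<^sub>0" for c
  proof -
    define u v where "u = single \<one>\<^bsub>G\<^esub> (c \<odot> \<one>)" and "v = single g y"
    have uv: "u \<in> carrier B" "v \<in> carrier B" using y by (auto simp: u_def v_def)
    have au: "adj B u = single \<one>\<^bsub>G\<^esub> (cnj c \<odot> \<one>)" by (simp add: u_def single_adj adj_smult)
    have av: "adj B v = single ?i (\<alpha> ?i (adj A y))" using g y by (simp add: v_def single_adj)
    have auv: "adj B u \<in> carrier B" "adj B v \<in> carrier B" using uv crossed_adj_closed by auto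
    have "\<tau> (adj B (u \<oplus>\<^bsub>B\<^esub> v) \<otimes>\<^bsub>B\<^esub> (u \<oplus>\<^bsub>B\<^esub> v))
       = \<tau> (adj B u \<otimes>\<^bsub>B\<^esub> u) + \<tau> (adj B u \<otimes>\<^bsub>B\<^esub> v) + \<tau> (adj B v \<otimes>\<^bsub>B\<^esub> u) + \<tau> (adj B v \<otimes>\<^bsub>B\<^esub> v)"
      using uv auv
      by (simp add: crossed_adj_add crossed_add_mult crossed_mult_add trace_add
          crossed_mult_closed crossed_add_closed)
    also have "\<tau> (adj B u \<otimes>\<^bsub>B\<^esub> u) = cnj c * c"
      unfolding au unfolding u_def using coeff_scale[of \<one> "\<one>\<^bsub>G\<^esub>" "cnj c * c"]
      by (simp add: single_mult smult_mult_left coeff_one_one flip: coeff_def)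
    also have "\<tau> (adj B u \<otimes>\<^bsub>B\<^esub> v) = cnj c * coeff g y"
      unfolding au v_def using g y
      by (simp add: single_mult smult_mult_left coeff_scale flip: coeff_def)
    also have "\<tau> (adj B v \<otimes>\<^bsub>B\<^esub> u) = c * coeff ?i (\<alpha> ?i (adj A y))"
      unfolding av u_def using g y
      by (simp add: single_mult act_scale smult_mult_right coeff_scale flip: coeff_def)
    also have "\<tau> (adj B v \<otimes>\<^bsub>B\<^esub> v) = m"
      unfolding av unfolding v_def m_def using g y by (simp add: single_mult yy flip: coeff_def)
    finally show ?thesis using trace_adj_mult[OF crossed_add_closed[OF uv]] by simp
  qed
  have p: "pos (adj A y \<otimes> y)" using y by (rule pos_adj_mult)
  have "m \<in> \<real>\<^sub>\<ge>\<^sub>0" unfolding m_def using g p by (intro coeff_one_nonneg act_pos) auto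
  then have le: "(cmod (coeff g y))\<^sup>2 \<le> Re m" by (rule cmod_le_of_hermitian_form_nonneg[OF form])
  have "pos (complex_of_real ((cnorm A y)\<^sup>2) \<odot> \<one> \<ominus> adj A y \<otimes> y)"
    using y p pos_selfadj cstar_identity by (intro pos_cnorm_diff) auto
  then have "coeff \<one>\<^bsub>G\<^esub> (\<alpha> ?i (complex_of_real ((cnorm A y)\<^sup>2) \<odot> \<one> \<ominus> adj A y \<otimes> y)) \<in> \<real>\<^sub>\<ge>\<^sub>0"
    using g by (intro coeff_one_nonneg act_pos) auto
  also have "\<alpha> ?i (complex_of_real ((cnorm A y)\<^sup>2) \<odot> \<one> \<ominus> adj A y \<otimes> y)
      = complex_of_real ((cnorm A y)\<^sup>2) \<odot> \<one> \<ominus> \<alpha> ?i (adj A y \<otimes> y)"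
    using g y by (simp add: diff_scale act_add act_scale)
  finally have "Re m \<le> (cnorm A y)\<^sup>2"
    using g y unfolding m_def
    by (simp add: coeff_diff coeff_scale coeff_one_one complex_nonneg_Reals_iff flip: of_real_power)
  with le have "(cmod (coeff g y))\<^sup>2 \<le> (cnorm A y)\<^sup>2" by linarith
  then show ?thesis by (rule power2_le_imp_le[OF _ cnorm_nonneg[OF y]])
qed

text \<open>Restricted to \<open>carrier A\<close> because the members of
  \<open>tracial_states A\<close> are extensional.\<close>

definition restricted_trace :: "'a \<Rightarrow> complex" where
  "restricted_trace = restrict (coeff \<one>\<^bsub>G\<^esub>) (carrier A)"

lemma restricted_trace_tracial: "restricted_trace \<in> tracial_states A"
proof -
  have "coeff \<one>\<^bsub>G\<^esub> (a \<otimes> b) = coeff \<one>\<^bsub>G\<^esub> (b \<otimes> a)" if "a \<in> carrier A" "b \<in> carrier A" for a b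
    using coeff_commute[of "\<one>\<^bsub>G\<^esub>" "\<one>\<^bsub>G\<^esub>" a b] that by simp
  moreover have "restricted_trace a \<in> \<real>\<^sub>\<ge>\<^sub>0" if "cstar_positive A a" for a
    using that coeff_one_nonneg pos_closed
    by (simp add: restricted_trace_def cstar_positive_iff_pos)
  ultimately show ?thesis
    unfolding tracial_states_def restricted_trace_def
    by (auto simp: cstar_linear_def coeff_add coeff_scale coeff_one_one)
qed

text \<open>\<alpha>_g(a) is the product of u_g and a u_(g^-1), and the product in the other order
  is a.\<close>

lemma restricted_trace_invariant:
  assumes g: "g \<in> carrier G" and a: "a \<in> carrier A"
  shows "restricted_trace (\<alpha> g a) = restricted_trace a"
  using coeff_commute[of g "inv\<^bsub>G\<^esub> g" \<one> a] assms by (simp add: restricted_trace_def)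

end

end

section \<open>Asymptotic equality of sequences\<close>

context unital_cstar
begin

definition bseq :: "(nat \<Rightarrow> 'a) \<Rightarrow> bool" where
  "bseq X \<longleftrightarrow> (\<forall>n. X n \<in> carrier A) \<and> (\<exists>K. \<forall>n. cnorm A (X n) \<le> K)"

definition asymp :: "(nat \<Rightarrow> 'a) \<Rightarrow> (nat \<Rightarrow> 'a) \<Rightarrow> bool" where
  "asymp X Y \<longleftrightarrow> (\<forall>n. X n \<in> carrier A) \<and> (\<forall>n. Y n \<in> carrier A) \<and>
     (\<lambda>n. cnorm A (X n \<ominus> Y n)) \<longlonglongrightarrow> 0"

lemma bseq_const: "x \<in> carrier A \<Longrightarrow> bseq (\<lambda>n. x)"
  by (auto simp: bseq_def)

lemma bseq_mult:
  assumes "bseq X" "bseq Y"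
  shows "bseq (\<lambda>n. X n \<otimes> Y n)"
proof -
  obtain K L where K: "\<And>n. cnorm A (X n) \<le> K" "\<And>n. cnorm A (Y n) \<le> L"
    using assms by (auto simp: bseq_def)
  have c: "\<And>n. X n \<in> carrier A" "\<And>n. Y n \<in> carrier A" using assms by (auto simp: bseq_def)
  have K0: "0 \<le> K" using K(1)[of 0] cnorm_nonneg[OF c(1)[of 0]] by linarith
  have "cnorm A (X n \<otimes> Y n) \<le> K * L" for n
  proof -
    have "cnorm A (X n \<otimes> Y n) \<le> cnorm A (X n) * cnorm A (Y n)" using c by (intro cnorm_mult)
    also have "\<dots> \<le> K * L"
      using K[of n] K0 c by (intro mult_mono) auto
    finally show ?thesis .
  qed
  then show ?thesis using c by (auto simp: bseq_def)
qed

lemma asympI: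
  assumes "\<And>n. X n \<in> carrier A" "\<And>n. Y n \<in> carrier A" "\<And>n. cnorm A (X n \<ominus> Y n) \<le> f n"
    "f \<longlonglongrightarrow> 0"
  shows "asymp X Y"
  unfolding asymp_def
  using assms(1,2) tendsto_sandwich[of "\<lambda>n. 0" "\<lambda>n. cnorm A (X n \<ominus> Y n)" sequentially f 0] assms(3,4)
  by (auto simp: eventually_sequentially)

lemma asymp_refl: "(\<And>n. X n \<in> carrier A) \<Longrightarrow> asymp X X"
  by (simp add: asymp_def a_minus_def r_neg)

lemma asymp_sym: "asymp X Y \<Longrightarrow> asymp Y X"
  by (auto simp: asymp_def cnorm_diff_commute)

lemma asymp_trans [trans]:
  assumes "asymp X Y" "asymp Y Z"
  shows "asymp X Z"
proof (rule asympI)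
  show "cnorm A (X n \<ominus> Z n) \<le> cnorm A (X n \<ominus> Y n) + cnorm A (Y n \<ominus> Z n)" for n
    using assms by (intro cnorm_diff_triangle) (auto simp: asymp_def)
  show "(\<lambda>n. cnorm A (X n \<ominus> Y n) + cnorm A (Y n \<ominus> Z n)) \<longlonglongrightarrow> 0"
    using assms by (intro tendsto_add_zero) (auto simp: asymp_def)
qed (use assms in \<open>auto simp: asymp_def\<close>)

text \<open>The difference is X (Y - Y') + (X - X') Y', so boundedness is asked of X and of Y'
  only.\<close>

lemma asymp_mult:
  assumes X: "asymp X X'" and Y: "asymp Y Y'" and b: "bseq X" "bseq Y'"
  shows "asymp (\<lambda>n. X n \<otimes> Y n) (\<lambda>n. X' n \<otimes> Y' n)"
proof -
  have c: "\<And>n. X n \<in> carrier A" "\<And>n. Y n \<in> carrier A" "\<And>n. X' n \<in> carrier A" "\<And>n. Y' n \<in> carrier A"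
    using X Y by (auto simp: asymp_def)
  obtain K L where K: "\<And>n. cnorm A (X n) \<le> K" "\<And>n. cnorm A (Y' n) \<le> L"
    using b by (auto simp: bseq_def)
  show ?thesis
  proof (rule asympI)
    fix n
    have "X n \<otimes> Y n \<ominus> X' n \<otimes> Y' n = X n \<otimes> (Y n \<ominus> Y' n) \<oplus> (X n \<ominus> X' n) \<otimes> Y' n"
      using c(1,2,3,4)[of n] by algebra
    then have "cnorm A (X n \<otimes> Y n \<ominus> X' n \<otimes> Y' n)
        \<le> cnorm A (X n \<otimes> (Y n \<ominus> Y' n)) + cnorm A ((X n \<ominus> X' n) \<otimes> Y' n)"
      using cnorm_triangle c by simp
    also have "\<dots> \<le> cnorm A (X n) * cnorm A (Y n \<ominus> Y' n) + cnorm A (X n \<ominus> X' n) * cnorm A (Y' n)"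
      using cnorm_mult c by (intro add_mono) auto
    also have "\<dots> \<le> K * cnorm A (Y n \<ominus> Y' n) + cnorm A (X n \<ominus> X' n) * L"
      using K c by (intro add_mono mult_right_mono mult_left_mono) auto
    finally show "cnorm A (X n \<otimes> Y n \<ominus> X' n \<otimes> Y' n) \<le> \<dots>" .
    show "(\<lambda>n. K * cnorm A (Y n \<ominus> Y' n) + cnorm A (X n \<ominus> X' n) * L) \<longlonglongrightarrow> 0"
      using X Y unfolding asymp_def
      by (intro tendsto_add_zero tendsto_mult_right_zero tendsto_mult_left_zero) auto
  qed (use c in auto)
qed

end

section \<open>Vanishing of the coefficients off the unit of the group\<close>

context finite_cstar_dynamics
begin

context
  fixes \<tau> g
  assumes \<tau>: "\<tau> \<in> tracial_states B" and g: "g \<in> carrier G"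
begin

lemma coeff_asymp:
  assumes "asymp X Y" "(\<lambda>n. coeff \<tau> g (Y n)) \<longlonglongrightarrow> 0"
  shows "(\<lambda>n. coeff \<tau> g (X n)) \<longlonglongrightarrow> 0"
proof -
  have c: "\<And>n. X n \<in> carrier A" "\<And>n. Y n \<in> carrier A" using assms by (auto simp: asymp_def)
  have "(\<lambda>n. coeff \<tau> g (X n \<ominus> Y n)) \<longlonglongrightarrow> 0"
  proof (rule Lim_null_comparison)
    show "\<forall>\<^sub>F n in sequentially. norm (coeff \<tau> g (X n \<ominus> Y n)) \<le> cnorm A (X n \<ominus> Y n)"
      using coeff_le[OF \<tau> g] c by (intro always_eventually) auto
    show "(\<lambda>n. cnorm A (X n \<ominus> Y n)) \<longlonglongrightarrow> 0" using assms by (simp add: asymp_def)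
  qed
  then have "(\<lambda>n. coeff \<tau> g (X n) - coeff \<tau> g (Y n)) \<longlonglongrightarrow> 0"
    using coeff_diff[OF \<tau>] c by simp
  from tendsto_add[OF this assms(2)] show ?thesis by simp
qed

text \<open>The index (l, h) names member h of tower l. The hypotheses are the Rokhlin relations
  along a sequence of tower systems whose error tends to 0, with approximate centrality required
  against the single element a.\<close>

context
  fixes d :: nat and p :: "nat \<Rightarrow> nat \<times> 'g \<Rightarrow> 'a" and a :: 'a and I
  defines "I \<equiv> {..d} \<times> carrier G"
  assumes a: "a \<in> carrier A" and g1: "g \<noteq> \<one>\<^bsub>G\<^esub>"
    and p: "\<And>n i. i \<in> I \<Longrightarrow> p n i \<in> carrier A" "\<And>n i. i \<in> I \<Longrightarrow> cnorm A (p n i) \<le> 1"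
    and p_act: "\<And>l h k. l \<le> d \<Longrightarrow> h \<in> carrier G \<Longrightarrow> k \<in> carrier G \<Longrightarrow>
      asymp (\<lambda>n. \<alpha> k (p n (l, h))) (\<lambda>n. p n (l, k \<otimes>\<^bsub>G\<^esub> h))"
    and p_central: "\<And>i. i \<in> I \<Longrightarrow> asymp (\<lambda>n. p n i \<otimes> a) (\<lambda>n. a \<otimes> p n i)"
    and p_orth: "\<And>l h k. l \<le> d \<Longrightarrow> h \<in> carrier G \<Longrightarrow> k \<in> carrier G \<Longrightarrow> h \<noteq> k \<Longrightarrow>
      asymp (\<lambda>n. p n (l, h) \<otimes> p n (l, k)) (\<lambda>n. \<zero>)"
    and p_sum: "asymp (\<lambda>n. \<Oplus>l\<in>{..d}. \<Oplus>h\<in>carrier G. p n (l, h)) (\<lambda>n. \<one>)"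
    and p_comm: "\<And>i j. i \<in> I \<Longrightarrow> j \<in> I \<Longrightarrow> asymp (\<lambda>n. p n i \<otimes> p n j) (\<lambda>n. p n j \<otimes> p n i)"
begin

text \<open>The product of the tower elements listed in w, times a. Keeping a at the right end lets
  words grow by left multiplication alone.\<close>

definition tower_word :: "(nat \<times> 'g) list \<Rightarrow> nat \<Rightarrow> 'a" where
  "tower_word w n = foldr (\<lambda>i x. p n i \<otimes> x) w a"

lemma tower_bseq: "i \<in> I \<Longrightarrow> bseq (\<lambda>n. p n i)"
  using p unfolding bseq_def by blast

lemma tower_word_bseq: "set w \<subseteq> I \<Longrightarrow> bseq (tower_word w)"
proof (induction w)
  case Nil
  then show ?case using bseq_const[OF a] by (simp add: tower_word_def[abs_def])
next
  case (Cons i w)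
  then have "bseq (\<lambda>n. p n i \<otimes> tower_word w n)" by (intro bseq_mult tower_bseq) auto
  then show ?case by (simp add: tower_word_def[abs_def])
qed

lemma tower_word_closed: "set w \<subseteq> I \<Longrightarrow> tower_word w n \<in> carrier A"
  using tower_word_bseq by (simp add: bseq_def)

lemma tower_word_Cons: "tower_word (i # w) n = p n i \<otimes> tower_word w n"
  by (simp add: tower_word_def)

lemma asymp_tower_left:
  "i \<in> I \<Longrightarrow> asymp X Y \<Longrightarrow> bseq Y \<Longrightarrow> asymp (\<lambda>n. p n i \<otimes> X n) (\<lambda>n. p n i \<otimes> Y n)"
  using p by (intro asymp_mult asymp_refl tower_bseq) auto

lemma tower_swap:
  assumes "i \<in> I" "j \<in> I" "bseq X"
  shows "asymp (\<lambda>n. p n i \<otimes> (p n j \<otimes> X n)) (\<lambda>n. p n j \<otimes> (p n i \<otimes> X n))"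
proof -
  have c: "\<And>n. X n \<in> carrier A" using assms by (simp add: bseq_def)
  have "asymp (\<lambda>n. (p n i \<otimes> p n j) \<otimes> X n) (\<lambda>n. (p n j \<otimes> p n i) \<otimes> X n)"
    using assms c by (intro asymp_mult p_comm asymp_refl bseq_mult tower_bseq) auto
  then show ?thesis using assms p c by (simp add: m_assoc)
qed

text \<open>p_j passes the letters because the towers commute asymptotically, and passes a at the
  end by asymptotic centrality.\<close>

lemma tower_word_commute:
  assumes "set w \<subseteq> I" "j \<in> I"
  shows "asymp (\<lambda>n. p n j \<otimes> tower_word w n) (\<lambda>n. tower_word w n \<otimes> p n j)"
  using assms(1)
proof (induction w)
  case Nil
  then show ?case using p_central[OF assms(2)] by (simp add: tower_word_def)
next
  case (Cons i w)
  then have i: "i \<in> I" "set w \<subseteq> I" by auto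
  have "asymp (\<lambda>n. p n j \<otimes> tower_word (i # w) n) (\<lambda>n. p n i \<otimes> (p n j \<otimes> tower_word w n))"
    unfolding tower_word_Cons by (rule tower_swap[OF assms(2) i(1) tower_word_bseq[OF i(2)]])
  also have "asymp \<dots> (\<lambda>n. p n i \<otimes> (tower_word w n \<otimes> p n j))"
    by (intro asymp_tower_left i Cons.IH bseq_mult tower_word_bseq tower_bseq assms)
  also have "(\<lambda>n. p n i \<otimes> (tower_word w n \<otimes> p n j)) = (\<lambda>n. tower_word (i # w) n \<otimes> p n j)"
    using p i assms tower_word_closed[OF i(2)] by (simp add: tower_word_Cons m_assoc)
  finally show ?case .
qed

text \<open>The first occurrence of i travels to the front by finitely many swaps of neighbours,
  each asymptotically without effect.\<close>

lemma tower_word_extract: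
  assumes "set w \<subseteq> I" "i \<in> set w"
  shows "asymp (tower_word w) (\<lambda>n. p n i \<otimes> tower_word (remove1 i w) n)"
  using assms
proof (induction w)
  case (Cons k w)
  then have k: "k \<in> I" "set w \<subseteq> I" by auto
  show ?case
  proof (cases "k = i")
    case True
    then show ?thesis
      using asymp_refl[of "tower_word (k # w)"] tower_word_closed[OF Cons.prems(1)]
      by (simp add: tower_word_Cons[abs_def])
  next
    case False
    then have iw: "i \<in> set w" "i \<in> I" using Cons by auto
    have r: "set (remove1 i w) \<subseteq> I" using k set_remove1_subset[of i w] by blast
    have "asymp (tower_word (k # w)) (\<lambda>n. p n k \<otimes> (p n i \<otimes> tower_word (remove1 i w) n))"
      unfolding tower_word_Cons[abs_def]
      by (intro asymp_tower_left Cons.IH bseq_mult tower_bseq tower_word_bseq r k iw)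
    also have "asymp \<dots> (\<lambda>n. p n i \<otimes> (p n k \<otimes> tower_word (remove1 i w) n))"
      by (intro tower_swap tower_word_bseq r k iw)
    also have "(\<lambda>n. p n i \<otimes> (p n k \<otimes> tower_word (remove1 i w) n))
        = (\<lambda>n. p n i \<otimes> tower_word (remove1 i (k # w)) n)"
      using False by (simp add: tower_word_Cons)
    finally show ?thesis .
  qed
qed simp

text \<open>
  Under the trace, moving one of two equal tower elements around \<open>u\<^sub>g\<close> replaces it by an orthogonal
  member of the same tower.
\<close>

lemma coeff_tower_square:
  assumes i: "i \<in> I" and w: "set w \<subseteq> I"
  shows "(\<lambda>n. coeff \<tau> g (p n i \<otimes> (p n i \<otimes> tower_word w n))) \<longlonglongrightarrow> 0"
proof -
  obtain l h where lh: "i = (l, h)" "l \<le> d" "h \<in> carrier G" using i by (auto simp: I_def)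
  define j where "j = (l, g \<otimes>\<^bsub>G\<^esub> h)"
  have j: "j \<in> I" using lh g by (auto simp: j_def I_def)
  have gh: "h \<noteq> g \<otimes>\<^bsub>G\<^esub> h" using g g1 lh by (metis G.r_cancel_one')
  note c = p(1)[OF i] p(1)[OF j] tower_word_closed[OF w]
  \<comment> \<open>The instance h = 1 of \<open>coeff_commute\<close>: the left factor p_i is moved
    to the far right of u_g and comes back past it as \<alpha>_g(p_i).\<close>
  have eq: "coeff \<tau> g (p n i \<otimes> (p n i \<otimes> tower_word w n))
      = coeff \<tau> g (p n i \<otimes> tower_word w n \<otimes> \<alpha> g (p n i))" for n
    using coeff_commute[OF \<tau>, of g "\<one>\<^bsub>G\<^esub>" "p n i \<otimes> tower_word w n" "p n i"] g c by simp
  have "asymp (\<lambda>n. p n i \<otimes> tower_word w n \<otimes> \<alpha> g (p n i)) (\<lambda>n. p n i \<otimes> tower_word w n \<otimes> p n j)"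
    using p_act[OF lh(2,3) g] c g unfolding lh(1)[symmetric] j_def[symmetric]
    by (intro asymp_mult asymp_refl bseq_mult tower_bseq tower_word_bseq i j w) auto
  also have "(\<lambda>n. p n i \<otimes> tower_word w n \<otimes> p n j) = (\<lambda>n. p n i \<otimes> (tower_word w n \<otimes> p n j))"
    using c by (simp add: m_assoc)
  also have "asymp \<dots> (\<lambda>n. p n i \<otimes> (p n j \<otimes> tower_word w n))"
    by (intro asymp_tower_left asymp_sym[OF tower_word_commute] bseq_mult tower_bseq tower_word_bseq i j w)
  also have "(\<lambda>n. p n i \<otimes> (p n j \<otimes> tower_word w n)) = (\<lambda>n. p n i \<otimes> p n j \<otimes> tower_word w n)"
    using c by (simp add: m_assoc)
  also have "asymp \<dots> (\<lambda>n. \<zero> \<otimes> tower_word w n)"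
    using p_orth[OF lh(2,3) _ gh] g lh c unfolding lh(1)[symmetric] j_def[symmetric]
    by (intro asymp_mult asymp_refl bseq_mult tower_bseq tower_word_bseq i j w) auto
  finally have "asymp (\<lambda>n. p n i \<otimes> tower_word w n \<otimes> \<alpha> g (p n i)) (\<lambda>n. \<zero>)" using c by simp
  then have "(\<lambda>n. coeff \<tau> g (p n i \<otimes> tower_word w n \<otimes> \<alpha> g (p n i))) \<longlonglongrightarrow> 0"
    by (rule coeff_asymp) (simp add: coeff_zero[OF \<tau>])
  then show ?thesis using eq by simp
qed

lemma coeff_tower_repeated:
  assumes i: "i \<in> set w" and w: "set w \<subseteq> I"
  shows "(\<lambda>n. coeff \<tau> g (tower_word (i # w) n)) \<longlonglongrightarrow> 0"
proof -
  have iI: "i \<in> I" using assms by auto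
  have r: "set (remove1 i w) \<subseteq> I" using w set_remove1_subset[of i w] by blast
  have "asymp (tower_word (i # w)) (\<lambda>n. p n i \<otimes> (p n i \<otimes> tower_word (remove1 i w) n))"
    unfolding tower_word_Cons[abs_def]
    by (intro asymp_tower_left tower_word_extract bseq_mult tower_bseq tower_word_bseq i w iI r)
  then show ?thesis using coeff_tower_square[OF iI r] by (rule coeff_asymp)
qed

text \<open>
  Insert the approximate unit \<open>\<Sum>i. p i\<close> repeatedly: after \<open>card I + 1\<close> insertions some tower element
  is repeated.
\<close>

lemma coeff_tower_word:
  assumes "set w \<subseteq> I" "distinct w"
  shows "(\<lambda>n. coeff \<tau> g (tower_word w n)) \<longlonglongrightarrow> 0"
  using assms
proof (induction "card I - length w" arbitrary: w rule: less_induct)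
  case less
  have fin: "finite I" using finite_group by (simp add: I_def)
  have c: "p n (l, h) \<in> carrier A" if "l \<le> d" "h \<in> carrier G" for n l h
    using p(1) that by (simp add: I_def)
  note wc = tower_word_closed[OF less.prems(1)]
  have step: "(\<lambda>n. coeff \<tau> g (tower_word (i # w) n)) \<longlonglongrightarrow> 0" if i: "i \<in> I" for i
  proof (cases "i \<in> set w")
    case True
    then show ?thesis using coeff_tower_repeated less.prems by blast
  next
    case False
    then have iw: "set (i # w) \<subseteq> I" "distinct (i # w)" using less.prems i by auto
    \<comment> \<open>Distinctness keeps the length within \<open>card I\<close>; without this bound
      the truncated subtraction in the induction measure could stay at 0 instead of
      decreasing.\<close>
    then have "length (i # w) \<le> card I" using fin by (metis card_mono distinct_card)
    then have "card I - length (i # w) < card I - length w" by simp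
    then show ?thesis using less.hyps[OF _ iw] by blast
  qed
  define S where "S = (\<lambda>n. \<Oplus>l\<in>{..d}. \<Oplus>h\<in>carrier G. p n (l, h))"
  have Sc: "S n \<in> carrier A" for n unfolding S_def using c by (intro finsum_closed_family) auto
  have "S n \<otimes> tower_word w n = (\<Oplus>l\<in>{..d}. \<Oplus>h\<in>carrier G. tower_word ((l, h) # w) n)" for n
  proof -
    have "S n \<otimes> tower_word w n = (\<Oplus>l\<in>{..d}. (\<Oplus>h\<in>carrier G. p n (l, h)) \<otimes> tower_word w n)"
      unfolding S_def using c wc by (intro finsum_mult_right finsum_closed_family) auto
    also have "\<dots> = (\<Oplus>l\<in>{..d}. \<Oplus>h\<in>carrier G. tower_word ((l, h) # w) n)"
      unfolding tower_word_Cons using c wc finite_group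
      by (intro finsum_eqI finsum_mult_right finsum_closed_family) auto
    finally show ?thesis .
  qed
  moreover have "coeff \<tau> g (\<Oplus>l\<in>{..d}. \<Oplus>h\<in>carrier G. tower_word ((l, h) # w) n)
      = (\<Sum>l\<in>{..d}. \<Sum>h\<in>carrier G. coeff \<tau> g (tower_word ((l, h) # w) n))" for n
  proof -
    have "coeff \<tau> g (\<Oplus>l\<in>{..d}. \<Oplus>h\<in>carrier G. tower_word ((l, h) # w) n)
        = (\<Sum>l\<in>{..d}. coeff \<tau> g (\<Oplus>h\<in>carrier G. tower_word ((l, h) # w) n))"
      using c wc unfolding tower_word_Cons
      by (intro coeff_finsum[OF \<tau>] finsum_closed_family) auto
    also have "\<dots> = (\<Sum>l\<in>{..d}. \<Sum>h\<in>carrier G. coeff \<tau> g (tower_word ((l, h) # w) n))"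
      using c wc finite_group unfolding tower_word_Cons
      by (intro sum.cong refl coeff_finsum[OF \<tau>]) auto
    finally show ?thesis .
  qed
  moreover have "(\<lambda>n. \<Sum>l\<in>{..d}. \<Sum>h\<in>carrier G. coeff \<tau> g (tower_word ((l, h) # w) n)) \<longlonglongrightarrow> 0"
    by (intro tendsto_null_sum step) (auto simp: I_def)
  ultimately have lim: "(\<lambda>n. coeff \<tau> g (S n \<otimes> tower_word w n)) \<longlonglongrightarrow> 0" by simp
  have "asymp (tower_word w) (\<lambda>n. S n \<otimes> tower_word w n)"
  proof -
    have "asymp (\<lambda>n. \<one> \<otimes> tower_word w n) (\<lambda>n. S n \<otimes> tower_word w n)"
      using p_sum wc unfolding S_def[symmetric]
      by (intro asymp_mult asymp_refl bseq_const tower_word_bseq less.prems asymp_sym[of S]) auto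
    then show ?thesis using wc by simp
  qed
  from coeff_asymp[OF this lim] show ?case .
qed

lemma coeff_tower_zero: "coeff \<tau> g a = 0"
proof -
  have "(\<lambda>n::nat. coeff \<tau> g a) \<longlonglongrightarrow> 0"
    using coeff_tower_word[of "[]"] by (simp add: tower_word_def)
  then show ?thesis using LIMSEQ_const_iff by blast
qed

end

end

text \<open>The Rokhlin relations for fixed d, F and \<epsilon>, named so that one system of towers
  can be chosen for every member of a sequence of tolerances.\<close>

definition rokhlin_towers :: "nat \<Rightarrow> 'a set \<Rightarrow> real \<Rightarrow> (nat \<Rightarrow> 'g \<Rightarrow> 'a) \<Rightarrow> bool" where
  "rokhlin_towers d F \<epsilon> f \<longleftrightarrow>
    (\<forall>l\<le>d. \<forall>g\<in>carrier G. cstar_positive A (f l g) \<and> cnorm A (f l g) \<le> 1) \<and>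
    (\<forall>l\<le>d. \<forall>g\<in>carrier G. \<forall>h\<in>carrier G. cnorm A (\<alpha> h (f l g) \<ominus> f l (h \<otimes>\<^bsub>G\<^esub> g)) \<le> \<epsilon>) \<and>
    (\<forall>l\<le>d. \<forall>g\<in>carrier G. \<forall>a\<in>F. cnorm A ((f l g \<otimes> a) \<ominus> (a \<otimes> f l g)) \<le> \<epsilon>) \<and>
    (\<forall>l\<le>d. \<forall>g\<in>carrier G. \<forall>h\<in>carrier G. g \<noteq> h \<longrightarrow> cnorm A (f l g \<otimes> f l h) \<le> \<epsilon>) \<and>
    cnorm A ((\<Oplus>l\<in>{..d}. \<Oplus>g\<in>carrier G. f l g) \<ominus> \<one>) \<le> \<epsilon> \<and>
    (\<forall>k\<le>d. \<forall>l\<le>d. \<forall>g\<in>carrier G. \<forall>h\<in>carrier G.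
      cnorm A ((f l g \<otimes> f k h) \<ominus> (f k h \<otimes> f l g)) \<le> \<epsilon>)"

text \<open>Towers are chosen for F = {a} and the tolerances 1 / (n + 1). Since d does not depend on
  the tolerance, all of them share one finite index set, which is what the pigeonhole argument in
  the limit relies on.\<close>

lemma coeff_eq_zero:
  assumes rok: "finite_rokhlin_dimension_commuting_towers G A \<alpha>"
    and \<tau>: "\<tau> \<in> tracial_states B" and g: "g \<in> carrier G" "g \<noteq> \<one>\<^bsub>G\<^esub>" and a: "a \<in> carrier A"
  shows "coeff \<tau> g a = 0"
proof -
  define e where "e = (\<lambda>n::nat. inverse (real (Suc n)))"
  have e: "e n > 0" "e \<longlonglongrightarrow> 0" for n
    using LIMSEQ_inverse_real_of_nat by (auto simp: e_def)
  from rok obtain d where d: "\<forall>F \<epsilon>. finite F \<and> F \<subseteq> carrier A \<and> 0 < \<epsilon> \<longrightarrow>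
      (\<exists>f. rokhlin_towers d F \<epsilon> f)"
    unfolding finite_rokhlin_dimension_commuting_towers_def rokhlin_towers_def by (rule exE)
  have "\<forall>n. \<exists>f. rokhlin_towers d {a} (e n) f"
    using d[rule_format, of "{a}"] a e(1) by simp
  then obtain f where "\<forall>n. rokhlin_towers d {a} (e n) (f n)"
    using choice[of "\<lambda>n. rokhlin_towers d {a} (e n)"] by blast
  note f = this[THEN spec, unfolded rokhlin_towers_def]
  note f1 = f[THEN conjunct1, rule_format]
    and f2 = f[THEN conjunct2, THEN conjunct1, rule_format]
    and f3 = f[THEN conjunct2, THEN conjunct2, THEN conjunct1, rule_format]
    and f4 = f[THEN conjunct2, THEN conjunct2, THEN conjunct2, THEN conjunct1, rule_format]
    and f5 = f[THEN conjunct2, THEN conjunct2, THEN conjunct2, THEN conjunct2, THEN conjunct1]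
    and f6 = f[THEN conjunct2, THEN conjunct2, THEN conjunct2, THEN conjunct2, THEN conjunct2,
      rule_format]
  define p where "p = (\<lambda>n (l, h). f n l h)"
  have pc: "f n l h \<in> carrier A" if "l \<le> d" "h \<in> carrier G" for n l h
    using f1[of l h n, THEN conjunct1] that unfolding cstar_positive_iff_pos by (intro pos_closed)
  show ?thesis
  proof (rule coeff_tower_zero[OF \<tau> g(1) a g(2), where p = p and d = d])
    show "p n i \<in> carrier A" "cnorm A (p n i) \<le> 1" if "i \<in> {..d} \<times> carrier G" for n i
      using that f1 pc by (auto simp: p_def)
    show "asymp (\<lambda>n. \<alpha> k (p n (l, h))) (\<lambda>n. p n (l, k \<otimes>\<^bsub>G\<^esub> h))"
      if "l \<le> d" "h \<in> carrier G" "k \<in> carrier G" for l h k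
      unfolding p_def prod.case using that pc
      by (intro asympI[OF _ _ f2 e(2)] act_closed) auto
    show "asymp (\<lambda>n. p n i \<otimes> a) (\<lambda>n. a \<otimes> p n i)" if i: "i \<in> {..d} \<times> carrier G" for i
    proof -
      obtain l h where "i = (l, h)" "l \<le> d" "h \<in> carrier G" using i by auto
      then show ?thesis unfolding p_def using pc a by (auto intro!: asympI[OF _ _ f3 e(2)])
    qed
    show "asymp (\<lambda>n. p n (l, h) \<otimes> p n (l, k)) (\<lambda>n. \<zero>)"
      if lhk: "l \<le> d" "h \<in> carrier G" "k \<in> carrier G" "h \<noteq> k" for l h k
    proof (unfold p_def prod.case, rule asympI[OF _ _ _ e(2)])
      fix n
      have "f n l h \<otimes> f n l k \<ominus> \<zero> = f n l h \<otimes> f n l k"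
        using pc lhk by (simp add: a_minus_def)
      then show "cnorm A (f n l h \<otimes> f n l k \<ominus> \<zero>) \<le> e n" using f4 lhk by simp
    qed (use pc lhk in auto)
    show "asymp (\<lambda>n. \<Oplus>l\<in>{..d}. \<Oplus>h\<in>carrier G. p n (l, h)) (\<lambda>n. \<one>)"
      unfolding p_def prod.case using pc
      by (intro asympI[OF _ _ f5 e(2)] finsum_closed_family) auto
    show "asymp (\<lambda>n. p n i \<otimes> p n j) (\<lambda>n. p n j \<otimes> p n i)"
      if ij: "i \<in> {..d} \<times> carrier G" "j \<in> {..d} \<times> carrier G" for i j
    proof -
      obtain l h k s where "i = (l, h)" "l \<le> d" "h \<in> carrier G" "j = (k, s)" "k \<le> d" "s \<in> carrier G"
        using ij by auto
      then show ?thesis unfolding p_def using pc by (auto intro!: asympI[OF _ _ f6 e(2)])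
    qed
  qed
qed

text \<open>Of the terms f(g) u_g only the one with g = 1 contributes. In other words, \<tau>
  factors through the conditional expectation of the crossed product onto \<open>A\<close>.\<close>

lemma trace_eq_restricted_trace:
  assumes rok: "finite_rokhlin_dimension_commuting_towers G A \<alpha>"
    and \<tau>: "\<tau> \<in> tracial_states B" and f: "f \<in> carrier B"
  shows "\<tau> f = restricted_trace \<tau> (f \<one>\<^bsub>G\<^esub>)"
proof -
  have "\<tau> f = \<tau> (\<Oplus>\<^bsub>B\<^esub>g\<in>carrier G. single g (f g))"
    using crossed_eq_finsum_single[OF f] by simp
  also have "\<dots> = (\<Sum>g\<in>carrier G. coeff \<tau> g (f g))"
    unfolding coeff_def[OF \<tau>] using f crossed_closed finite_group
    by (intro trace_finsum[OF \<tau>]) auto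
  also have "\<dots> = (\<Sum>g\<in>carrier G. if \<one>\<^bsub>G\<^esub> = g then coeff \<tau> g (f g) else 0)"
    using coeff_eq_zero[OF rok \<tau>] f crossed_closed by (intro sum.cong) auto
  also have "\<dots> = coeff \<tau> \<one>\<^bsub>G\<^esub> (f \<one>\<^bsub>G\<^esub>)" using finite_group by simp
  finally show ?thesis
    using f crossed_closed by (simp add: restricted_trace_def[OF \<tau>])
qed

end

section \<open>Complex matrices\<close>

lemma unital_cstar_complex: "unital_cstar complex_cstar"
  using cstar_algebra_complex
  by (simp add: unital_cstar_def unital_cstar_axioms_def cstar_algebra_def)

lemma finsum_complex: "finite I \<Longrightarrow> (\<Oplus>\<^bsub>complex_cstar\<^esub>i\<in>I. f i) = (\<Sum>i\<in>I. f i)"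
proof (induction I rule: finite_induct)
  case empty
  interpret C: unital_cstar complex_cstar by (rule unital_cstar_complex)
  show ?case by simp
next
  case (insert i I)
  interpret C: unital_cstar complex_cstar by (rule unital_cstar_complex)
  show ?case using insert by simp
qed

abbreviation cmat :: "nat \<Rightarrow> (nat \<Rightarrow> nat \<Rightarrow> complex) cstar_struct" where
  "cmat K \<equiv> matrix_algebra K complex_cstar"

lemma cmat_carrier: "X \<in> carrier (cmat K) \<longleftrightarrow> (\<forall>i j. \<not> (i < K \<and> j < K) \<longrightarrow> X i j = 0)"
  by (simp add: matrix_algebra_def)

lemma cmat_add: "X \<oplus>\<^bsub>cmat K\<^esub> Y = (\<lambda>i j. X i j + Y i j)"
  and cmat_zero: "\<zero>\<^bsub>cmat K\<^esub> = (\<lambda>i j. 0)"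
  and cmat_scale: "c \<odot>\<^bsub>cmat K\<^esub> X = (\<lambda>i j. c * X i j)"
  and cmat_adj: "adj (cmat K) X = (\<lambda>i j. cnj (X j i))"
  by (simp_all add: matrix_algebra_def)

lemma cmat_mult:
  "X \<otimes>\<^bsub>cmat K\<^esub> Y = (\<lambda>i j. if i < K \<and> j < K then \<Sum>k<K. X i k * Y k j else 0)"
  by (intro ext) (simp add: matrix_algebra_def finsum_complex)

lemma cmat_mult_closed: "X \<otimes>\<^bsub>cmat K\<^esub> Y \<in> carrier (cmat K)"
  by (simp add: cmat_mult cmat_carrier)

lemma cmat_abelian_group: "abelian_group (cmat K)"
proof (rule abelian_groupI)
  fix X assume "X \<in> carrier (cmat K)"
  then show "\<exists>Y\<in>carrier (cmat K). Y \<oplus>\<^bsub>cmat K\<^esub> X = \<zero>\<^bsub>cmat K\<^esub>"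
    by (intro bexI[of _ "\<lambda>i j. - X i j"]) (auto simp: cmat_add cmat_zero cmat_carrier)
qed (auto simp: cmat_add cmat_zero cmat_carrier add_ac)

lemma cmat_diff:
  assumes "X \<in> carrier (cmat K)" "Y \<in> carrier (cmat K)"
  shows "X \<ominus>\<^bsub>cmat K\<^esub> Y = (\<lambda>i j. X i j - Y i j)"
proof -
  interpret abelian_group "cmat K" by (rule cmat_abelian_group)
  have "\<ominus>\<^bsub>cmat K\<^esub> Y = (\<lambda>i j. - Y i j)"
    using assms(2) by (intro minus_equality) (auto simp: cmat_add cmat_zero cmat_carrier)
  then show ?thesis by (simp add: a_minus_def cmat_add)
qed

lemma cmat_finsum:
  assumes "finite I" "\<And>i. i \<in> I \<Longrightarrow> F i \<in> carrier (cmat K)"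
  shows "(\<Oplus>\<^bsub>cmat K\<^esub>i\<in>I. F i) = (\<lambda>a b. \<Sum>i\<in>I. F i a b)"
  using assms
proof (induction I rule: finite_induct)
  case empty
  interpret abelian_group "cmat K" by (rule cmat_abelian_group)
  show ?case by (simp add: cmat_zero)
next
  case (insert i I)
  interpret abelian_group "cmat K" by (rule cmat_abelian_group)
  have "F i \<in> carrier (cmat K)" "F \<in> I \<rightarrow> carrier (cmat K)" using insert by auto
  then show ?case using insert by (simp add: cmat_add)
qed

section \<open>Euclidean norms and Gram matrices\<close>

definition vnorm :: "nat \<Rightarrow> (nat \<Rightarrow> complex) \<Rightarrow> real" where
  "vnorm K \<xi> = L2_set (\<lambda>i. cmod (\<xi> i)) {..<K}"

definition mat_vec :: "nat \<Rightarrow> (nat \<Rightarrow> nat \<Rightarrow> complex) \<Rightarrow> (nat \<Rightarrow> complex) \<Rightarrow> nat \<Rightarrow> complex" where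
  "mat_vec K X \<xi> i = (\<Sum>j<K. X i j * \<xi> j)"

lemma sum_cnj_mult_self: "(\<Sum>i\<in>I. cnj (\<xi> i) * \<xi> i) = complex_of_real ((L2_set (\<lambda>i. cmod (\<xi> i)) I)\<^sup>2)"
proof -
  have "(\<Sum>i\<in>I. cnj (\<xi> i) * \<xi> i) = (\<Sum>i\<in>I. complex_of_real ((cmod (\<xi> i))\<^sup>2))"
    by (intro sum.cong refl) (metis complex_norm_square mult.commute)
  also have "\<dots> = complex_of_real (\<Sum>i\<in>I. (cmod (\<xi> i))\<^sup>2)" by simp
  also have "(\<Sum>i\<in>I. (cmod (\<xi> i))\<^sup>2) = (L2_set (\<lambda>i. cmod (\<xi> i)) I)\<^sup>2"
    unfolding L2_set_def by (subst real_sqrt_pow2) (auto intro: sum_nonneg)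
  finally show ?thesis .
qed

lemma vnorm_nonneg [simp]: "0 \<le> vnorm K \<xi>"
  by (simp add: vnorm_def L2_set_nonneg)

lemma hilbert_module_norm_complex: "hilbert_module_norm complex_cstar {..<K} \<xi> = vnorm K \<xi>"
  unfolding hilbert_module_norm_def by (simp add: finsum_complex sum_cnj_mult_self norm_power vnorm_def L2_set_nonneg)

lemma cmat_cnorm: "cnorm (cmat K) X = hilbert_module_op_norm complex_cstar {..<K} (mat_vec K X)"
  by (simp add: matrix_algebra_def mat_vec_def[abs_def] finsum_complex)

lemma mat_app_complex: "unital_cstar.mat_app complex_cstar {..<K} X = mat_vec K X"
  by (intro ext) (simp add: unital_cstar.mat_app_def[OF unital_cstar_complex] finsum_complex mat_vec_def)

lemma vnorm_mat_vec_le: "vnorm K (mat_vec K X \<xi>) \<le> cnorm (cmat K) X * vnorm K \<xi>"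
  using unital_cstar.hnorm_mat_app_le[OF unital_cstar_complex, of "{..<K}" X \<xi>]
  by (simp add: mat_app_complex cmat_cnorm hilbert_module_norm_complex)

lemma cmat_cnorm_le:
  assumes "\<And>\<xi>. vnorm K (mat_vec K X \<xi>) \<le> c * vnorm K \<xi>" "0 \<le> c"
  shows "cnorm (cmat K) X \<le> c"
  using unital_cstar.opnorm_le[OF unital_cstar_complex, of "{..<K}" X c] assms
  by (simp add: mat_app_complex cmat_cnorm hilbert_module_norm_complex)

lemma cmat_cnorm_nonneg [simp]: "0 \<le> cnorm (cmat K) X"
  using unital_cstar.opnorm_nonneg[OF unital_cstar_complex, of "{..<K}" X]
  by (simp add: mat_app_complex cmat_cnorm)

lemma vnorm_sum_le: "finite T \<Longrightarrow> vnorm K (\<lambda>i. \<Sum>t\<in>T. w t i) \<le> (\<Sum>t\<in>T. vnorm K (w t))"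
proof (induction T rule: finite_induct)
  case empty
  then show ?case by (simp add: vnorm_def L2_set_def)
next
  case (insert t T)
  have "vnorm K (\<lambda>i. \<Sum>t\<in>insert t T. w t i)
      \<le> L2_set (\<lambda>i. cmod (w t i) + cmod (\<Sum>t\<in>T. w t i)) {..<K}"
    unfolding vnorm_def using insert by (intro L2_set_mono) (auto simp: norm_triangle_ineq)
  also have "\<dots> \<le> vnorm K (w t) + vnorm K (\<lambda>i. \<Sum>t\<in>T. w t i)"
    unfolding vnorm_def by (rule L2_set_triangle_ineq)
  finally show ?case using insert by simp
qed

lemma mat_vec_sum: "mat_vec K (\<lambda>i j. \<Sum>t\<in>T. X t i j) \<xi> = (\<lambda>i. \<Sum>t\<in>T. mat_vec K (X t) \<xi> i)"
  unfolding mat_vec_def by (intro ext) (simp add: sum_distrib_right sum.swap[of _ T])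

lemma cmat_cnorm_sum_le:
  assumes "finite T"
  shows "cnorm (cmat K) (\<lambda>i j. \<Sum>t\<in>T. X t i j) \<le> (\<Sum>t\<in>T. cnorm (cmat K) (X t))"
proof (rule cmat_cnorm_le)
  fix \<xi>
  have "vnorm K (mat_vec K (\<lambda>i j. \<Sum>t\<in>T. X t i j) \<xi>) \<le> (\<Sum>t\<in>T. vnorm K (mat_vec K (X t) \<xi>))"
    unfolding mat_vec_sum by (rule vnorm_sum_le[OF assms])
  also have "\<dots> \<le> (\<Sum>t\<in>T. cnorm (cmat K) (X t)) * vnorm K \<xi>"
    unfolding sum_distrib_right by (intro sum_mono vnorm_mat_vec_le)
  finally show "vnorm K (mat_vec K (\<lambda>i j. \<Sum>t\<in>T. X t i j) \<xi>) \<le> \<dots>" .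
qed (simp add: sum_nonneg)

lemma cmod_sum_cnj_mult_le:
  "cmod (\<Sum>i\<in>I. cnj (\<eta> i) * \<xi> i) \<le> L2_set (\<lambda>i. cmod (\<eta> i)) I * L2_set (\<lambda>i. cmod (\<xi> i)) I"
proof -
  have "cmod (\<Sum>i\<in>I. cnj (\<eta> i) * \<xi> i) \<le> (\<Sum>i\<in>I. \<bar>cmod (\<eta> i)\<bar> * \<bar>cmod (\<xi> i)\<bar>)"
    by (rule order.trans[OF norm_sum]) (simp add: norm_mult)
  also have "\<dots> \<le> L2_set (\<lambda>i. cmod (\<eta> i)) I * L2_set (\<lambda>i. cmod (\<xi> i)) I"
    by (rule L2_set_mult_ineq)
  finally show ?thesis .
qed

text \<open>In matrix terms q = U* V, and the claim is <\<xi>, q \<eta>> = <U \<xi>, V \<eta>>. The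
  row index ranges over an arbitrary set S so that pairs of numbers can serve as rows.\<close>

lemma sum_gram:
  fixes U V :: "'c \<Rightarrow> nat \<Rightarrow> complex"
  assumes "\<And>a b. a < K \<Longrightarrow> b < K \<Longrightarrow> q a b = (\<Sum>c\<in>S. cnj (U c a) * V c b)"
  shows "(\<Sum>a<K. cnj (\<xi> a) * mat_vec K q \<eta> a)
    = (\<Sum>c\<in>S. cnj (\<Sum>a<K. U c a * \<xi> a) * (\<Sum>b<K. V c b * \<eta> b))"
proof -
  have "(\<Sum>a<K. cnj (\<xi> a) * mat_vec K q \<eta> a)
      = (\<Sum>a<K. \<Sum>b<K. \<Sum>c\<in>S. cnj (U c a * \<xi> a) * (V c b * \<eta> b))"
    unfolding mat_vec_def
    by (intro sum.cong refl) (auto simp: assms sum_distrib_left sum_distrib_right mult_ac intro!: sum.cong)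
  also have "\<dots> = (\<Sum>a<K. \<Sum>c\<in>S. \<Sum>b<K. cnj (U c a * \<xi> a) * (V c b * \<eta> b))"
    by (intro sum.cong refl) (rule sum.swap)
  also have "\<dots> = (\<Sum>c\<in>S. \<Sum>a<K. \<Sum>b<K. cnj (U c a * \<xi> a) * (V c b * \<eta> b))"
    by (rule sum.swap)
  also have "\<dots> = (\<Sum>c\<in>S. cnj (\<Sum>a<K. U c a * \<xi> a) * (\<Sum>b<K. V c b * \<eta> b))"
    by (simp add: sum_product)
  finally show ?thesis .
qed

text \<open>The norm estimate behind the Kadison--Schwarz inequality.\<close>

lemma cmat_cnorm_gram_le:
  fixes U V :: "'c \<Rightarrow> nat \<Rightarrow> complex"
  assumes p: "\<And>a b. a < K \<Longrightarrow> b < K \<Longrightarrow> p a b = (\<Sum>c\<in>S. cnj (U c a) * U c b)"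
    and q: "\<And>a b. a < K \<Longrightarrow> b < K \<Longrightarrow> q a b = (\<Sum>c\<in>S. cnj (U c a) * V c b)"
    and r: "\<And>a b. a < K \<Longrightarrow> b < K \<Longrightarrow> r a b = (\<Sum>c\<in>S. cnj (V c a) * V c b)"
  shows "(cnorm (cmat K) q)\<^sup>2 \<le> cnorm (cmat K) p * cnorm (cmat K) r"
proof -
  \<comment> \<open>Here s = W* W, and ||W \<xi>||^2 = <\<xi>, s \<xi>> is at most ||s||
    ||\<xi>||^2.\<close>
  have gram: "L2_set (\<lambda>c. cmod (\<Sum>a<K. W c a * \<xi> a)) S \<le> sqrt (cnorm (cmat K) s) * vnorm K \<xi>"
    if s: "\<And>a b. a < K \<Longrightarrow> b < K \<Longrightarrow> s a b = (\<Sum>c\<in>S. cnj (W c a) * W c b)"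
    for W :: "'c \<Rightarrow> nat \<Rightarrow> complex" and s \<xi>
  proof -
    let ?L = "L2_set (\<lambda>c. cmod (\<Sum>a<K. W c a * \<xi> a)) S"
    have "?L\<^sup>2 = cmod (complex_of_real (?L\<^sup>2))" by (simp only: norm_of_real abs_power2)
    also have "\<dots> = cmod (\<Sum>a<K. cnj (\<xi> a) * mat_vec K s \<xi> a)"
    proof -
      have "(\<Sum>a<K. cnj (\<xi> a) * mat_vec K s \<xi> a)
          = (\<Sum>c\<in>S. cnj (\<Sum>a<K. W c a * \<xi> a) * (\<Sum>b<K. W c b * \<xi> b))"
        by (rule sum_gram) (rule s)
      then show ?thesis by (simp only: sum_cnj_mult_self)
    qed
    also have "\<dots> \<le> vnorm K \<xi> * vnorm K (mat_vec K s \<xi>)"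
      unfolding vnorm_def by (rule cmod_sum_cnj_mult_le)
    also have "\<dots> \<le> vnorm K \<xi> * (cnorm (cmat K) s * vnorm K \<xi>)"
      by (intro mult_left_mono vnorm_mat_vec_le) simp
    also have "\<dots> = (sqrt (cnorm (cmat K) s) * vnorm K \<xi>)\<^sup>2"
      by (simp add: power_mult_distrib power2_eq_square[of "vnorm K \<xi>"] mult_ac)
    finally show ?thesis by (rule power2_le_imp_le) simp
  qed
  have "cnorm (cmat K) q \<le> sqrt (cnorm (cmat K) p) * sqrt (cnorm (cmat K) r)"
  proof (rule cmat_cnorm_le)
    fix \<eta>
    \<comment> \<open>Testing q \<eta> against itself gives ||\<zeta>||^2 = <U \<zeta>, V \<eta>>; a
      factor ||\<zeta>|| is cancelled at the end.\<close>
    define \<zeta> where "\<zeta> = mat_vec K q \<eta>"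
    have "(vnorm K \<zeta>)\<^sup>2 = cmod (complex_of_real ((vnorm K \<zeta>)\<^sup>2))" by (simp only: norm_of_real abs_power2)
    also have "\<dots> = cmod (\<Sum>a<K. cnj (\<zeta> a) * mat_vec K q \<eta> a)"
      unfolding \<zeta>_def[symmetric] sum_cnj_mult_self vnorm_def ..
    also have "\<dots> \<le> L2_set (\<lambda>c. cmod (\<Sum>a<K. U c a * \<zeta> a)) S * L2_set (\<lambda>c. cmod (\<Sum>b<K. V c b * \<eta> b)) S"
    proof -
      have "(\<Sum>a<K. cnj (\<zeta> a) * mat_vec K q \<eta> a)
          = (\<Sum>c\<in>S. cnj (\<Sum>a<K. U c a * \<zeta> a) * (\<Sum>b<K. V c b * \<eta> b))"
        by (rule sum_gram) (rule q)
      then show ?thesis by (simp only: cmod_sum_cnj_mult_le)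
    qed
    also have "\<dots> \<le> (sqrt (cnorm (cmat K) p) * vnorm K \<zeta>) * (sqrt (cnorm (cmat K) r) * vnorm K \<eta>)"
      by (intro mult_mono gram p r) (auto simp: L2_set_nonneg)
    finally have "vnorm K \<zeta> * vnorm K \<zeta>
        \<le> (sqrt (cnorm (cmat K) p) * sqrt (cnorm (cmat K) r) * vnorm K \<eta>) * vnorm K \<zeta>"
      by (simp add: power2_eq_square mult_ac)
    then show "vnorm K (mat_vec K q \<eta>) \<le> sqrt (cnorm (cmat K) p) * sqrt (cnorm (cmat K) r) * vnorm K \<eta>"
      unfolding \<zeta>_def[symmetric] using vnorm_nonneg[of K \<zeta>]
      by (cases "vnorm K \<zeta> = 0") auto
  qed simp
  then have "(cnorm (cmat K) q)\<^sup>2 \<le> (sqrt (cnorm (cmat K) p) * sqrt (cnorm (cmat K) r))\<^sup>2"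
    by (intro power_mono) auto
  then show ?thesis by (simp add: power_mult_distrib)
qed

text \<open>Both layers of the product W* W are written out as scalar sums. No condition is put on W
  outside the relevant indices, which makes witnesses easy to reindex; the converse truncates W to V
  in order to land in the carrier.\<close>

lemma cstar_positive_cmat_matrix:
  "cstar_positive (matrix_algebra n (cmat K)) Z \<longleftrightarrow>
    (\<forall>i j. \<not> (i < n \<and> j < n) \<longrightarrow> Z i j = (\<lambda>a b. 0)) \<and>
    (\<forall>i<n. \<forall>j<n. Z i j \<in> carrier (cmat K)) \<and>
    (\<exists>W. \<forall>i<n. \<forall>j<n. \<forall>a<K. \<forall>b<K.
      Z i j a b = (\<Sum>k<n. \<Sum>c<K. cnj (W k i c a) * W k j c b))"
    (is "?P \<longleftrightarrow> ?Q")
proof -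
  have entry: "(adj (matrix_algebra n (cmat K)) W \<otimes>\<^bsub>matrix_algebra n (cmat K)\<^esub> W) i j =
      (if i < n \<and> j < n
       then (\<lambda>a b. \<Sum>k<n. if a < K \<and> b < K then \<Sum>c<K. cnj (W k i c a) * W k j c b else 0)
       else (\<lambda>a b. 0))" for W i j
  proof -
    have "(adj (matrix_algebra n (cmat K)) W \<otimes>\<^bsub>matrix_algebra n (cmat K)\<^esub> W) i j =
      (if i < n \<and> j < n then \<Oplus>\<^bsub>cmat K\<^esub>k\<in>{..<n}. adj (cmat K) (W k i) \<otimes>\<^bsub>cmat K\<^esub> W k j
       else \<zero>\<^bsub>cmat K\<^esub>)"
      by (simp add: matrix_algebra_def[of n])
    moreover have "(\<Oplus>\<^bsub>cmat K\<^esub>k\<in>{..<n}. adj (cmat K) (W k i) \<otimes>\<^bsub>cmat K\<^esub> W k j)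
        = (\<lambda>a b. \<Sum>k<n. (adj (cmat K) (W k i) \<otimes>\<^bsub>cmat K\<^esub> W k j) a b)"
      by (intro cmat_finsum cmat_mult_closed) simp
    ultimately show ?thesis by (simp only: cmat_zero cmat_mult cmat_adj)
  qed
  show ?thesis
  proof
    assume ?P
    then obtain W where W: "Z = adj (matrix_algebra n (cmat K)) W \<otimes>\<^bsub>matrix_algebra n (cmat K)\<^esub> W"
      unfolding cstar_positive_def by blast
    show ?Q
      unfolding W entry by (intro conjI exI[of _ W]) (auto simp: cmat_carrier)
  next
    assume Q: ?Q
    then obtain W where W: "\<And>i j a b. i < n \<Longrightarrow> j < n \<Longrightarrow> a < K \<Longrightarrow> b < K \<Longrightarrow>
      Z i j a b = (\<Sum>k<n. \<Sum>c<K. cnj (W k i c a) * W k j c b)" by blast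
    define V where "V = (\<lambda>k i c a. if k < n \<and> i < n \<and> c < K \<and> a < K then W k i c a else 0)"
    have "V \<in> carrier (matrix_algebra n (cmat K))"
      unfolding matrix_algebra_def[of n] by (auto simp: V_def cmat_carrier cmat_zero)
    moreover have "Z = adj (matrix_algebra n (cmat K)) V \<otimes>\<^bsub>matrix_algebra n (cmat K)\<^esub> V"
    proof (intro ext)
      fix i j a b
      show "Z i j a b = (adj (matrix_algebra n (cmat K)) V \<otimes>\<^bsub>matrix_algebra n (cmat K)\<^esub> V) i j a b"
      proof (cases "i < n \<and> j < n \<and> a < K \<and> b < K")
        case True
        then show ?thesis unfolding entry using W by (simp add: V_def)
      next
        case False
        then show ?thesis unfolding entry using Q by (auto simp: cmat_carrier)
      qed
    qed
    ultimately show ?P unfolding cstar_positive_def by blast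
  qed
qed

section \<open>Block matrices\<close>

lemma sum_div_mod:
  fixes F :: "nat \<Rightarrow> nat \<Rightarrow> 'b::comm_monoid_add"
  shows "(\<Sum>I<N * k. F (I div k) (I mod k)) = (\<Sum>s<N. \<Sum>i<k. F s i)"
proof (cases "k = 0")
  case False
  have "(\<Sum>I<N * k. F (I div k) (I mod k)) = (\<Sum>(s, i)\<in>{..<N} \<times> {..<k}. F s i)"
  proof (rule sum.reindex_bij_witness[where i = "\<lambda>(s, i). s * k + i" and j = "\<lambda>I. (I div k, I mod k)"])
    fix si assume "si \<in> {..<N} \<times> {..<k}"
    then obtain s i where si: "si = (s, i)" "s < N" "i < k" by auto
    have "s * k + i < Suc s * k" using si by simp
    also have "\<dots> \<le> N * k" using si by (intro mult_le_mono1) simp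
    finally show "(case si of (s, i) \<Rightarrow> s * k + i) \<in> {..<N * k}" using si by simp
  qed (use False in \<open>auto simp: less_mult_imp_div_less\<close>)
  then show ?thesis by (simp add: sum.cartesian_product)
qed simp

text \<open>The identification of M_N(M_k) with M_(N k): the index s * k + i stands for position i
  of block s, and \<open>div\<close> and \<open>mod\<close> recover the pair.\<close>

definition block_mat :: "nat \<Rightarrow> nat \<Rightarrow> (nat \<Rightarrow> nat \<Rightarrow> nat \<Rightarrow> nat \<Rightarrow> complex) \<Rightarrow> nat \<Rightarrow> nat \<Rightarrow> complex" where
  "block_mat N k b I J = (if I < N * k \<and> J < N * k
     then b (I div k) (J div k) (I mod k) (J mod k) else 0)"

lemma block_mat_closed: "block_mat N k b \<in> carrier (cmat (N * k))"
  by (simp add: cmat_carrier block_mat_def)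

lemma mod_less_of_less_mult: "I < N * k \<Longrightarrow> I mod k < (k::nat)"
  by (cases "k = 0") auto

lemma block_mat_cong:
  assumes "\<And>s t i j. s < N \<Longrightarrow> t < N \<Longrightarrow> i < k \<Longrightarrow> j < k \<Longrightarrow> b s t i j = c s t i j"
  shows "block_mat N k b = block_mat N k c"
  by (intro ext) (auto simp: block_mat_def assms less_mult_imp_div_less mod_less_of_less_mult)

lemma block_mat_mult:
  "block_mat N k b \<otimes>\<^bsub>cmat (N * k)\<^esub> block_mat N k c
    = block_mat N k (\<lambda>s t i j. \<Sum>r<N. (b s r \<otimes>\<^bsub>cmat k\<^esub> c r t) i j)"
proof (intro ext)
  fix I J
  show "(block_mat N k b \<otimes>\<^bsub>cmat (N * k)\<^esub> block_mat N k c) I J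
    = block_mat N k (\<lambda>s t i j. \<Sum>r<N. (b s r \<otimes>\<^bsub>cmat k\<^esub> c r t) i j) I J"
  proof (cases "I < N * k \<and> J < N * k")
    case True
    have "(block_mat N k b \<otimes>\<^bsub>cmat (N * k)\<^esub> block_mat N k c) I J
        = (\<Sum>R<N * k. b (I div k) (R div k) (I mod k) (R mod k) * c (R div k) (J div k) (R mod k) (J mod k))"
      using True by (simp add: cmat_mult block_mat_def)
    also have "\<dots> = (\<Sum>r<N. \<Sum>l<k. b (I div k) r (I mod k) l * c r (J div k) l (J mod k))"
      by (rule sum_div_mod)
    finally show ?thesis
      using True mod_less_of_less_mult[of I N k] mod_less_of_less_mult[of J N k]
      by (simp add: block_mat_def cmat_mult)
  qed (auto simp: cmat_mult block_mat_def)
qed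

lemma block_mat_diff:
  "block_mat N k b \<ominus>\<^bsub>cmat (N * k)\<^esub> block_mat N k c = block_mat N k (\<lambda>s t i j. b s t i j - c s t i j)"
  by (simp add: cmat_diff block_mat_closed) (auto simp: block_mat_def intro!: ext)

lemma mat_vec_block_mat:
  assumes "I < N * k"
  shows "mat_vec (N * k) (block_mat N k b) \<xi> I
    = (\<Sum>t<N. mat_vec k (b (I div k) t) (\<lambda>j. \<xi> (t * k + j)) (I mod k))"
proof -
  have "mat_vec (N * k) (block_mat N k b) \<xi> I
      = (\<Sum>J<N * k. b (I div k) (J div k) (I mod k) (J mod k) * \<xi> (J div k * k + J mod k))"
    unfolding mat_vec_def using assms by (simp add: block_mat_def)
  also have "\<dots> = (\<Sum>t<N. \<Sum>j<k. b (I div k) t (I mod k) j * \<xi> (t * k + j))"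
    by (rule sum_div_mod[where F = "\<lambda>t j. b (I div k) t (I mod k) j * \<xi> (t * k + j)"])
  finally show ?thesis by (simp add: mat_vec_def)
qed

lemma vnorm_blocks:
  "(vnorm (N * k) \<xi>)\<^sup>2 = (\<Sum>s<N. (vnorm k (\<lambda>i. \<xi> (s * k + i)))\<^sup>2)"
proof -
  have sq: "(vnorm K \<zeta>)\<^sup>2 = (\<Sum>i<K. (cmod (\<zeta> i))\<^sup>2)" for K \<zeta>
    unfolding vnorm_def L2_set_def by (simp add: sum_nonneg)
  have "(\<Sum>I<N * k. (cmod (\<xi> I))\<^sup>2) = (\<Sum>I<N * k. (cmod (\<xi> (I div k * k + I mod k)))\<^sup>2)"
    by simp
  also have "\<dots> = (\<Sum>s<N. \<Sum>i<k. (cmod (\<xi> (s * k + i)))\<^sup>2)"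
    by (rule sum_div_mod[where F = "\<lambda>s i. (cmod (\<xi> (s * k + i)))\<^sup>2"])
  finally show ?thesis by (simp add: sq)
qed

lemma vnorm_mat_vec_block_mat:
  "(vnorm (N * k) (mat_vec (N * k) (block_mat N k b) \<xi>))\<^sup>2
    = (\<Sum>s<N. (vnorm k (\<lambda>i. \<Sum>t<N. mat_vec k (b s t) (\<lambda>j. \<xi> (t * k + j)) i))\<^sup>2)"
proof -
  have "mat_vec (N * k) (block_mat N k b) \<xi> (s * k + i)
      = (\<Sum>t<N. mat_vec k (b s t) (\<lambda>j. \<xi> (t * k + j)) i)" if "s < N" "i < k" for s i
  proof -
    have "s * k + i < Suc s * k" using that by simp
    also have "\<dots> \<le> N * k" using that by (intro mult_le_mono1) simp
    finally show ?thesis using that by (subst mat_vec_block_mat) auto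
  qed
  then show ?thesis
    unfolding vnorm_blocks unfolding vnorm_def by (intro sum.cong refl arg_cong[of _ _ "\<lambda>x. x\<^sup>2"] L2_set_cong) auto
qed

text \<open>Crude, but sufficient in both uses: for multiplicative defects, where every block tends
  to 0, and for a first bound on the amplification, whose constant is removed afterwards.\<close>

lemma cmat_cnorm_block_mat_le:
  "cnorm (cmat (N * k)) (block_mat N k b) \<le> (\<Sum>s<N. \<Sum>t<N. cnorm (cmat k) (b s t))"
proof (rule cmat_cnorm_le)
  fix \<xi>
  let ?v = "\<lambda>s. vnorm k (\<lambda>i. \<Sum>t<N. mat_vec k (b s t) (\<lambda>j. \<xi> (t * k + j)) i)"
  have part: "vnorm k (\<lambda>j. \<xi> (t * k + j)) \<le> vnorm (N * k) \<xi>" if "t < N" for t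
  proof -
    have "(vnorm k (\<lambda>j. \<xi> (t * k + j)))\<^sup>2 \<le> (vnorm (N * k) \<xi>)\<^sup>2"
      unfolding vnorm_blocks[of N] using that
      by (intro member_le_sum[where f = "\<lambda>t. (vnorm k (\<lambda>j. \<xi> (t * k + j)))\<^sup>2"]) auto
    then show ?thesis by (rule power2_le_imp_le) simp
  qed
  have v: "?v s \<le> (\<Sum>t<N. cnorm (cmat k) (b s t)) * vnorm (N * k) \<xi>" for s
  proof -
    have "?v s \<le> (\<Sum>t<N. vnorm k (mat_vec k (b s t) (\<lambda>j. \<xi> (t * k + j))))"
      by (rule vnorm_sum_le) simp
    also have "\<dots> \<le> (\<Sum>t<N. cnorm (cmat k) (b s t) * vnorm (N * k) \<xi>)"
    proof (intro sum_mono)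
      fix t assume "t \<in> {..<N}"
      then have "cnorm (cmat k) (b s t) * vnorm k (\<lambda>j. \<xi> (t * k + j))
          \<le> cnorm (cmat k) (b s t) * vnorm (N * k) \<xi>"
        by (intro mult_left_mono part) auto
      then show "vnorm k (mat_vec k (b s t) (\<lambda>j. \<xi> (t * k + j))) \<le> cnorm (cmat k) (b s t) * vnorm (N * k) \<xi>"
        using vnorm_mat_vec_le order.trans by blast
    qed
    finally show ?thesis by (simp add: sum_distrib_right)
  qed
  have "vnorm (N * k) (mat_vec (N * k) (block_mat N k b) \<xi>) = L2_set ?v {..<N}"
    unfolding L2_set_def vnorm_mat_vec_block_mat[symmetric] by simp
  also have "\<dots> \<le> (\<Sum>s<N. ?v s)" by (intro L2_set_le_sum) simp
  also have "\<dots> \<le> (\<Sum>s<N. \<Sum>t<N. cnorm (cmat k) (b s t)) * vnorm (N * k) \<xi>"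
    unfolding sum_distrib_right[of _ "{..<N}"] by (intro sum_mono v[unfolded sum_distrib_right])
  finally show "vnorm (N * k) (mat_vec (N * k) (block_mat N k b) \<xi>) \<le> \<dots>" .
qed (simp add: sum_nonneg)

text \<open>Equal diagonal blocks act on orthogonal summands, so no constant appears. The sharpness
  matters: this bounds the image of the unit in the Kadison-Schwarz inequality, and a constant there
  would be compounded by the iteration instead of disappearing.\<close>

lemma cmat_cnorm_diag_block_mat_le:
  "cnorm (cmat (N * k)) (block_mat N k (\<lambda>s t. if s = t then x else (\<lambda>i j. 0))) \<le> cnorm (cmat k) x"
proof (rule cmat_cnorm_le)
  fix \<xi>
  let ?b = "\<lambda>s t. if s = t then x else (\<lambda>i j. 0)"
  have "(\<Sum>t<N. mat_vec k (?b s t) (\<lambda>j. \<xi> (t * k + j)) i) = mat_vec k x (\<lambda>j. \<xi> (s * k + j)) i"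
    if "s < N" for s i
  proof -
    have "(\<Sum>t<N. mat_vec k (?b s t) (\<lambda>j. \<xi> (t * k + j)) i)
        = (\<Sum>t<N. if s = t then mat_vec k x (\<lambda>j. \<xi> (t * k + j)) i else 0)"
      by (intro sum.cong refl) (simp add: mat_vec_def)
    then show ?thesis using that by simp
  qed
  then have "(vnorm (N * k) (mat_vec (N * k) (block_mat N k ?b) \<xi>))\<^sup>2
      = (\<Sum>s<N. (vnorm k (mat_vec k x (\<lambda>j. \<xi> (s * k + j))))\<^sup>2)"
    unfolding vnorm_mat_vec_block_mat by (intro sum.cong refl) simp
  also have "\<dots> \<le> (\<Sum>s<N. (cnorm (cmat k) x * vnorm k (\<lambda>j. \<xi> (s * k + j)))\<^sup>2)"
    by (intro sum_mono power_mono vnorm_mat_vec_le) simp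
  also have "\<dots> = (cnorm (cmat k) x * vnorm (N * k) \<xi>)\<^sup>2"
    by (simp add: power_mult_distrib vnorm_blocks sum_distrib_left)
  finally show "vnorm (N * k) (mat_vec (N * k) (block_mat N k ?b) \<xi>) \<le> cnorm (cmat k) x * vnorm (N * k) \<xi>"
    by (rule power2_le_imp_le) simp
qed simp

section \<open>Amplification of completely positive maps\<close>

lemma (in unital_cstar) finsum_div_mod:
  fixes n k :: nat
  assumes "\<And>s i. s < n \<Longrightarrow> i < k \<Longrightarrow> F s i \<in> carrier A"
  shows "(\<Oplus>R\<in>{..<n * k}. F (R div k) (R mod k)) = (\<Oplus>s\<in>{..<n}. \<Oplus>i\<in>{..<k}. F s i)"
  using assms
proof (induction n)
  case (Suc n)
  define H where "H = (\<lambda>R. F (R div k) (R mod k))"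
  have H: "H R \<in> carrier A" if "R < Suc n * k" for R
    unfolding H_def using that by (intro Suc.prems less_mult_imp_div_less mod_less_of_less_mult)
  have split: "{..<Suc n * k} = {..<n * k} \<union> (\<lambda>i. n * k + i) ` {..<k}"
  proof (intro equalityI subsetI)
    fix R assume R: "R \<in> {..<Suc n * k}"
    show "R \<in> {..<n * k} \<union> (\<lambda>i. n * k + i) ` {..<k}"
    proof (cases "R < n * k")
      case False
      then have "R = n * k + (R - n * k)" "R - n * k < k" using R by auto
      then show ?thesis by blast
    qed simp
  qed auto
  have "finsum A H {..<Suc n * k} = finsum A H {..<n * k} \<oplus> finsum A H ((\<lambda>i. n * k + i) ` {..<k})"
    unfolding split using H by (intro finsum_Un_disjoint) auto
  also have "finsum A H ((\<lambda>i. n * k + i) ` {..<k}) = (\<Oplus>i\<in>{..<k}. H (n * k + i))"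
    using H by (intro finsum_reindex) (auto simp: inj_on_def)
  also have "\<dots> = (\<Oplus>i\<in>{..<k}. F n i)"
    using Suc.prems by (intro finsum_eqI) (auto simp: H_def)
  also have "finsum A H {..<n * k} = (\<Oplus>s\<in>{..<n}. \<Oplus>i\<in>{..<k}. F s i)"
    unfolding H_def using Suc by simp
  also have "\<dots> \<oplus> (\<Oplus>i\<in>{..<k}. F n i) = (\<Oplus>s\<in>{..<Suc n}. \<Oplus>i\<in>{..<k}. F s i)"
    unfolding lessThan_Suc using Suc.prems
    by (subst finsum_insert) (auto intro!: finsum_closed_family a_comm)
  finally show ?case by (simp add: H_def)
qed simp

context finite_cstar_dynamics
begin

abbreviation N :: nat where
  "N \<equiv> card (carrier G)"

text \<open>Regular matrices are indexed by the group, the target matrix algebras by natural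
  numbers; any fixed enumeration links the two.\<close>

definition enum :: "nat \<Rightarrow> 'g" where
  "enum = (SOME e. bij_betw e {..<N} (carrier G))"

lemma bij_enum: "bij_betw enum {..<N} (carrier G)"
proof -
  have "\<exists>e. bij_betw e {..<N} (carrier G)"
    using ex_bij_betw_nat_finite[OF finite_group] by (simp add: atLeast0LessThan)
  then show ?thesis unfolding enum_def by (rule someI_ex)
qed

lemma enum_closed [simp, intro]: "s < N \<Longrightarrow> enum s \<in> carrier G"
  using bij_enum by (auto simp: bij_betw_def)

lemma enum_eq_iff: "s < N \<Longrightarrow> t < N \<Longrightarrow> enum s = enum t \<longleftrightarrow> s = t"
  using bij_enum by (auto simp: bij_betw_def inj_on_def)

lemma N_pos: "0 < N"
  using finite_group G.one_closed by (auto simp: card_gt_0_iff)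

lemma finsum_enum:
  assumes "\<And>r. r \<in> carrier G \<Longrightarrow> f r \<in> carrier A"
  shows "(\<Oplus>r\<in>carrier G. f r) = (\<Oplus>r\<in>{..<N}. f (enum r))"
proof -
  have "enum ` {..<N} = carrier G" "inj_on enum {..<N}" using bij_enum by (auto simp: bij_betw_def)
  then show ?thesis using finsum_reindex[of f enum "{..<N}"] assms by auto
qed

lemma crossed_one_closed: "\<one>\<^bsub>B\<^esub> \<in> carrier B"
  by (auto simp: crossed_product_def)

lemma crossed_one_eq_single: "\<one>\<^bsub>B\<^esub> = single \<one>\<^bsub>G\<^esub> \<one>"
  by (simp add: crossed_product_def single_def)

lemma crossed_adj_one: "adj B \<one>\<^bsub>B\<^esub> = \<one>\<^bsub>B\<^esub>"
  by (simp add: crossed_one_eq_single single_adj)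

lemma crossed_one_mult:
  assumes f: "f \<in> carrier B"
  shows "\<one>\<^bsub>B\<^esub> \<otimes>\<^bsub>B\<^esub> f = f"
proof (intro crossed_eqI crossed_mult_closed crossed_one_closed f)
  fix t assume t: "t \<in> carrier G"
  have "(\<one>\<^bsub>B\<^esub> \<otimes>\<^bsub>B\<^esub> f) t = (\<Oplus>s\<in>carrier G. if \<one>\<^bsub>G\<^esub> = s then f t else \<zero>)"
    unfolding crossed_mult[OF t] crossed_one_eq_single single_def using f t crossed_closed
    by (intro finsum_eqI) auto
  also have "\<dots> = f t" using f t crossed_closed finite_group by (intro finsum_singleton) auto
  finally show "(\<one>\<^bsub>B\<^esub> \<otimes>\<^bsub>B\<^esub> f) t = f t" .
qed

lemma crossed_adj_zero_mult_zero: "adj B \<zero>\<^bsub>B\<^esub> \<otimes>\<^bsub>B\<^esub> \<zero>\<^bsub>B\<^esub> = \<zero>\<^bsub>B\<^esub>"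
proof (intro crossed_eqI crossed_mult_closed crossed_adj_closed crossed_zero_closed)
  fix t assume t: "t \<in> carrier G"
  have "(adj B \<zero>\<^bsub>B\<^esub> \<otimes>\<^bsub>B\<^esub> \<zero>\<^bsub>B\<^esub>) t = (\<Oplus>s\<in>carrier G. \<zero>)"
    unfolding crossed_mult[OF t] using t by (intro finsum_eqI) (auto simp: crossed_adj crossed_zero)
  then show "(adj B \<zero>\<^bsub>B\<^esub> \<otimes>\<^bsub>B\<^esub> \<zero>\<^bsub>B\<^esub>) t = \<zero>\<^bsub>B\<^esub> t"
    using t by (simp add: finsum_zero crossed_zero)
qed

lemma regular_one:
  assumes "t \<in> carrier G" "r \<in> carrier G"
  shows "regular \<one>\<^bsub>B\<^esub> t r = (if t = r then \<one> else \<zero>)"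
proof -
  have "t \<otimes>\<^bsub>G\<^esub> inv\<^bsub>G\<^esub> r = \<one>\<^bsub>G\<^esub> \<longleftrightarrow> t = r"
    using assms by (metis G.inv_closed G.inv_equality G.inv_inv G.r_inv)
  then show ?thesis
    using assms by (simp add: regular_def crossed_one_eq_single single_def)
qed

text \<open>\<open>amplify k \<phi>\<close> is \<open>\<phi> \<otimes> id\<close> on \<open>M\<^sub>N(A)\<close>, composed with the regular representation.\<close>

definition amplify ::
    "nat \<Rightarrow> ('a \<Rightarrow> nat \<Rightarrow> nat \<Rightarrow> complex) \<Rightarrow> ('g \<Rightarrow> 'a) \<Rightarrow> nat \<Rightarrow> nat \<Rightarrow> complex" where
  "amplify k \<phi> f = block_mat N k (\<lambda>s t. \<phi> (regular f (enum s) (enum t)))"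

context
  fixes k :: nat and \<phi>
  assumes cp: "cp_contractive A (cmat k) \<phi>"
begin

lemma cp_closed: "x \<in> carrier A \<Longrightarrow> \<phi> x \<in> carrier (cmat k)"
  using cp by (auto simp: cp_contractive_def cstar_linear_def)

lemma cp_add: "x \<in> carrier A \<Longrightarrow> y \<in> carrier A \<Longrightarrow> \<phi> (x \<oplus> y) = (\<lambda>i j. \<phi> x i j + \<phi> y i j)"
  using cp by (auto simp: cp_contractive_def cstar_linear_def cmat_add)

lemma cp_scale: "x \<in> carrier A \<Longrightarrow> \<phi> (c \<odot> x) = (\<lambda>i j. c * \<phi> x i j)"
  using cp by (auto simp: cp_contractive_def cstar_linear_def cmat_scale)

lemma cp_zero: "\<phi> \<zero> = (\<lambda>i j. 0)"
  using cp_scale[of \<zero> 0] by simp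

lemma cp_finsum:
  assumes "finite I" "\<And>i. i \<in> I \<Longrightarrow> f i \<in> carrier A"
  shows "\<phi> (\<Oplus>i\<in>I. f i) = (\<lambda>a b. \<Sum>i\<in>I. \<phi> (f i) a b)"
  using assms
proof (induction I rule: finite_induct)
  case (insert i I)
  then have "f i \<in> carrier A" "f \<in> I \<rightarrow> carrier A" by auto
  then show ?case using insert by (simp add: cp_add)
qed (simp add: cp_zero)

lemma cp_cnorm_le: "x \<in> carrier A \<Longrightarrow> cnorm (cmat k) (\<phi> x) \<le> cnorm A x"
  using cp by (auto simp: cp_contractive_def)

lemma amplify_closed: "amplify k \<phi> f \<in> carrier (cmat (N * k))"
  unfolding amplify_def by (rule block_mat_closed)

lemma amplify_linear: "cstar_linear B (cmat (N * k)) (amplify k \<phi>)"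
  unfolding cstar_linear_def
proof (intro conjI ballI allI)
  show "amplify k \<phi> \<in> carrier B \<rightarrow> carrier (cmat (N * k))" using amplify_closed by blast
  show "amplify k \<phi> (f \<oplus>\<^bsub>B\<^esub> h) = amplify k \<phi> f \<oplus>\<^bsub>cmat (N * k)\<^esub> amplify k \<phi> h"
    if "f \<in> carrier B" "h \<in> carrier B" for f h
    unfolding amplify_def cmat_add using that
    by (intro ext) (auto simp: block_mat_def regular_add cp_add less_mult_imp_div_less)
  show "amplify k \<phi> (c \<odot>\<^bsub>B\<^esub> f) = c \<odot>\<^bsub>cmat (N * k)\<^esub> amplify k \<phi> f"
    if "f \<in> carrier B" for c f
    unfolding amplify_def cmat_scale using that
    by (intro ext) (auto simp: block_mat_def regular_scale cp_scale less_mult_imp_div_less)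
qed

lemma amplify_zero: "amplify k \<phi> \<zero>\<^bsub>B\<^esub> = (\<lambda>a b. 0)"
  unfolding amplify_def
  by (intro ext) (auto simp: block_mat_def regular_def crossed_zero cp_zero less_mult_imp_div_less)

text \<open>Positivity at level n comes from complete positivity of \<phi> at level n N. If X = Y* Y
  over \<open>B\<close>, applying \<open>regular\<close> entrywise gives a matrix Y' of size n N
  over \<open>A\<close>, and the entries of Y'* Y' are those of \<open>regular (X i j)\<close>. The
  factor W obtained from \<phi> only has to be regrouped.\<close>

lemma amplify_positive:
  assumes "cstar_positive (matrix_algebra n B) X"
  shows "cstar_positive (matrix_algebra n (cmat (N * k))) (\<lambda>i j. amplify k \<phi> (X i j))"
proof -
  obtain Y where Y: "Y \<in> carrier (matrix_algebra n B)"
    and X: "X = adj (matrix_algebra n B) Y \<otimes>\<^bsub>matrix_algebra n B\<^esub> Y"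
    using assms unfolding cstar_positive_def by blast
  have Yc: "Y i j \<in> carrier B" if "i < n" "j < n" for i j
    using Y that by (simp add: matrix_algebra_def)
  have YYc: "adj B (Y l i) \<otimes>\<^bsub>B\<^esub> Y l j \<in> carrier B" if "l < n" "i < n" "j < n" for l i j
    using Yc that by (intro crossed_mult_closed crossed_adj_closed) auto
  have Xe: "X i j = (if i < n \<and> j < n then \<Oplus>\<^bsub>B\<^esub>l\<in>{..<n}. adj B (Y l i) \<otimes>\<^bsub>B\<^esub> Y l j else \<zero>\<^bsub>B\<^esub>)" for i j
    by (simp add: X matrix_algebra_def)
  define R where "R = (\<lambda>l r i s. regular (Y l i) (enum r) (enum s))"
  have Rc: "R l r i s \<in> carrier A" if "l < n" "r < N" "i < n" "s < N" for l r i s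
    using Yc that by (auto simp: R_def)
  have regX: "regular (X i j) (enum s) (enum t) = (\<Oplus>l\<in>{..<n}. \<Oplus>r\<in>{..<N}. adj A (R l r i s) \<otimes> R l r j t)"
    if ij: "i < n" "j < n" "s < N" "t < N" for i j s t
  proof -
    have "regular (X i j) (enum s) (enum t)
        = (\<Oplus>l\<in>{..<n}. regular (adj B (Y l i) \<otimes>\<^bsub>B\<^esub> Y l j) (enum s) (enum t))"
    proof -
      have "X i j = (\<Oplus>\<^bsub>B\<^esub>l\<in>{..<n}. adj B (Y l i) \<otimes>\<^bsub>B\<^esub> Y l j)" using ij by (simp add: Xe)
      then show ?thesis using ij YYc by (simp only:) (intro regular_finsum, auto)
    qed
    also have "\<dots> = (\<Oplus>l\<in>{..<n}. \<Oplus>r\<in>{..<N}. adj A (R l r i s) \<otimes> R l r j t)"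
    proof (intro finsum_eqI finsum_closed_family)
      fix l assume l: "l \<in> {..<n}"
      have "regular (adj B (Y l i) \<otimes>\<^bsub>B\<^esub> Y l j) (enum s) (enum t)
          = (\<Oplus>r\<in>carrier G. adj A (regular (Y l i) r (enum s)) \<otimes> regular (Y l j) r (enum t))"
        using ij l Yc crossed_adj_closed by (auto simp: regular_mult regular_adj intro!: finsum_eqI)
      also have "\<dots> = (\<Oplus>r\<in>{..<N}. adj A (R l r i s) \<otimes> R l r j t)"
        unfolding R_def using ij l Yc by (intro finsum_enum) auto
      finally show "regular (adj B (Y l i) \<otimes>\<^bsub>B\<^esub> Y l j) (enum s) (enum t)
          = (\<Oplus>r\<in>{..<N}. adj A (R l r i s) \<otimes> R l r j t)" .
    qed (use Rc ij in auto)
    finally show ?thesis .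
  qed
  let ?M = "matrix_algebra (n * N) A"
  \<comment> \<open>The index i * N + s combines the matrix position i with the group element
    \<open>enum s\<close>.\<close>
  define Y' where "Y' = (\<lambda>P Q. if P < n * N \<and> Q < n * N then R (P div N) (P mod N) (Q div N) (Q mod N) else \<zero>)"
  define X' where "X' = adj ?M Y' \<otimes>\<^bsub>?M\<^esub> Y'"
  have "Y' \<in> carrier ?M"
    using Rc by (auto simp: matrix_algebra_def Y'_def less_mult_imp_div_less mod_less_of_less_mult)
  then have "cstar_positive ?M X'" unfolding cstar_positive_def X'_def by blast
  then have "cstar_positive (matrix_algebra (n * N) (cmat k)) (\<lambda>P Q. \<phi> (X' P Q))"
    using cp unfolding cp_contractive_def by blast
  then obtain W where W: "\<And>P Q a b. P < n * N \<Longrightarrow> Q < n * N \<Longrightarrow> a < k \<Longrightarrow> b < k \<Longrightarrow>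
      \<phi> (X' P Q) a b = (\<Sum>T<n * N. \<Sum>c<k. cnj (W T P c a) * W T Q c b)"
    unfolding cstar_positive_cmat_matrix by blast
  have idx: "i * N + s < n * N" if "i < n" "s < N" for i s
  proof -
    have "i * N + s < Suc i * N" using that by simp
    also have "\<dots> \<le> n * N" using that by (intro mult_le_mono1) simp
    finally show ?thesis .
  qed
  have X'reg: "X' (i * N + s) (j * N + t) = regular (X i j) (enum s) (enum t)"
    if ij: "i < n" "j < n" "s < N" "t < N" for i j s t
  proof -
    have "X' (i * N + s) (j * N + t)
        = (\<Oplus>T\<in>{..<n * N}. adj A (Y' T (i * N + s)) \<otimes> Y' T (j * N + t))"
      using idx[OF ij(1,3)] idx[OF ij(2,4)] by (simp add: X'_def matrix_algebra_def)
    also have "\<dots> = (\<Oplus>T\<in>{..<n * N}. adj A (R (T div N) (T mod N) i s) \<otimes> R (T div N) (T mod N) j t)"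
      using ij idx[OF ij(1,3)] idx[OF ij(2,4)] Rc
      by (intro finsum_eqI) (auto simp: Y'_def less_mult_imp_div_less mod_less_of_less_mult)
    also have "\<dots> = (\<Oplus>l\<in>{..<n}. \<Oplus>r\<in>{..<N}. adj A (R l r i s) \<otimes> R l r j t)"
      using ij Rc by (intro finsum_div_mod[where F = "\<lambda>l r. adj A (R l r i s) \<otimes> R l r j t"]) auto
    finally show ?thesis using regX[OF ij] by simp
  qed
  \<comment> \<open>Regrouping of ((l, r), c) as (l, (r, c)), that is, of M_(n N)(M_k) as M_n(M_(N
    k)).\<close>
  define V where "V = (\<lambda>l i C a. W (l * N + C div k) (i * N + a div k) (C mod k) (a mod k))"
  have "amplify k \<phi> (X i j) a b = (\<Sum>l<n. \<Sum>C<N * k. cnj (V l i C a) * V l j C b)"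
    if ij: "i < n" "j < n" and ab: "a < N * k" "b < N * k" for i j a b
  proof -
    have s: "a div k < N" "b div k < N" "a mod k < k" "b mod k < k"
      using ab less_mult_imp_div_less mod_less_of_less_mult by auto
    define P Q where "P = i * N + a div k" and "Q = j * N + b div k"
    have "amplify k \<phi> (X i j) a b = \<phi> (X' P Q) (a mod k) (b mod k)"
      unfolding amplify_def block_mat_def P_def Q_def using ab X'reg[OF ij s(1,2)] by simp
    also have "\<dots> = (\<Sum>T<n * N. \<Sum>c<k. cnj (W T P c (a mod k)) * W T Q c (b mod k))"
      unfolding P_def Q_def using idx ij s by (intro W) auto
    also have "\<dots> = (\<Sum>T<n * N. \<Sum>c<k. cnj (W (T div N * N + T mod N) P c (a mod k))
        * W (T div N * N + T mod N) Q c (b mod k))"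
      by simp
    also have "\<dots> = (\<Sum>l<n. \<Sum>r<N. \<Sum>c<k. cnj (W (l * N + r) P c (a mod k)) * W (l * N + r) Q c (b mod k))"
      by (rule sum_div_mod[where F = "\<lambda>l r. \<Sum>c<k. cnj (W (l * N + r) P c (a mod k)) * W (l * N + r) Q c (b mod k)"])
    also have "\<dots> = (\<Sum>l<n. \<Sum>C<N * k. cnj (V l i C a) * V l j C b)"
      unfolding V_def P_def[symmetric] Q_def[symmetric]
      by (intro sum.cong refl sum_div_mod[symmetric])
    finally show ?thesis .
  qed
  then have "\<exists>V. \<forall>i<n. \<forall>j<n. \<forall>a<N * k. \<forall>b<N * k.
      amplify k \<phi> (X i j) a b = (\<Sum>l<n. \<Sum>C<N * k. cnj (V l i C a) * V l j C b)"
    by blast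
  moreover have "amplify k \<phi> (X i j) = (\<lambda>a b. 0)" if "\<not> (i < n \<and> j < n)" for i j
    unfolding Xe using that amplify_zero by auto
  ultimately show ?thesis
    unfolding cstar_positive_cmat_matrix using amplify_closed by blast
qed

section \<open>Contractivity of the amplification\<close>

lemma cnorm_amplify_one_le: "cnorm (cmat (N * k)) (amplify k \<phi> \<one>\<^bsub>B\<^esub>) \<le> 1"
proof -
  have "amplify k \<phi> \<one>\<^bsub>B\<^esub> = block_mat N k (\<lambda>s t. if s = t then \<phi> \<one> else (\<lambda>i j. 0))"
    unfolding amplify_def by (intro block_mat_cong) (simp add: regular_one enum_eq_iff cp_zero)
  then have "cnorm (cmat (N * k)) (amplify k \<phi> \<one>\<^bsub>B\<^esub>) \<le> cnorm (cmat k) (\<phi> \<one>)"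
    using cmat_cnorm_diag_block_mat_le by simp
  also have "\<dots> \<le> 1" using cp_cnorm_le[of \<one>] cnorm_one_le by simp
  finally show ?thesis .
qed

text \<open>Y has first row (1, f) and second row 0, so X = Y* Y has the entries 1, f in its first
  row and f*, f* f in its second. Positivity of its image makes the images of 1, f and f* f Gram
  matrices of two families U and V, to which the norm estimate applies; the image of 1 is a
  contraction.\<close>

lemma amplify_Kadison_Schwarz:
  assumes f: "f \<in> carrier B"
  shows "(cnorm (cmat (N * k)) (amplify k \<phi> f))\<^sup>2 \<le> cnorm (cmat (N * k)) (amplify k \<phi> (adj B f \<otimes>\<^bsub>B\<^esub> f))"
proof -
  interpret B: abelian_monoid B by (rule crossed_abelian_monoid)
  define Y :: "nat \<Rightarrow> nat \<Rightarrow> 'g \<Rightarrow> 'a"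
    where "Y = (\<lambda>i j. if i = 0 \<and> j = 0 then \<one>\<^bsub>B\<^esub> else if i = 0 \<and> j = 1 then f else \<zero>\<^bsub>B\<^esub>)"
  define X where "X = adj (matrix_algebra 2 B) Y \<otimes>\<^bsub>matrix_algebra 2 B\<^esub> Y"
  have "Y \<in> carrier (matrix_algebra 2 B)"
    using f crossed_one_closed crossed_zero_closed by (auto simp: matrix_algebra_def Y_def)
  then have "cstar_positive (matrix_algebra 2 B) X" unfolding X_def cstar_positive_def by blast
  then have "cstar_positive (matrix_algebra 2 (cmat (N * k))) (\<lambda>i j. amplify k \<phi> (X i j))"
    by (rule amplify_positive)
  then obtain W :: "nat \<Rightarrow> nat \<Rightarrow> nat \<Rightarrow> nat \<Rightarrow> complex"
    where W: "\<And>i j a b. i < 2 \<Longrightarrow> j < 2 \<Longrightarrow> a < N * k \<Longrightarrow> b < N * k \<Longrightarrow>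
      amplify k \<phi> (X i j) a b = (\<Sum>l<2. \<Sum>c<N * k. cnj (W l i c a) * W l j c b)"
    unfolding cstar_positive_cmat_matrix by blast
  have Xe: "X i j = adj B (Y 0 i) \<otimes>\<^bsub>B\<^esub> Y 0 j" if ij: "i < 2" "j < 2" for i j
  proof -
    have c: "adj B (Y 0 i) \<otimes>\<^bsub>B\<^esub> Y 0 j \<in> carrier B"
      using f ij by (intro crossed_mult_closed crossed_adj_closed)
        (auto simp: Y_def crossed_one_closed crossed_zero_closed)
    have "X i j = (\<Oplus>\<^bsub>B\<^esub>l\<in>{..<2}. adj B (Y l i) \<otimes>\<^bsub>B\<^esub> Y l j)"
      using ij by (simp add: X_def matrix_algebra_def)
    also have "{..<2::nat} = {0, 1}" by auto
    also have "(\<Oplus>\<^bsub>B\<^esub>l\<in>{0, 1}. adj B (Y l i) \<otimes>\<^bsub>B\<^esub> Y l j)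
        = adj B (Y 0 i) \<otimes>\<^bsub>B\<^esub> Y 0 j \<oplus>\<^bsub>B\<^esub> adj B (Y 1 i) \<otimes>\<^bsub>B\<^esub> Y 1 j"
      using c by (simp add: Y_def crossed_adj_zero_mult_zero crossed_zero_closed)
    also have "adj B (Y 1 i) \<otimes>\<^bsub>B\<^esub> Y 1 j = \<zero>\<^bsub>B\<^esub>"
      by (simp add: Y_def crossed_adj_zero_mult_zero)
    finally show ?thesis using c by simp
  qed
  have X00: "X 0 0 = \<one>\<^bsub>B\<^esub>" and X01: "X 0 1 = f" and X11: "X 1 1 = adj B f \<otimes>\<^bsub>B\<^esub> f"
    using f by (simp_all add: Xe Y_def crossed_adj_one crossed_one_mult crossed_one_closed)
  have sums: "(\<Sum>l<2. \<Sum>c<N * k. F l c) = (\<Sum>x\<in>{..<2::nat} \<times> {..<N * k}. F (fst x) (snd x))"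
    for F :: "nat \<Rightarrow> nat \<Rightarrow> complex"
    by (simp add: sum.cartesian_product case_prod_unfold)
  have "(cnorm (cmat (N * k)) (amplify k \<phi> f))\<^sup>2
      \<le> cnorm (cmat (N * k)) (amplify k \<phi> \<one>\<^bsub>B\<^esub>) * cnorm (cmat (N * k)) (amplify k \<phi> (adj B f \<otimes>\<^bsub>B\<^esub> f))"
  proof (rule cmat_cnorm_gram_le[where S = "{..<2::nat} \<times> {..<N * k}"
        and U = "\<lambda>x a. W (fst x) 0 (snd x) a" and V = "\<lambda>x a. W (fst x) 1 (snd x) a"])
    fix a b assume ab: "a < N * k" "b < N * k"
    show "amplify k \<phi> \<one>\<^bsub>B\<^esub> a b = (\<Sum>x\<in>{..<2} \<times> {..<N * k}. cnj (W (fst x) 0 (snd x) a) * W (fst x) 0 (snd x) b)"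
      using W[of 0 0 a b] ab X00 sums[of "\<lambda>l c. cnj (W l 0 c a) * W l 0 c b"] by simp
    show "amplify k \<phi> f a b = (\<Sum>x\<in>{..<2} \<times> {..<N * k}. cnj (W (fst x) 0 (snd x) a) * W (fst x) 1 (snd x) b)"
      using W[of 0 1 a b] ab X01 sums[of "\<lambda>l c. cnj (W l 0 c a) * W l 1 c b"] by simp
    show "amplify k \<phi> (adj B f \<otimes>\<^bsub>B\<^esub> f) a b
        = (\<Sum>x\<in>{..<2} \<times> {..<N * k}. cnj (W (fst x) 1 (snd x) a) * W (fst x) 1 (snd x) b)"
      using W[of 1 1 a b] ab X11 sums[of "\<lambda>l c. cnj (W l 1 c a) * W l 1 c b"] by simp
  qed
  also have "\<dots> \<le> 1 * cnorm (cmat (N * k)) (amplify k \<phi> (adj B f \<otimes>\<^bsub>B\<^esub> f))"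
    by (intro mult_right_mono cnorm_amplify_one_le) simp
  finally show ?thesis by simp
qed

lemma cnorm_amplify_crude:
  assumes f: "f \<in> carrier B"
  shows "cnorm (cmat (N * k)) (amplify k \<phi> f) \<le> real (N * N) * cnorm B f"
proof -
  have "cnorm (cmat (N * k)) (amplify k \<phi> f)
      \<le> (\<Sum>s<N. \<Sum>t<N. cnorm (cmat k) (\<phi> (regular f (enum s) (enum t))))"
    unfolding amplify_def by (rule cmat_cnorm_block_mat_le)
  also have "\<dots> \<le> (\<Sum>s<N. \<Sum>t<N. cnorm B f)"
  proof (intro sum_mono)
    fix s t assume st: "s \<in> {..<N}" "t \<in> {..<N}"
    have "cnorm (cmat k) (\<phi> (regular f (enum s) (enum t))) \<le> cnorm A (regular f (enum s) (enum t))"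
      using f st by (intro cp_cnorm_le) auto
    also have "\<dots> \<le> cnorm B f"
      unfolding cnorm_crossed[OF f] using f st by (intro cnorm_entry_le_opnorm finite_group) auto
    finally show "cnorm (cmat k) (\<phi> (regular f (enum s) (enum t))) \<le> cnorm B f" .
  qed
  finally show ?thesis by simp
qed

text \<open>The constant of the crude bound disappears on iterating the Kadison--Schwarz inequality.\<close>

lemma cnorm_amplify_le:
  assumes f: "f \<in> carrier B"
  shows "cnorm (cmat (N * k)) (amplify k \<phi> f) \<le> cnorm B f"
proof -
  have nn: "0 \<le> cnorm B h" if "h \<in> carrier B" for h
    unfolding cnorm_crossed[OF that] using that by (intro opnorm_nonneg finite_group) auto
  \<comment> \<open>Passing from h to h* h doubles the exponent on both sides and leaves the
    constant N * N of the crude bound untouched.\<close>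
  have iter: "cnorm (cmat (N * k)) (amplify k \<phi> h) ^ (2 ^ n) \<le> real (N * N) * cnorm B h ^ (2 ^ n)"
    if "h \<in> carrier B" for n h
    using that
  proof (induction n arbitrary: h)
    case 0
    then show ?case using cnorm_amplify_crude by simp
  next
    case (Suc n)
    let ?hh = "adj B h \<otimes>\<^bsub>B\<^esub> h"
    have hh: "?hh \<in> carrier B" using Suc.prems by (intro crossed_mult_closed crossed_adj_closed)
    have "cnorm (cmat (N * k)) (amplify k \<phi> h) ^ (2 ^ Suc n) = ((cnorm (cmat (N * k)) (amplify k \<phi> h))\<^sup>2) ^ (2 ^ n)"
      by (simp flip: power_mult)
    also have "\<dots> \<le> cnorm (cmat (N * k)) (amplify k \<phi> ?hh) ^ (2 ^ n)"
      by (intro power_mono amplify_Kadison_Schwarz Suc.prems) simp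
    also have "\<dots> \<le> real (N * N) * cnorm B ?hh ^ (2 ^ n)" by (rule Suc.IH[OF hh])
    also have "\<dots> \<le> real (N * N) * ((cnorm B h)\<^sup>2) ^ (2 ^ n)"
      by (intro mult_left_mono power_mono crossed_adj_mult_cnorm_le Suc.prems nn hh) simp
    also have "\<dots> = real (N * N) * cnorm B h ^ (2 ^ Suc n)" by (simp flip: power_mult)
    finally show ?case .
  qed
  show ?thesis
  proof (cases "cnorm B f = 0")
    case True
    then show ?thesis using cnorm_amplify_crude[OF f] by simp
  next
    case False
    then have p: "cnorm B f > 0" using nn[OF f] by simp
    have "cnorm (cmat (N * k)) (amplify k \<phi> f) / cnorm B f \<le> 1"
    proof (rule le_one_of_power_pow2_le)
      fix n
      have "(cnorm (cmat (N * k)) (amplify k \<phi> f) / cnorm B f) ^ (2 ^ n) \<le> real (N * N) * 1"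
        using iter[OF f, of n] p by (simp add: power_divide pos_divide_le_eq)
      also have "\<dots> \<le> real (N * N) * (2 ^ n + 1)" by (intro mult_left_mono) auto
      finally show "(cnorm (cmat (N * k)) (amplify k \<phi> f) / cnorm B f) ^ (2 ^ n) \<le> \<dots>" .
    qed (use p in simp)
    then show ?thesis using p by simp
  qed
qed

lemma amplify_cp_contractive: "cp_contractive B (cmat (N * k)) (amplify k \<phi>)"
  unfolding cp_contractive_def
  using amplify_linear amplify_positive cnorm_amplify_le by blast

text \<open>Since \<open>regular\<close> is multiplicative, block (s, t) of the defect is the sum
  over r of the defects of \<phi> at the pairs of entries being multiplied. There are finitely many
  such pairs for given f and h.\<close>

lemma amplify_mult_defect:
  assumes f: "f \<in> carrier B" and h: "h \<in> carrier B"
  shows "cnorm (cmat (N * k)) (amplify k \<phi> (f \<otimes>\<^bsub>B\<^esub> h) \<ominus>\<^bsub>cmat (N * k)\<^esub>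
      (amplify k \<phi> f \<otimes>\<^bsub>cmat (N * k)\<^esub> amplify k \<phi> h))
    \<le> (\<Sum>s<N. \<Sum>t<N. \<Sum>r<N. cnorm (cmat k)
        (\<phi> (regular f (enum s) (enum r) \<otimes> regular h (enum r) (enum t)) \<ominus>\<^bsub>cmat k\<^esub>
          (\<phi> (regular f (enum s) (enum r)) \<otimes>\<^bsub>cmat k\<^esub> \<phi> (regular h (enum r) (enum t)))))"
proof -
  define x y where "x = (\<lambda>s r. regular f (enum s) (enum r))" and "y = (\<lambda>r t. regular h (enum r) (enum t))"
  have c: "x s r \<in> carrier A" "y s r \<in> carrier A" if "s < N" "r < N" for s r
    using f h that by (auto simp: x_def y_def)
  define D where "D = (\<lambda>s t r. \<phi> (x s r \<otimes> y r t) \<ominus>\<^bsub>cmat k\<^esub> (\<phi> (x s r) \<otimes>\<^bsub>cmat k\<^esub> \<phi> (y r t)))"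
  have D: "D s t r = (\<lambda>i j. \<phi> (x s r \<otimes> y r t) i j - (\<phi> (x s r) \<otimes>\<^bsub>cmat k\<^esub> \<phi> (y r t)) i j)"
    if "s < N" "t < N" "r < N" for s t r
    unfolding D_def using c that by (intro cmat_diff cp_closed cmat_mult_closed m_closed) auto
  have "amplify k \<phi> (f \<otimes>\<^bsub>B\<^esub> h) = block_mat N k (\<lambda>s t i j. \<Sum>r<N. \<phi> (x s r \<otimes> y r t) i j)"
    unfolding amplify_def
  proof (intro block_mat_cong)
    fix s t i j assume st: "s < N" "t < N"
    have "regular (f \<otimes>\<^bsub>B\<^esub> h) (enum s) (enum t) = (\<Oplus>r\<in>{..<N}. x s r \<otimes> y r t)"
      unfolding x_def y_def using f h st by (simp add: regular_mult finsum_enum)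
    moreover have "\<phi> (\<Oplus>r\<in>{..<N}. x s r \<otimes> y r t) = (\<lambda>i j. \<Sum>r<N. \<phi> (x s r \<otimes> y r t) i j)"
      using c st by (intro cp_finsum) auto
    ultimately show "\<phi> (regular (f \<otimes>\<^bsub>B\<^esub> h) (enum s) (enum t)) i j = (\<Sum>r<N. \<phi> (x s r \<otimes> y r t) i j)"
      by simp
  qed
  then have "amplify k \<phi> (f \<otimes>\<^bsub>B\<^esub> h) \<ominus>\<^bsub>cmat (N * k)\<^esub>
      (amplify k \<phi> f \<otimes>\<^bsub>cmat (N * k)\<^esub> amplify k \<phi> h)
    = block_mat N k (\<lambda>s t i j. (\<Sum>r<N. \<phi> (x s r \<otimes> y r t) i j)
        - (\<Sum>r<N. (\<phi> (x s r) \<otimes>\<^bsub>cmat k\<^esub> \<phi> (y r t)) i j))"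
    by (simp only: amplify_def x_def y_def block_mat_mult block_mat_diff)
  also have "\<dots> = block_mat N k (\<lambda>s t i j. \<Sum>r<N. D s t r i j)"
    by (intro block_mat_cong) (simp add: D sum_subtractf)
  finally have "cnorm (cmat (N * k)) (amplify k \<phi> (f \<otimes>\<^bsub>B\<^esub> h) \<ominus>\<^bsub>cmat (N * k)\<^esub>
      (amplify k \<phi> f \<otimes>\<^bsub>cmat (N * k)\<^esub> amplify k \<phi> h))
      \<le> (\<Sum>s<N. \<Sum>t<N. cnorm (cmat k) (\<lambda>i j. \<Sum>r<N. D s t r i j))"
    by (simp only: cmat_cnorm_block_mat_le)
  also have "\<dots> \<le> (\<Sum>s<N. \<Sum>t<N. \<Sum>r<N. cnorm (cmat k) (D s t r))"
    by (intro sum_mono cmat_cnorm_sum_le) simp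
  finally show ?thesis by (simp only: D_def x_def y_def)
qed

end

section \<open>Transfer of quasidiagonality\<close>

lemma normalized_trace_amplify:
  assumes f: "f \<in> carrier B"
  shows "normalized_trace (N * k) (amplify k \<phi> f)
    = (\<Sum>s<N. normalized_trace k (\<phi> (\<alpha> (inv\<^bsub>G\<^esub> (enum s)) (f \<one>\<^bsub>G\<^esub>)))) / of_nat N"
proof -
  have "(\<Sum>I<N * k. amplify k \<phi> f I I)
      = (\<Sum>I<N * k. \<phi> (regular f (enum (I div k)) (enum (I div k))) (I mod k) (I mod k))"
    by (simp add: amplify_def block_mat_def)
  also have "\<dots> = (\<Sum>s<N. \<Sum>i<k. \<phi> (regular f (enum s) (enum s)) i i)"
    by (rule sum_div_mod[where F = "\<lambda>s i. \<phi> (regular f (enum s) (enum s)) i i"])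
  \<comment> \<open>As t t^-1 = 1, every diagonal entry of \<open>regular f\<close> is a translate
    of f(1) under the action.\<close>
  also have "\<dots> = (\<Sum>s<N. \<Sum>i<k. \<phi> (\<alpha> (inv\<^bsub>G\<^esub> (enum s)) (f \<one>\<^bsub>G\<^esub>)) i i)"
    by (intro sum.cong refl) (simp add: regular_def)
  finally show ?thesis
    by (simp add: normalized_trace_def sum_divide_distrib mult.commute)
qed

lemma quasidiagonal_crossed_trace:
  assumes rok: "finite_rokhlin_dimension_commuting_towers G A \<alpha>"
    and \<tau>: "\<tau> \<in> tracial_states B"
    and qd: "quasidiagonal_trace A (restricted_trace \<tau>)"
  shows "quasidiagonal_trace B \<tau>"
proof -
  let ?\<rho> = "restricted_trace \<tau>"
  obtain \<N> :: "(nat \<times> ('a \<Rightarrow> nat \<Rightarrow> nat \<Rightarrow> complex)) filter" where nb: "\<N> \<noteq> bot"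
    and cp: "\<forall>\<^sub>F (k, \<phi>) in \<N>. 0 < k \<and> cp_contractive A (cmat k) \<phi>"
    and tr: "\<And>a. a \<in> carrier A \<Longrightarrow>
      ((\<lambda>(k, \<phi>). cmod (normalized_trace k (\<phi> a) - ?\<rho> a)) \<longlongrightarrow> 0) \<N>"
    and mult: "\<And>a b. a \<in> carrier A \<Longrightarrow> b \<in> carrier A \<Longrightarrow>
      ((\<lambda>(k, \<phi>). cnorm (cmat k) (\<phi> (a \<otimes> b) \<ominus>\<^bsub>cmat k\<^esub> (\<phi> a \<otimes>\<^bsub>cmat k\<^esub> \<phi> b))) \<longlongrightarrow> 0) \<N>"
    using qd unfolding quasidiagonal_trace_def by blast
  \<comment> \<open>The image filter corresponds to the net obtained by amplifying each member of
    the given one.\<close>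
  define \<N>' where "\<N>' = filtermap (\<lambda>(k, \<phi>). (N * k, amplify k \<phi>)) \<N>"
  have "\<N>' \<noteq> bot" using nb by (simp add: \<N>'_def filtermap_bot_iff)
  moreover have "\<forall>\<^sub>F (k, \<phi>) in \<N>'. 0 < k \<and> cp_contractive B (cmat k) \<phi>"
    unfolding \<N>'_def eventually_filtermap using cp
    by eventually_elim (auto intro: amplify_cp_contractive N_pos)
  moreover have "((\<lambda>(k, \<phi>). cmod (normalized_trace k (\<phi> f) - \<tau> f)) \<longlongrightarrow> 0) \<N>'"
    if f: "f \<in> carrier B" for f
  proof -
    define a where "a = (\<lambda>s. \<alpha> (inv\<^bsub>G\<^esub> (enum s)) (f \<one>\<^bsub>G\<^esub>))"
    \<comment> \<open>By invariance all N translates of f(1) have the trace \<tau> f, so the average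
      over the diagonal blocks converges to \<tau> f as well.\<close>
    have a: "a s \<in> carrier A" "?\<rho> (a s) = \<tau> f" if "s < N" for s
      using f that crossed_closed[OF f] trace_eq_restricted_trace[OF rok \<tau> f]
      by (auto simp: a_def restricted_trace_invariant[OF \<tau>])
    have lim: "((\<lambda>x. \<Sum>s<N. cmod (normalized_trace (fst x) (snd x (a s)) - \<tau> f)) \<longlongrightarrow> 0) \<N>"
    proof (intro tendsto_null_sum)
      fix s assume "s \<in> {..<N}"
      then show "((\<lambda>x. cmod (normalized_trace (fst x) (snd x (a s)) - \<tau> f)) \<longlongrightarrow> 0) \<N>"
        using tr[of "a s"] a by (simp add: case_prod_unfold)
    qed
    have bound: "cmod (normalized_trace (N * k) (amplify k \<phi> f) - \<tau> f)
        \<le> (\<Sum>s<N. cmod (normalized_trace k (\<phi> (a s)) - \<tau> f))" for k \<phi>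
    proof -
      have "normalized_trace (N * k) (amplify k \<phi> f) - \<tau> f
          = (\<Sum>s<N. normalized_trace k (\<phi> (a s)) - \<tau> f) / of_nat N"
        unfolding normalized_trace_amplify[OF f] a_def using N_pos
        by (simp add: sum_subtractf diff_divide_distrib)
      then have "cmod (normalized_trace (N * k) (amplify k \<phi> f) - \<tau> f)
          = cmod (\<Sum>s<N. normalized_trace k (\<phi> (a s)) - \<tau> f) / real N"
        by (simp add: norm_divide)
      also have "\<dots> \<le> cmod (\<Sum>s<N. normalized_trace k (\<phi> (a s)) - \<tau> f)"
        using N_pos by (simp add: divide_le_eq mult_le_cancel_left1)
      also have "\<dots> \<le> (\<Sum>s<N. cmod (normalized_trace k (\<phi> (a s)) - \<tau> f))" by (rule norm_sum)
      finally show ?thesis .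
    qed
    show ?thesis
      unfolding \<N>'_def filterlim_filtermap
      by (rule Lim_null_comparison[OF always_eventually lim]) (simp add: case_prod_unfold bound)
  qed
  moreover have "((\<lambda>(k, \<phi>). cnorm (cmat k) (\<phi> (f \<otimes>\<^bsub>B\<^esub> h) \<ominus>\<^bsub>cmat k\<^esub> (\<phi> f \<otimes>\<^bsub>cmat k\<^esub> \<phi> h))) \<longlongrightarrow> 0) \<N>'"
    if f: "f \<in> carrier B" and h: "h \<in> carrier B" for f h
  proof -
    define x y where "x = (\<lambda>s r. regular f (enum s) (enum r))" and "y = (\<lambda>r t. regular h (enum r) (enum t))"
    define E where "E = (\<lambda>p. \<Sum>s<N. \<Sum>t<N. \<Sum>r<N. (case p of (k, \<phi>) \<Rightarrow>
      cnorm (cmat k) (\<phi> (x s r \<otimes> y r t) \<ominus>\<^bsub>cmat k\<^esub> (\<phi> (x s r) \<otimes>\<^bsub>cmat k\<^esub> \<phi> (y r t)))))"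
    \<comment> \<open>E is a finite sum of multiplicative defects of \<phi> at fixed pairs of
      elements of \<open>A\<close>, each of which tends to 0 along the filter.\<close>
    have "(E \<longlongrightarrow> 0) \<N>"
      unfolding E_def using f h by (intro tendsto_null_sum mult) (auto simp: x_def y_def)
    moreover have "\<forall>\<^sub>F p in \<N>. norm (case (case p of (k, \<phi>) \<Rightarrow> (N * k, amplify k \<phi>)) of (k, \<phi>) \<Rightarrow>
        cnorm (cmat k) (\<phi> (f \<otimes>\<^bsub>B\<^esub> h) \<ominus>\<^bsub>cmat k\<^esub> (\<phi> f \<otimes>\<^bsub>cmat k\<^esub> \<phi> h))) \<le> E p"
      using cp
    proof eventually_elim
      case (elim p)
      obtain k \<phi> where p: "p = (k, \<phi>)" by (cases p)
      then have "cp_contractive A (cmat k) \<phi>" using elim by simp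
      then show ?case
        unfolding p E_def prod.case x_def y_def real_norm_def abs_of_nonneg[OF cmat_cnorm_nonneg]
        by (rule amplify_mult_defect[OF _ f h])
    qed
    ultimately show ?thesis
      unfolding \<N>'_def filterlim_filtermap by (rule Lim_null_comparison[rotated])
  qed
  ultimately show ?thesis unfolding quasidiagonal_trace_def by blast
qed

end

theorem corollary3p10:
  fixes A :: "'a cstar_struct"
    and G :: "('g, 'm) monoid_scheme"
    and \<alpha> :: "'g \<Rightarrow> 'a \<Rightarrow> 'a"
  assumes "cstar_algebra A"
    and "cstar_simple A"
    and "cstar_exact A"
    and "cstar_finite A"
    and "cstar_separable A"
    and "strict_comparison A"
    and "countable (extreme_traces A)"
    and "group G"
    and "finite (carrier G)"
    and "cstar_action G A \<alpha>"
    and "finite_rokhlin_dimension_commuting_towers G A \<alpha>"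
    and "\<forall>\<tau>\<in>tracial_states A. quasidiagonal_trace A \<tau>"
  shows "\<forall>\<tau>\<in>tracial_states (crossed_product G A \<alpha>).
           quasidiagonal_trace (crossed_product G A \<alpha>) \<tau>"
proof
  fix \<tau>
  assume \<tau>: "\<tau> \<in> tracial_states (crossed_product G A \<alpha>)"
  interpret finite_cstar_dynamics A G \<alpha>
    using assms(1,8,9,10)
    by (simp add: finite_cstar_dynamics_def finite_cstar_dynamics_axioms_def unital_cstar_def
        unital_cstar_axioms_def cstar_algebra_def)
  show "quasidiagonal_trace (crossed_product G A \<alpha>) \<tau>"
    using assms(12) restricted_trace_tracial[OF \<tau>]
    by (intro quasidiagonal_crossed_trace[OF assms(11) \<tau>]) blast
qed

end
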